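(* Let $\mathbf{k}$ be any field and let $n\ge 2$ be an integer. (1) If $n$ is even and $\mathrm{char}(\mathbf{k})\neq 2$, then every monomial transformation of $\mathbb{P}^n_{\mathbf{k}}$ belongs to $G_n(\mathbf{k})$. (2) If $n$ is odd, there are monomial transformations of $\mathbb{P}^n_{\mathbf{k}}$ which do not belong to $G_n(\mathbf{k})$. (3) If $n$ is odd and $\mathrm{char}(\mathbf{k})\neq 2$, then the group of monomial transformations that belong to $G_n(\mathbf{k})$ is equal to $$(\mathbf{k}^* )^n\rtimes \mathrm{GL}(n,\mathbb{Z})_{\mathrm{odd}},$$ where $\mathrm{GL}(n,\mathbb{Z})_{\mathrm{odd}}$ is the subgroup of $\mathrm{GL}(n,\mathbb{Z})$ consisting of the matrices such that each column has an odd number of odd entries (equivalently, an odd sum of entries).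
   Context: $\mathrm{Bir}(\mathbb{P}^n_{\mathbf{k}})$ is the group of birational transformations of $\mathbb{P}^n_{\mathbf{k}}$ (defined over $\mathbf{k}$). The standard involution is $$\sigma_n\colon [x_0:\dots:x_n]\dashrightarrow \left[\tfrac{1}{x_0}:\dots:\tfrac{1}{x_n}\right]=[x_1x_2\cdots x_n:x_0x_2x_3\cdots x_n:\dots:x_0x_1\cdots x_{n-1}],$$ and $G_n(\mathbf{k})=\langle \sigma_n,\mathrm{Aut}(\mathbb{P}^n_{\mathbf{k}})\rangle\subset \mathrm{Bir}(\mathbb{P}^n_{\mathbf{k}})$, where $\mathrm{Aut}(\mathbb{P}^n_{\mathbf{k}})=\mathrm{PGL}(n+1,\mathbf{k})$. The group of monomial transformations of $\mathbb{P}^n_{\mathbf{k}}$ is identified with $(\mathbf{k}^* )^n\rtimes\mathrm{GL}(n,\mathbb{Z})$: the element $((\alpha_1,\dots,\alpha_n),(a_{ij})_{i,j=1}^n)$ corresponds to the birational map $$[x_0:\dots:x_n]\dashrightarrow \left[1:\alpha_1 \left(\tfrac{x_1}{x_0}\right)^{a_{11}}\cdots \left(\tfrac{x_n}{x_0}\right)^{a_{1n}}:\dots:\alpha_n\left(\tfrac{x_1}{x_0}\right)^{a_{n1}}\cdots \left(\tfrac{x_n}{x_0}\right)^{a_{nn}}\right].$$ *)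

theory Defs
  imports
    "HOL-Library.Poly_Mapping"
    "HOL-Algebra.Generated_Groups"
    "HOL-Computational_Algebra.Polynomial_Factorial"
    "Jordan_Normal_Form.Matrix"
begin

section \<open>Polynomials in the variables $x_0, x_1, x_2, \ldots$\<close>

type_synonym 'a mpol = "(nat \<Rightarrow>\<^sub>0 nat) \<Rightarrow>\<^sub>0 'a"

definition Cst :: "'a \<Rightarrow> 'a::comm_ring_1 mpol" where
  "Cst c = Poly_Mapping.single 0 c"

definition Var :: "nat \<Rightarrow> 'a::comm_ring_1 mpol" where
  "Var i = Poly_Mapping.single (Poly_Mapping.single i 1) 1"

definition form :: "nat \<Rightarrow> nat \<Rightarrow> 'a::comm_ring_1 mpol \<Rightarrow> bool" where
  "form n d p \<longleftrightarrow> (\<forall>m \<in> Poly_Mapping.keys p.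
     Poly_Mapping.keys m \<subseteq> {..n} \<and> (\<Sum>i\<in>Poly_Mapping.keys m. Poly_Mapping.lookup m i) = d)"

definition subst_pol :: "(nat \<Rightarrow> 'a::comm_ring_1 mpol) \<Rightarrow> 'a mpol \<Rightarrow> 'a mpol" where
  "subst_pol g p = (\<Sum>m\<in>Poly_Mapping.keys p.
     Cst (Poly_Mapping.lookup p m) *
     (\<Prod>i\<in>Poly_Mapping.keys m. g i ^ Poly_Mapping.lookup m i))"

section \<open>Birational transformations of projective space\<close>

text \<open>
  A rational self-map of $P^n$ over the field is a class of tuples $[f_0 : \ldots : f_n]$ of forms
  of the same degree in $x_0, \ldots, x_n$, not all zero, up to proportionality over the function
  field.  Tuples are functions on the natural numbers; the values at indices above $n$ are
  irrelevant, and each class contains all possible continuations.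
\<close>

definition form_tuples :: "nat \<Rightarrow> (nat \<Rightarrow> 'a::field mpol) set" where
  "form_tuples n = {f. (\<exists>d. \<forall>i\<le>n. form n d (f i)) \<and> (\<exists>i\<le>n. f i \<noteq> 0)}"

text \<open>
  \<open>ratmap n \<phi>\<close> is the rational map $[\varphi_0 : \ldots : \varphi_n]$ for
  rational functions $\varphi_i$; its elements are the tuples obtained by clearing denominators.
\<close>

definition ratmap :: "nat \<Rightarrow> (nat \<Rightarrow> 'a::field mpol fract) \<Rightarrow> (nat \<Rightarrow> 'a mpol) set" where
  "ratmap n \<phi> = {f \<in> form_tuples n.
     \<forall>i\<le>n. \<forall>j\<le>n. to_fract (f i) * \<phi> j = to_fract (f j) * \<phi> i}"

abbreviation polmap :: "nat \<Rightarrow> (nat \<Rightarrow> 'a::field mpol) \<Rightarrow> (nat \<Rightarrow> 'a mpol) set" where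
  "polmap n f \<equiv> ratmap n (\<lambda>i. to_fract (f i))"

definition comp_tuple :: "(nat \<Rightarrow> 'a::field mpol) \<Rightarrow> (nat \<Rightarrow> 'a mpol) \<Rightarrow> nat \<Rightarrow> 'a mpol" where
  "comp_tuple f g = (\<lambda>i. subst_pol g (f i))"

text \<open>
  The composite of two rational maps is defined only if the composed tuple is nonzero, which is
  part of the membership \<open>comp_tuple f g \<in> polmap n Var\<close> and automatic for birational maps.
  The product of the group is the composition $F \circ G$ ($G$ is applied first); the union below
  ranges over representatives and all its members coincide.
\<close>

definition Bir :: "nat \<Rightarrow> (nat \<Rightarrow> 'a::field mpol) set monoid" where
  "Bir n = \<lparr>
     carrier = {polmap n f | f. f \<in> form_tuples n \<and>
       (\<exists>g \<in> form_tuples n. comp_tuple f g \<in> polmap n Var \<and> comp_tuple g f \<in> polmap n Var)},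
     monoid.mult = (\<lambda>F G. \<Union>f\<in>F. \<Union>g\<in>G. polmap n (comp_tuple f g)),
     one = polmap n Var \<rparr>"

definition GL :: "nat \<Rightarrow> 'r::comm_ring_1 mat monoid" where
  "GL n = units_of (ring_mat TYPE('r) n ())"

definition Aut_P :: "nat \<Rightarrow> (nat \<Rightarrow> 'a::field mpol) set set" where
  "Aut_P n = {polmap n (\<lambda>i. \<Sum>j\<le>n. Cst (M $$ (i, j)) * Var j) | M. M \<in> carrier (GL (n + 1))}"

definition std_involution :: "nat \<Rightarrow> (nat \<Rightarrow> 'a::field mpol) set" where
  "std_involution n = ratmap n (\<lambda>i. 1 / to_fract (Var i))"

definition G_sub :: "nat \<Rightarrow> (nat \<Rightarrow> 'a::field mpol) set set" where
  "G_sub n = generate (Bir n) (insert (std_involution n) (Aut_P n))"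

section \<open>Monomial transformations\<close>

definition torus :: "nat \<Rightarrow> 'a::field vec set" where
  "torus n = {\<alpha> \<in> carrier_vec n. \<forall>i<n. \<alpha> $ i \<noteq> 0}"

text \<open>Vectors and matrices are indexed from 0, so \<open>\<alpha> $ i\<close> is the coefficient of the
  projective coordinate \<open>Suc i\<close>.\<close>

definition monomial_map :: "nat \<Rightarrow> 'a::field vec \<times> int mat \<Rightarrow> (nat \<Rightarrow> 'a mpol) set" where
  "monomial_map n = (\<lambda>(\<alpha>, A). ratmap n (\<lambda>k. case k of
       0 \<Rightarrow> 1
     | Suc i \<Rightarrow> to_fract (Cst (\<alpha> $ i)) *
         (\<Prod>j<n. (to_fract (Var (Suc j)) / to_fract (Var 0)) powi (A $$ (i, j)))))"

text \<open>The semidirect product of the torus with a set \<open>H\<close> of integer matrices (intended: a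
  subgroup of \<open>GL n\<close>), with the multiplication that corresponds to the composition of
  monomial maps.\<close>

definition torus_semidirect :: "nat \<Rightarrow> int mat set \<Rightarrow> ('a::field vec \<times> int mat) monoid" where
  "torus_semidirect n H = \<lparr>
     carrier = torus n \<times> H,
     monoid.mult = (\<lambda>(\<alpha>, A) (\<beta>, B).
       (vec n (\<lambda>i. \<alpha> $ i * (\<Prod>j<n. (\<beta> $ j) powi (A $$ (i, j)))), A * B)),
     one = (vec n (\<lambda>_. 1), 1\<^sub>m n) \<rparr>"

definition Monomial :: "nat \<Rightarrow> (nat \<Rightarrow> 'a::field mpol) set set" where
  "Monomial n = monomial_map n ` carrier (torus_semidirect n (carrier (GL n)))"

definition GL_odd :: "nat \<Rightarrow> int mat set" where
  "GL_odd n = {A \<in> carrier (GL n). \<forall>j<n. odd (card {i. i < n \<and> odd (A $$ (i, j))})}"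

lemma odd_card_iff_odd_column_sum:
  "odd (card {i. i < n \<and> odd (A $$ (i, j))}) \<longleftrightarrow> odd (\<Sum>i<n. A $$ (i, j) :: int)"
  by (subst even_sum_iff) (auto simp: lessThan_def)

lemma carrier_GL: "carrier (GL n :: 'r::comm_ring_1 mat monoid) =
    {A \<in> carrier_mat n n. \<exists>B \<in> carrier_mat n n. B * A = 1\<^sub>m n \<and> A * B = 1\<^sub>m n}"
  by (auto simp: GL_def units_of_def Units_def ring_mat_simps)

lemma group_GL: "group (GL n :: 'r::comm_ring_1 mat monoid)"
  unfolding GL_def by (intro monoid.units_group ring.is_monoid ring_mat)

lemma GL_simps: "monoid.mult (GL n) = (*)" "\<one>\<^bsub>GL n\<^esub> = 1\<^sub>m n"
  by (simp_all add: GL_def units_of_def ring_mat_simps)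

lemma column_sum_mult:
  fixes A B :: "int mat"
  assumes A: "A \<in> carrier_mat n n" and B: "B \<in> carrier_mat n n" and j: "j < n"
  shows "(\<Sum>i<n. (A * B) $$ (i, j)) = (\<Sum>k<n. (\<Sum>i<n. A $$ (i, k)) * B $$ (k, j))"
proof -
  have "(\<Sum>i<n. (A * B) $$ (i, j)) = (\<Sum>i<n. \<Sum>k<n. A $$ (i, k) * B $$ (k, j))"
    using A B j by (intro sum.cong) (auto simp: scalar_prod_def atLeast0LessThan)
  also have "\<dots> = (\<Sum>k<n. \<Sum>i<n. A $$ (i, k) * B $$ (k, j))" by (rule sum.swap)
  finally show ?thesis by (simp add: sum_distrib_right)
qed

lemma odd_column_sum_mult:
  fixes A B :: "int mat"
  assumes A: "A \<in> carrier_mat n n" and B: "B \<in> carrier_mat n n" and j: "j < n"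
    and odd: "\<And>k. k < n \<Longrightarrow> odd (\<Sum>i<n. A $$ (i, k))"
  shows "odd (\<Sum>i<n. (A * B) $$ (i, j)) \<longleftrightarrow> odd (\<Sum>k<n. B $$ (k, j))"
proof -
  have "{k \<in> {..<n}. odd ((\<Sum>i<n. A $$ (i, k)) * B $$ (k, j))} = {k \<in> {..<n}. odd (B $$ (k, j))}"
    using odd by auto
  then show ?thesis unfolding column_sum_mult[OF A B j] by (simp only: even_sum_iff finite_lessThan)
qed

lemma subgroup_GL_odd: "subgroup (GL_odd n) (GL n)"
proof -
  interpret group "GL n :: int mat monoid" by (rule group_GL)
  have mem: "A \<in> GL_odd n \<longleftrightarrow> A \<in> carrier (GL n) \<and> (\<forall>j<n. odd (\<Sum>i<n. A $$ (i, j)))" for A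
    by (simp add: GL_odd_def odd_card_iff_odd_column_sum)
  have one: "odd (\<Sum>i<n. (1\<^sub>m n :: int mat) $$ (i, j))" if "j < n" for j
  proof -
    have "(\<Sum>i<n. (1\<^sub>m n :: int mat) $$ (i, j)) = (\<Sum>i<n. if i = j then 1 else 0)"
      using that by (intro sum.cong) auto
    then show ?thesis using that by simp
  qed
  show ?thesis
  proof (rule subgroupI)
    show "GL_odd n \<subseteq> carrier (GL n)" by (auto simp: mem)
    show "GL_odd n \<noteq> {}" using one one_closed by (auto simp: mem GL_simps intro!: exI[of _ "1\<^sub>m n"] simp flip: ex_in_conv)
  next
    fix A assume A: "A \<in> GL_odd n"
    let ?B = "m_inv (GL n) A"
    have B: "?B \<in> carrier (GL n)" "A * ?B = 1\<^sub>m n"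
      using A inv_closed r_inv[of A] by (auto simp: mem GL_simps)
    have "odd (\<Sum>i<n. ?B $$ (i, j))" if "j < n" for j
      using odd_column_sum_mult[of A n ?B j] A B that one[OF that] by (auto simp: mem carrier_GL)
    then show "?B \<in> GL_odd n" using B by (simp add: mem)
  next
    fix A B assume AB: "A \<in> GL_odd n" "B \<in> GL_odd n"
    then have "A * B \<in> carrier (GL n)" using m_closed[of A B] by (simp add: mem GL_simps)
    moreover have "odd (\<Sum>i<n. (A * B) $$ (i, j))" if "j < n" for j
      using odd_column_sum_mult[of A n B j] AB that by (auto simp: mem carrier_GL)
    ultimately show "monoid.mult (GL n) A B \<in> GL_odd n" by (simp add: mem GL_simps)
  qed
qed

end

(*
  Elements of G_n are words in the standard involution and linear maps. Composing such a word from
  the left, one sees that G_n consists of the classes of the tuples of rational functions that are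
  obtained from (x_0, ..., x_n) by scaling, invertible linear combinations and entrywise inversion.

  Upper bound (n odd). Let W be the determinant of the matrix with columns f, d_1 f, ..., d_n f, where
  d_j is the derivation with respect to x_j. Scaling f by c multiplies W by c^(n+1), a linear map
  multiplies it by a constant, and inversion multiplies it by a sign and the square of 1/(f_0 ... f_n).
  As n + 1 is even, W is x_0 up to constants and squares on all of G_n. For a monomial map with matrix
  A, W is a constant times a Laurent monomial in which x_j has exponent (j-th column sum of A) - 1 for
  j >= 1. Hence all column sums are odd.

  Lower bound (characteristic not 2). The move x_i -> x_j^2 / x_i belongs to G_n; conjugating additions
  by it gives x_i -> x_i + x_j^2 / x_k, by polarisation x_i -> x_i + x_j x_l / x_k, and a product of
  three such transvections gives (x_i, x_j) -> (x_i x_k / x_l, x_j x_l / x_k). On exponent matrices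
  these are sign changes, addition of twice a row to another one, and addition of a row to two others.
  For even n the latter moves, applied to pairs, yield all elementary row operations. For odd n they
  suffice to reduce a matrix with odd column sums to the identity: the first column becomes a unit
  vector, the remaining rows can then be reduced freely with the first row absorbing the second
  addition, and the first row is left with even entries, which are cleared last.
*)
theory Submission
  imports Defs "Jordan_Normal_Form.Gauss_Jordan_Elimination" "Jordan_Normal_Form.Determinant"
begin

section \<open>Evaluation of polynomials\<close>

text \<open>Odd column sums mean that A fixes the row vector (1, ..., 1) modulo 2. This explains the
  split by the parity of n: an interchange of x_0 with x_k, renormalised so that the first
  coordinate is 1, negates row k and subtracts it from the n - 1 other rows, which respects that
  vector for odd n and breaks it for even n. The obstacle in handling G_n is that its product is a
  union over representatives, and that rational functions can be substituted into each other only
  under control of the denominators. Composing on the left avoids this: only forms are evaluated at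
  tuples of rational functions, and the condition that no nonzero form vanishes at such a tuple
  makes evaluation compatible with proportionality. The upper bound must hold in every
  characteristic and for tuples of degree 0, but the ordinary Jacobian determinant of a homogeneous
  tuple vanishes whenever its degree is 0 in the field. Replacing the first column by the tuple
  itself cures this; Euler's relation accounts for the factor x_0.\<close>

definition monom_eval :: "(nat \<Rightarrow> 'b::comm_ring_1) \<Rightarrow> (nat \<Rightarrow>\<^sub>0 nat) \<Rightarrow> 'b" where
  "monom_eval \<theta> m = (\<Prod>i\<in>Poly_Mapping.keys m. \<theta> i ^ Poly_Mapping.lookup m i)"

text \<open>Coefficient map and values are separate parameters, so that the same lemmas serve
  substitution of polynomials, evaluation in the function field, and the evaluation at x_i +
  \<epsilon> behind the derivations.\<close>

definition poly_eval :: "('a \<Rightarrow> 'b) \<Rightarrow> (nat \<Rightarrow> 'b::comm_ring_1) \<Rightarrow> 'a::comm_ring_1 mpol \<Rightarrow> 'b" where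
  "poly_eval \<kappa> \<theta> p = (\<Sum>m\<in>Poly_Mapping.keys p. \<kappa> (Poly_Mapping.lookup p m) * monom_eval \<theta> m)"

lemma monom_eval_superset:
  assumes "finite S" "Poly_Mapping.keys m \<subseteq> S"
  shows "monom_eval \<theta> m = (\<Prod>i\<in>S. \<theta> i ^ Poly_Mapping.lookup m i)"
  unfolding monom_eval_def using assms
  by (intro prod.mono_neutral_left) (auto simp: in_keys_iff)

lemma monom_eval_add: "monom_eval \<theta> (m + m') = monom_eval \<theta> m * monom_eval \<theta> m'"
proof -
  let ?S = "Poly_Mapping.keys m \<union> Poly_Mapping.keys m'"
  have "Poly_Mapping.keys (m + m') \<subseteq> ?S" by (rule Poly_Mapping.keys_add)
  then show ?thesis
    by (simp add: monom_eval_superset[where S = ?S] lookup_add power_add prod.distrib)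
qed

lemma monom_eval_0 [simp]: "monom_eval \<theta> 0 = 1"
  by (simp add: monom_eval_def)

lemma monom_eval_single [simp]: "monom_eval \<theta> (Poly_Mapping.single i k) = \<theta> i ^ k"
  by (simp add: monom_eval_def)

lemma monom_eval_scale:
  "monom_eval (\<lambda>i. c * \<theta> i) m = c ^ (\<Sum>i\<in>Poly_Mapping.keys m. Poly_Mapping.lookup m i) * monom_eval \<theta> m"
  by (simp add: monom_eval_def power_mult_distrib prod.distrib power_sum)

lemma poly_mapping_sum_single:
  fixes p :: "'a \<Rightarrow>\<^sub>0 'b::comm_monoid_add"
  shows "p = (\<Sum>m\<in>Poly_Mapping.keys p. Poly_Mapping.single m (Poly_Mapping.lookup p m))"
proof (rule poly_mapping_eqI)
  fix k
  have "(\<Sum>m\<in>Poly_Mapping.keys p. Poly_Mapping.lookup (Poly_Mapping.single m (Poly_Mapping.lookup p m)) k)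
     = (\<Sum>m\<in>Poly_Mapping.keys p. if m = k then Poly_Mapping.lookup p k else 0)"
    by (intro sum.cong) (auto simp: lookup_single when_def)
  then show "Poly_Mapping.lookup p k = Poly_Mapping.lookup
      (\<Sum>m\<in>Poly_Mapping.keys p. Poly_Mapping.single m (Poly_Mapping.lookup p m)) k"
    by (simp add: lookup_sum in_keys_iff)
qed

lemma mpol_induct [case_names single add]:
  fixes p :: "'a::comm_ring_1 mpol"
  assumes "\<And>m c. P (Poly_Mapping.single m c)" and "\<And>p q. P p \<Longrightarrow> P q \<Longrightarrow> P (p + q)"
  shows "P p"
proof -
  have "P (\<Sum>m\<in>S. Poly_Mapping.single m (Poly_Mapping.lookup p m))" if "finite S" for S
    using that
  proof (induction S)
    case empty
    then show ?case using assms(1)[of 0 0] by simp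
  qed (auto intro: assms)
  from this[OF finite_keys[of p]] show ?thesis by (simp flip: poly_mapping_sum_single)
qed

locale evaluation = comm_ring_hom \<kappa> for \<kappa> :: "'a::comm_ring_1 \<Rightarrow> 'b::comm_ring_1"
begin

lemma poly_eval_superset:
  assumes "finite S" "Poly_Mapping.keys p \<subseteq> S"
  shows "poly_eval \<kappa> \<theta> p = (\<Sum>m\<in>S. \<kappa> (Poly_Mapping.lookup p m) * monom_eval \<theta> m)"
  unfolding poly_eval_def using assms
  by (intro sum.mono_neutral_left) (auto simp: in_keys_iff)

lemma poly_eval_add: "poly_eval \<kappa> \<theta> (p + q) = poly_eval \<kappa> \<theta> p + poly_eval \<kappa> \<theta> q"
proof -
  let ?S = "Poly_Mapping.keys p \<union> Poly_Mapping.keys q"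
  have "Poly_Mapping.keys (p + q) \<subseteq> ?S" by (rule Poly_Mapping.keys_add)
  then show ?thesis
    by (simp add: poly_eval_superset[where S = ?S] lookup_add hom_add algebra_simps sum.distrib)
qed

lemma poly_eval_0 [simp]: "poly_eval \<kappa> \<theta> 0 = 0"
  by (simp add: poly_eval_def)

lemma poly_eval_single [simp]: "poly_eval \<kappa> \<theta> (Poly_Mapping.single m c) = \<kappa> c * monom_eval \<theta> m"
  by (cases "c = 0") (auto simp: poly_eval_def)

lemma poly_eval_mult: "poly_eval \<kappa> \<theta> (p * q) = poly_eval \<kappa> \<theta> p * poly_eval \<kappa> \<theta> q"
proof (induction p rule: mpol_induct)
  case (single m c)
  show ?case
  proof (induction q rule: mpol_induct)
    case (single m' c')
    then show ?case by (simp add: mult_single hom_mult monom_eval_add)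
  qed (simp add: poly_eval_add algebra_simps)
qed (simp add: poly_eval_add algebra_simps)

lemma poly_eval_1 [simp]: "poly_eval \<kappa> \<theta> 1 = 1"
  using poly_eval_single[of \<theta> 0 1] by (simp del: poly_eval_single)

lemma poly_eval_Cst [simp]: "poly_eval \<kappa> \<theta> (Cst c) = \<kappa> c"
  by (simp add: Cst_def)

lemma poly_eval_Var [simp]: "poly_eval \<kappa> \<theta> (Var i) = \<theta> i"
  by (simp add: Var_def)

lemma comm_ring_hom_poly_eval: "comm_ring_hom (poly_eval \<kappa> \<theta>)"
  by unfold_locales (simp_all add: poly_eval_add poly_eval_mult)

lemma poly_eval_cong_form:
  assumes "form n d p" "\<And>i. i \<le> n \<Longrightarrow> \<theta> i = \<theta>' i"
  shows "poly_eval \<kappa> \<theta> p = poly_eval \<kappa> \<theta>' p"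
  unfolding poly_eval_def
proof (rule sum.cong[OF refl])
  fix m assume "m \<in> Poly_Mapping.keys p"
  then have "Poly_Mapping.keys m \<subseteq> {..n}" using assms(1) by (auto simp: form_def)
  then have "monom_eval \<theta> m = monom_eval \<theta>' m"
    unfolding monom_eval_def by (intro prod.cong) (auto simp: assms(2))
  then show "\<kappa> (Poly_Mapping.lookup p m) * monom_eval \<theta> m = \<kappa> (Poly_Mapping.lookup p m) * monom_eval \<theta>' m"
    by simp
qed

text \<open>Homogeneity is what lets evaluation of a tuple of forms respect proportional
  arguments.\<close>

lemma poly_eval_scale_form:
  assumes "form n d p"
  shows "poly_eval \<kappa> (\<lambda>i. c * \<theta> i) p = c ^ d * poly_eval \<kappa> \<theta> p"
  unfolding poly_eval_def sum_distrib_left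
proof (rule sum.cong[OF refl])
  fix m assume "m \<in> Poly_Mapping.keys p"
  then have "(\<Sum>i\<in>Poly_Mapping.keys m. Poly_Mapping.lookup m i) = d" using assms by (auto simp: form_def)
  then show "\<kappa> (Poly_Mapping.lookup p m) * monom_eval (\<lambda>i. c * \<theta> i) m =
      c ^ d * (\<kappa> (Poly_Mapping.lookup p m) * monom_eval \<theta> m)"
    by (simp add: monom_eval_scale)
qed

end

text \<open>With h an evaluation, a substitution or the embedding \<open>to_fract\<close>, this
  yields the rules for composing substitutions and evaluations.\<close>

lemma hom_poly_eval:
  assumes "comm_ring_hom \<kappa>" "comm_ring_hom h"
  shows "h (poly_eval \<kappa> \<theta> p) = poly_eval (h \<circ> \<kappa>) (h \<circ> \<theta>) p"
proof -
  interpret h: comm_ring_hom h by fact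
  show ?thesis
    by (simp add: poly_eval_def monom_eval_def h.hom_sum h.hom_mult h.hom_prod h.hom_power)
qed

section \<open>Substitution and evaluation in the function field\<close>

lemma Cst_hom: "comm_ring_hom (Cst :: 'a::comm_ring_1 \<Rightarrow> 'a mpol)"
  by unfold_locales (simp_all add: Cst_def single_add mult_single)

interpretation Cst: evaluation Cst
  unfolding evaluation_def by (rule Cst_hom)

lemma subst_pol_eq_poly_eval: "subst_pol g p = poly_eval Cst g p"
  by (simp add: subst_pol_def poly_eval_def monom_eval_def)

lemma to_fract_hom: "comm_ring_hom (to_fract :: 'a::idom \<Rightarrow> 'a fract)"
  by unfold_locales simp_all

interpretation to_fract: comm_ring_hom to_fract
  by (rule to_fract_hom)

abbreviation const :: "'a::field \<Rightarrow> 'a mpol fract" where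
  "const c \<equiv> to_fract (Cst c)"

lemma const_hom: "comm_ring_hom (\<lambda>c. const c)"
  by unfold_locales (simp_all add: Cst.hom_add Cst.hom_mult)

interpretation const: evaluation "\<lambda>c. const c"
  unfolding evaluation_def by (rule const_hom)

abbreviation ev :: "(nat \<Rightarrow> 'a::field mpol fract) \<Rightarrow> 'a mpol \<Rightarrow> 'a mpol fract" where
  "ev \<equiv> poly_eval (\<lambda>c. const c)"

interpretation ev: comm_ring_hom "ev \<theta>" for \<theta>
  by (rule const.comm_ring_hom_poly_eval)

interpretation subst: comm_ring_hom "poly_eval Cst g" for g
  by (rule Cst.comm_ring_hom_poly_eval)

lemma Cst_eq_0_iff [simp]: "Cst c = 0 \<longleftrightarrow> c = 0"
  by (metis Cst_def lookup_single_eq lookup_zero single_zero)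

lemma to_fract_subst_pol: "to_fract (subst_pol g p) = ev (\<lambda>i. to_fract (g i)) p"
  by (simp add: subst_pol_eq_poly_eval hom_poly_eval[OF Cst_hom to_fract_hom] comp_def)

lemma ev_subst_pol: "ev \<theta> (subst_pol g p) = ev (\<lambda>i. ev \<theta> (g i)) p"
  by (simp add: subst_pol_eq_poly_eval hom_poly_eval[OF Cst_hom const.comm_ring_hom_poly_eval] comp_def)

lemma subst_pol_subst_pol: "subst_pol h (subst_pol g p) = subst_pol (\<lambda>i. subst_pol h (g i)) p"
  unfolding subst_pol_eq_poly_eval
  by (simp add: hom_poly_eval[OF Cst_hom Cst.comm_ring_hom_poly_eval] comp_def)

text \<open>The coordinates form the generic point: an identity checked there is an identity of
  polynomials. The proof writes a monomial as the product of its powers of variables.\<close>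

lemma ev_to_fract_Var: "ev (\<lambda>i. to_fract (Var i)) p = to_fract (p :: 'a::field mpol)"
proof (induction p rule: mpol_induct)
  case (single m c)
  have pow: "Poly_Mapping.single (Poly_Mapping.single i k) (1::'a) = Var i ^ k" for i k
  proof (induction k)
    case (Suc k)
    have "Poly_Mapping.single i (Suc k) = Poly_Mapping.single i 1 + Poly_Mapping.single i k"
      by (simp flip: single_add)
    then show ?case using Suc[symmetric] by (simp add: mult_single Var_def)
  qed simp
  have add: "Poly_Mapping.single (a + b) (1::'a) = Poly_Mapping.single a 1 * Poly_Mapping.single b 1"
    for a b :: "nat \<Rightarrow>\<^sub>0 nat"
    by (simp add: mult_single)
  have "Poly_Mapping.single (\<Sum>i\<in>S. Poly_Mapping.single i (Poly_Mapping.lookup m i)) (1::'a) =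
      (\<Prod>i\<in>S. Var i ^ Poly_Mapping.lookup m i)" if "finite S" for S
    using that by (induction S) (simp_all add: add pow)
  from this[OF finite_keys[of m]] have "Poly_Mapping.single m 1 = (monom_eval Var m :: 'a mpol)"
    unfolding monom_eval_def by (simp flip: poly_mapping_sum_single)
  moreover have "to_fract (monom_eval Var m :: 'a mpol) = monom_eval (\<lambda>i. to_fract (Var i)) m"
    by (simp add: monom_eval_def to_fract.hom_prod to_fract.hom_power)
  moreover have "to_fract (Poly_Mapping.single m c) = const c * to_fract (Poly_Mapping.single m 1)"
    by (simp add: Cst_def mult_single flip: to_fract_mult)
  ultimately show ?case by simp
qed (simp add: ev.hom_add)

lemma subst_pol_Var [simp]: "subst_pol Var p = (p :: 'a::field mpol)"
  using to_fract_subst_pol[of Var p] by (simp add: ev_to_fract_Var)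

section \<open>Forms\<close>

lemma form_0 [simp]: "form n d 0"
  by (simp add: form_def)

lemma form_add: "form n d p \<Longrightarrow> form n d q \<Longrightarrow> form n d (p + q)"
  unfolding form_def using Poly_Mapping.keys_add[of p q] by blast

lemma form_sum: "(\<And>i. i \<in> S \<Longrightarrow> form n d (f i)) \<Longrightarrow> form n d (sum f S)"
  by (induction S rule: infinite_finite_induct) (auto intro: form_add)

lemma form_mult:
  assumes "form n d p" "form n e q"
  shows "form n (d + e) (p * q)"
  unfolding form_def
proof
  fix m assume "m \<in> Poly_Mapping.keys (p * q)"
  then obtain a b where ab: "m = a + b" "a \<in> Poly_Mapping.keys p" "b \<in> Poly_Mapping.keys q"
    using Poly_Mapping.keys_mult[of p q] by auto
  have a: "Poly_Mapping.keys a \<subseteq> {..n}" "(\<Sum>i\<in>Poly_Mapping.keys a. Poly_Mapping.lookup a i) = d"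
    using assms(1) ab by (auto simp: form_def)
  have b: "Poly_Mapping.keys b \<subseteq> {..n}" "(\<Sum>i\<in>Poly_Mapping.keys b. Poly_Mapping.lookup b i) = e"
    using assms(2) ab by (auto simp: form_def)
  have m: "Poly_Mapping.keys m \<subseteq> {..n}"
    using a b Poly_Mapping.keys_add[of a b] ab(1) by blast
  have *: "(\<Sum>i\<in>Poly_Mapping.keys c. Poly_Mapping.lookup c i) = (\<Sum>i\<le>n. Poly_Mapping.lookup c i)"
    if "Poly_Mapping.keys c \<subseteq> {..n}" for c
    using that by (intro sum.mono_neutral_left) (auto simp: in_keys_iff)
  show "Poly_Mapping.keys m \<subseteq> {..n} \<and> (\<Sum>i\<in>Poly_Mapping.keys m. Poly_Mapping.lookup m i) = d + e"
    using a b m by (simp add: *[OF a(1)] *[OF b(1)] *[OF m] ab(1)[symmetric])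
      (simp add: ab(1) lookup_add sum.distrib)
qed

lemma form_Cst [simp]: "form n 0 (Cst c)"
  by (cases "c = 0") (auto simp: form_def Cst_def)

lemma form_1 [simp]: "form n 0 1"
  by (simp add: form_def)

lemma form_Var: "i \<le> n \<Longrightarrow> form n 1 (Var i)"
  by (simp add: form_def Var_def)

lemma form_power: "form n d p \<Longrightarrow> form n (k * d) (p ^ k)"
  by (induction k) (auto dest: form_mult)

lemma form_prod: "(\<And>i. i \<in> S \<Longrightarrow> form n (d i) (f i)) \<Longrightarrow> form n (sum d S) (prod f S)"
  by (induction S rule: infinite_finite_induct) (auto intro: form_mult)

lemma form_subst_pol:
  assumes "form n d p" "\<And>i. i \<le> n \<Longrightarrow> form n e (g i)"
  shows "form n (d * e) (subst_pol g p)"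
  unfolding subst_pol_def
proof (rule form_sum)
  fix m assume "m \<in> Poly_Mapping.keys p"
  then have m: "Poly_Mapping.keys m \<subseteq> {..n}" "(\<Sum>i\<in>Poly_Mapping.keys m. Poly_Mapping.lookup m i) = d"
    using assms(1) by (auto simp: form_def)
  have "form n (\<Sum>i\<in>Poly_Mapping.keys m. Poly_Mapping.lookup m i * e)
      (\<Prod>i\<in>Poly_Mapping.keys m. g i ^ Poly_Mapping.lookup m i)"
    using m(1) by (intro form_prod form_power assms(2)) auto
  then have "form n (d * e) (\<Prod>i\<in>Poly_Mapping.keys m. g i ^ Poly_Mapping.lookup m i)"
    using m(2) by (simp flip: sum_distrib_right)
  from form_mult[OF form_Cst this]
  show "form n (d * e) (Cst (Poly_Mapping.lookup p m) * (\<Prod>i\<in>Poly_Mapping.keys m. g i ^ Poly_Mapping.lookup m i))"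
    by simp
qed

section \<open>Dominant tuples and composition\<close>

abbreviation frac_tuple :: "(nat \<Rightarrow> 'a::field mpol) \<Rightarrow> nat \<Rightarrow> 'a mpol fract" where
  "frac_tuple f \<equiv> \<lambda>i. to_fract (f i)"

definition proportional :: "nat \<Rightarrow> (nat \<Rightarrow> 'a::field mpol fract) \<Rightarrow> (nat \<Rightarrow> 'a mpol fract) \<Rightarrow> bool" where
  "proportional n \<phi> \<theta> \<longleftrightarrow> (\<exists>c. c \<noteq> 0 \<and> (\<forall>i\<le>n. \<phi> i = c * \<theta> i))"

text \<open>The first conjunct makes \<theta> represent a rational map, the second makes the image
  of this map dense: no hypersurface contains it.\<close>

definition dominant :: "nat \<Rightarrow> (nat \<Rightarrow> 'a::field mpol fract) \<Rightarrow> bool" where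
  "dominant n \<theta> \<longleftrightarrow> (\<exists>f \<in> form_tuples n. proportional n (frac_tuple f) \<theta>) \<and>
     (\<forall>d p. form n d p \<longrightarrow> ev \<theta> p = 0 \<longrightarrow> p = 0)"

lemma proportional_refl [simp]: "proportional n \<theta> \<theta>"
  unfolding proportional_def by (rule exI[of _ 1]) simp

lemma proportional_sym: "proportional n \<phi> \<theta> \<Longrightarrow> proportional n \<theta> \<phi>"
  unfolding proportional_def
  by (elim exE, rule_tac x = "inverse c" in exI) (auto simp: field_simps)

lemma proportional_trans: "proportional n \<phi> \<theta> \<Longrightarrow> proportional n \<theta> \<chi> \<Longrightarrow> proportional n \<phi> \<chi>"
  unfolding proportional_def
  by (elim exE, rule_tac x = "c * ca" in exI) (auto simp: field_simps)

text \<open>Turns the equations in \<open>ratmap\<close> into an explicit factor. A zero tuple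
  satisfies these equations trivially, hence the nonzero entries on both sides.\<close>

lemma proportional_iff_cross:
  assumes "i0 \<le> n" "\<phi> i0 \<noteq> 0" "j0 \<le> n" "\<theta> j0 \<noteq> 0"
  shows "proportional n \<phi> \<theta> \<longleftrightarrow> (\<forall>i\<le>n. \<forall>j\<le>n. \<phi> i * \<theta> j = \<phi> j * \<theta> i)"
proof
  assume *: "\<forall>i\<le>n. \<forall>j\<le>n. \<phi> i * \<theta> j = \<phi> j * \<theta> i"
  have "\<phi> j0 \<noteq> 0" using * assms by (metis mult_eq_0_iff)
  then show "proportional n \<phi> \<theta>"
    unfolding proportional_def using * assms
    by (intro exI[of _ "\<phi> j0 / \<theta> j0"]) (auto simp: field_simps)
qed (auto simp: proportional_def)

lemma form_tuples_nonzero: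
  assumes "f \<in> form_tuples n"
  obtains i where "i \<le> n" "f i \<noteq> 0"
  using assms by (auto simp: form_tuples_def)

lemma mem_ratmap_iff:
  assumes "\<exists>i\<le>n. \<phi> i \<noteq> 0"
  shows "f \<in> ratmap n \<phi> \<longleftrightarrow> f \<in> form_tuples n \<and> proportional n (frac_tuple f) \<phi>"
proof (cases "f \<in> form_tuples n")
  case True
  then obtain i where i: "i \<le> n" "f i \<noteq> 0" by (rule form_tuples_nonzero)
  obtain j where j: "j \<le> n" "\<phi> j \<noteq> 0" using assms by auto
  show ?thesis using True i j
    by (subst proportional_iff_cross[of i n _ j]) (auto simp: ratmap_def)
qed (simp add: ratmap_def)

lemma proportional_nonzero:
  "proportional n \<phi> \<theta> \<Longrightarrow> (\<exists>i\<le>n. \<phi> i \<noteq> 0) \<longleftrightarrow> (\<exists>i\<le>n. \<theta> i \<noteq> 0)"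
  by (auto simp: proportional_def)

lemma ratmap_cong_proportional:
  assumes "proportional n \<phi> \<theta>"
  shows "ratmap n \<phi> = ratmap n \<theta>"
proof -
  obtain c where c: "c \<noteq> 0" "\<And>i. i \<le> n \<Longrightarrow> \<phi> i = c * \<theta> i"
    using assms by (auto simp: proportional_def)
  show ?thesis
    unfolding ratmap_def
    by (intro Collect_cong conj_cong refl) (auto simp: c mult.left_commute)
qed

lemma dominantI:
  assumes "f \<in> form_tuples n" "proportional n (frac_tuple f) \<theta>"
    "\<And>d p. form n d p \<Longrightarrow> ev \<theta> p = 0 \<Longrightarrow> p = 0"
  shows "dominant n \<theta>"
  using assms by (auto simp: dominant_def)

lemma dominant_nonzero_form: "dominant n \<theta> \<Longrightarrow> form n d p \<Longrightarrow> p \<noteq> 0 \<Longrightarrow> ev \<theta> p \<noteq> 0"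
  by (auto simp: dominant_def)

lemma Var_neq_0 [simp]: "Var i \<noteq> 0"
  unfolding Var_def by (metis lookup_single_eq lookup_zero zero_neq_one)

lemma dominant_nonzero: "dominant n \<theta> \<Longrightarrow> i \<le> n \<Longrightarrow> \<theta> i \<noteq> 0"
  using dominant_nonzero_form[OF _ form_Var Var_neq_0, of n \<theta> i] by simp

lemma dominantE:
  assumes "dominant n \<theta>"
  obtains f where "f \<in> form_tuples n" "proportional n (frac_tuple f) \<theta>" "f \<in> ratmap n \<theta>"
    "dominant n (frac_tuple f)"
proof -
  from assms obtain f where f: "f \<in> form_tuples n" "proportional n (frac_tuple f) \<theta>"
    by (auto simp: dominant_def)
  moreover have "f \<in> ratmap n \<theta>"
    using f dominant_nonzero[OF assms] by (subst mem_ratmap_iff) auto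
  moreover have "dominant n (frac_tuple f)"
  proof (rule dominantI[OF f(1)])
    fix d p assume p: "form n d p" "ev (frac_tuple f) p = 0"
    obtain c where c: "c \<noteq> 0" "\<And>i. i \<le> n \<Longrightarrow> to_fract (f i) = c * \<theta> i"
      using f by (auto simp: proportional_def)
    have "ev (frac_tuple f) p = c ^ d * ev \<theta> p"
      using const.poly_eval_cong_form[OF p(1) c(2)] const.poly_eval_scale_form[OF p(1)] by simp
    then show "p = 0" using p c assms by (auto simp: dominant_def)
  qed simp
  ultimately show thesis using that by blast
qed

lemma dominant_cong_proportional:
  assumes "dominant n \<theta>" "proportional n \<phi> \<theta>"
  shows "dominant n \<phi>"
proof -
  obtain f where f: "f \<in> form_tuples n" "proportional n (frac_tuple f) \<theta>"
    using assms by (auto simp: dominant_def)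
  obtain c where c: "c \<noteq> 0" "\<And>i. i \<le> n \<Longrightarrow> \<phi> i = c * \<theta> i"
    using assms by (auto simp: proportional_def)
  show ?thesis
  proof (rule dominantI[OF f(1)])
    show "proportional n (frac_tuple f) \<phi>"
      using f(2) assms(2) proportional_sym proportional_trans by blast
    fix d p assume p: "form n d p" "ev \<phi> p = 0"
    have "ev \<phi> p = c ^ d * ev \<theta> p"
      using const.poly_eval_cong_form[OF p(1) c(2)] const.poly_eval_scale_form[OF p(1)] by simp
    then show "p = 0" using p c assms by (auto simp: dominant_def)
  qed
qed

lemma mem_ratmap_dominant_iff:
  assumes "dominant n \<phi>"
  shows "f \<in> ratmap n \<phi> \<longleftrightarrow> f \<in> form_tuples n \<and> proportional n (frac_tuple f) \<phi>"
  using dominant_nonzero[OF assms] by (intro mem_ratmap_iff) auto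

text \<open>The cross relations between f and f' are identities of polynomials and survive
  evaluation; dominance keeps a nonzero entry on either side, so that they again give a
  factor.\<close>

lemma ev_proportional:
  assumes f: "f \<in> form_tuples n" "f' \<in> form_tuples n" "proportional n (frac_tuple f) (frac_tuple f')"
    and \<theta>: "dominant n \<theta>"
  shows "proportional n (\<lambda>i. ev \<theta> (f i)) (\<lambda>i. ev \<theta> (f' i))"
proof -
  obtain d d' where d: "\<And>i. i \<le> n \<Longrightarrow> form n d (f i)" "\<And>i. i \<le> n \<Longrightarrow> form n d' (f' i)"
    using f by (auto simp: form_tuples_def)
  obtain i j where ij: "i \<le> n" "f i \<noteq> 0" "j \<le> n" "f' j \<noteq> 0"
    using f by (metis form_tuples_nonzero)
  have nz: "ev \<theta> (f i) \<noteq> 0" "ev \<theta> (f' j) \<noteq> 0"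
    using dominant_nonzero_form[OF \<theta>] d ij by blast+
  have "f k * f' l = f l * f' k" if "k \<le> n" "l \<le> n" for k l
  proof -
    have "to_fract (f k * f' l) = to_fract (f l * f' k)"
      using that f(3) proportional_iff_cross[of i n "frac_tuple f" j "frac_tuple f'"] ij by simp
    then show ?thesis by (simp only: to_fract_eq_iff)
  qed
  then show ?thesis using ij nz
    by (subst proportional_iff_cross[of i n _ j]) (auto simp flip: ev.hom_mult)
qed

lemma ev_scale:
  assumes f: "f \<in> form_tuples n" and "proportional n \<phi> \<theta>"
  shows "proportional n (\<lambda>i. ev \<phi> (f i)) (\<lambda>i. ev \<theta> (f i))"
proof -
  obtain d where d: "\<And>i. i \<le> n \<Longrightarrow> form n d (f i)"
    using f by (auto simp: form_tuples_def)
  obtain c where c: "c \<noteq> 0" "\<And>i. i \<le> n \<Longrightarrow> \<phi> i = c * \<theta> i"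
    using assms by (auto simp: proportional_def)
  have "ev \<phi> (f i) = c ^ d * ev \<theta> (f i)" if "i \<le> n" for i
    using const.poly_eval_cong_form[OF d[OF that] c(2)] const.poly_eval_scale_form[OF d[OF that]] by simp
  then show ?thesis unfolding proportional_def using c by (intro exI[of _ "c ^ d"]) auto
qed

lemma comp_tuple_form_tuples:
  assumes f: "f \<in> form_tuples n" and g: "g \<in> form_tuples n" "dominant n (frac_tuple g)"
  shows "comp_tuple f g \<in> form_tuples n"
proof -
  obtain d e where d: "\<And>i. i \<le> n \<Longrightarrow> form n d (f i)" "\<And>i. i \<le> n \<Longrightarrow> form n e (g i)"
    using f g by (auto simp: form_tuples_def)
  obtain i where i: "i \<le> n" "f i \<noteq> 0" using f by (rule form_tuples_nonzero)
  have "to_fract (comp_tuple f g i) \<noteq> 0"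
    using dominant_nonzero_form[OF g(2) d(1)] i by (simp add: comp_tuple_def to_fract_subst_pol)
  then show ?thesis
    using d i by (auto simp: form_tuples_def comp_tuple_def intro!: form_subst_pol)
qed

lemma frac_tuple_comp_tuple: "frac_tuple (comp_tuple f g) = (\<lambda>i. ev (frac_tuple g) (f i))"
  by (simp add: comp_tuple_def to_fract_subst_pol)

text \<open>If p vanishes at the composite, then the form \<open>subst_pol f p\<close> vanishes at
  \<theta>, so it is zero, and p vanishes at f.\<close>

lemma dominant_comp:
  assumes f: "f \<in> form_tuples n" "dominant n (frac_tuple f)" and \<theta>: "dominant n \<theta>"
  shows "dominant n (\<lambda>i. ev \<theta> (f i))"
proof -
  obtain d where d: "\<And>i. i \<le> n \<Longrightarrow> form n d (f i)"
    using f by (auto simp: form_tuples_def)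
  obtain g where g: "g \<in> form_tuples n" "proportional n (frac_tuple g) \<theta>" "dominant n (frac_tuple g)"
    using \<theta> by (rule dominantE)
  show ?thesis
  proof (rule dominantI[OF comp_tuple_form_tuples[OF f(1) g(1,3)]])
    show "proportional n (frac_tuple (comp_tuple f g)) (\<lambda>i. ev \<theta> (f i))"
      unfolding frac_tuple_comp_tuple using f(1) g(2) by (rule ev_scale)
    fix e p assume p: "form n e p" "ev (\<lambda>i. ev \<theta> (f i)) p = 0"
    then have "ev \<theta> (subst_pol f p) = 0" by (simp add: ev_subst_pol)
    moreover have "form n (e * d) (subst_pol f p)" using p d by (intro form_subst_pol) auto
    ultimately have "subst_pol f p = 0" using \<theta> by (auto simp: dominant_def)
    then have "ev (frac_tuple f) p = 0" by (metis to_fract_subst_pol to_fract_0)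
    then show "p = 0" using f p by (auto simp: dominant_def)
  qed
qed

text \<open>The members of the union in the product coincide: a change of the left representative is
  absorbed by \<open>ev_proportional\<close>, a change of the right one by
  \<open>ev_scale\<close>.\<close>

lemma comp_ratmap:
  assumes f: "f \<in> ratmap n \<phi>" "\<exists>i\<le>n. \<phi> i \<noteq> 0" and \<theta>: "dominant n \<theta>"
  shows "ratmap n \<phi> \<otimes>\<^bsub>Bir n\<^esub> ratmap n \<theta> = ratmap n (\<lambda>i. ev \<theta> (f i))"
proof -
  have f': "f \<in> form_tuples n" "proportional n (frac_tuple f) \<phi>"
    using f by (simp_all add: mem_ratmap_iff)
  have nz: "\<exists>i\<le>n. \<theta> i \<noteq> 0" using dominant_nonzero[OF \<theta>] by auto
  have *: "polmap n (comp_tuple f' g) = ratmap n (\<lambda>i. ev \<theta> (f i))"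
    if "f' \<in> ratmap n \<phi>" "g \<in> ratmap n \<theta>" for f' g
  proof (rule ratmap_cong_proportional)
    have 1: "f' \<in> form_tuples n" "proportional n (frac_tuple f') \<phi>"
      using that f by (simp_all add: mem_ratmap_iff)
    have 2: "g \<in> form_tuples n" "proportional n (frac_tuple g) \<theta>"
      using that nz by (simp_all add: mem_ratmap_iff)
    have "proportional n (frac_tuple f') (frac_tuple f)"
      using 1 f' proportional_sym proportional_trans by blast
    then have "proportional n (\<lambda>i. ev \<theta> (f' i)) (\<lambda>i. ev \<theta> (f i))"
      using ev_proportional[OF 1(1) f'(1) _ \<theta>] by blast
    with ev_scale[OF 1(1) 2(2)]
    show "proportional n (frac_tuple (comp_tuple f' g)) (\<lambda>i. ev \<theta> (f i))"
      unfolding frac_tuple_comp_tuple by (rule proportional_trans)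
  qed
  obtain g where "g \<in> ratmap n \<theta>" using \<theta> by (rule dominantE)
  then have "(\<Union>f\<in>ratmap n \<phi>. \<Union>g\<in>ratmap n \<theta>. polmap n (comp_tuple f g)) = ratmap n (\<lambda>i. ev \<theta> (f i))"
    using * f(1) by blast
  then show ?thesis by (simp add: Bir_def)
qed

lemma Var_form_tuples: "Var \<in> form_tuples n"
  unfolding form_tuples_def
proof (intro CollectI conjI exI)
  show "\<forall>i\<le>n. form n 1 (Var i)" using form_Var by blast
  show "0 \<le> n" "Var 0 \<noteq> 0" by simp_all
qed

lemma dominant_Var: "dominant n (frac_tuple Var)"
  by (rule dominantI[OF Var_form_tuples]) (simp_all add: ev_to_fract_Var)

text \<open>A form that vanishes at f vanishes at the composite with g, which is a multiple of the
  generic point, and is therefore zero by homogeneity.\<close>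

lemma dominant_of_left_inverse:
  assumes f: "f \<in> form_tuples n" and "comp_tuple f g \<in> polmap n Var"
  shows "dominant n (frac_tuple f)"
proof (rule dominantI[OF f])
  fix d p assume p: "form n d p" "ev (frac_tuple f) p = 0"
  have "proportional n (frac_tuple (comp_tuple f g)) (frac_tuple Var)"
    using assms(2) by (subst (asm) mem_ratmap_iff) auto
  then obtain c where c: "c \<noteq> 0" "\<And>i. i \<le> n \<Longrightarrow> to_fract (comp_tuple f g i) = c * to_fract (Var i)"
    by (auto simp: proportional_def)
  have "subst_pol f p = 0" using p(2) by (simp flip: to_fract_subst_pol)
  then have "ev (frac_tuple g) (subst_pol f p) = 0" by simp
  then have "ev (frac_tuple (comp_tuple f g)) p = 0"
    by (simp add: ev_subst_pol frac_tuple_comp_tuple)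
  then have "c ^ d * ev (frac_tuple Var) p = 0"
    using const.poly_eval_cong_form[OF p(1) c(2)] const.poly_eval_scale_form[OF p(1)] by simp
  then show "p = 0" using c by (simp add: ev_to_fract_Var)
qed simp

section \<open>Associativity, units and inverses in \<open>Bir n\<close>\<close>

lemma carrier_BirE:
  assumes "F \<in> carrier (Bir n)"
  obtains f where "f \<in> form_tuples n" "dominant n (frac_tuple f)" "F = polmap n f"
  using assms dominant_of_left_inverse by (fastforce simp: Bir_def)

lemma Bir_mult_polmap:
  assumes f: "f \<in> form_tuples n" and g: "dominant n (frac_tuple g)"
  shows "polmap n f \<otimes>\<^bsub>Bir n\<^esub> polmap n g = polmap n (comp_tuple f g)"
proof -
  have nz: "\<exists>i\<le>n. to_fract (f i) \<noteq> 0" using f by (auto simp: form_tuples_def)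
  then have "f \<in> polmap n f" using f by (simp add: mem_ratmap_iff)
  from comp_ratmap[OF this nz g] show ?thesis by (simp add: frac_tuple_comp_tuple)
qed

lemma Bir_assoc:
  assumes "F \<in> carrier (Bir n)" "G \<in> carrier (Bir n)" "H \<in> carrier (Bir n)"
  shows "F \<otimes>\<^bsub>Bir n\<^esub> G \<otimes>\<^bsub>Bir n\<^esub> H = F \<otimes>\<^bsub>Bir n\<^esub> (G \<otimes>\<^bsub>Bir n\<^esub> H)"
proof -
  obtain f where f: "f \<in> form_tuples n" "dominant n (frac_tuple f)" "F = polmap n f"
    using assms(1) by (rule carrier_BirE)
  obtain g where g: "g \<in> form_tuples n" "dominant n (frac_tuple g)" "G = polmap n g"
    using assms(2) by (rule carrier_BirE)
  obtain h where h: "h \<in> form_tuples n" "dominant n (frac_tuple h)" "H = polmap n h"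
    using assms(3) by (rule carrier_BirE)
  have "dominant n (frac_tuple (comp_tuple g h))"
    unfolding frac_tuple_comp_tuple by (rule dominant_comp[OF g(1,2) h(2)])
  moreover have "comp_tuple f g \<in> form_tuples n"
    by (rule comp_tuple_form_tuples[OF f(1) g(1,2)])
  moreover have "comp_tuple (comp_tuple f g) h = comp_tuple f (comp_tuple g h)"
    by (simp add: comp_tuple_def subst_pol_subst_pol)
  ultimately show ?thesis by (simp add: f(1,3) g h Bir_mult_polmap)
qed

lemma Bir_one: "\<one>\<^bsub>Bir n\<^esub> = polmap n Var"
  by (simp add: Bir_def)

lemma Bir_one_left:
  assumes "dominant n \<theta>"
  shows "\<one>\<^bsub>Bir n\<^esub> \<otimes>\<^bsub>Bir n\<^esub> ratmap n \<theta> = ratmap n \<theta>"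
proof -
  have nz: "\<exists>i\<le>n. to_fract (Var i) \<noteq> 0" by auto
  then have "Var \<in> polmap n Var" using Var_form_tuples by (simp add: mem_ratmap_iff)
  from comp_ratmap[OF this nz assms] show ?thesis by (simp add: Bir_def)
qed

lemma Bir_one_right:
  assumes "f \<in> form_tuples n"
  shows "polmap n f \<otimes>\<^bsub>Bir n\<^esub> \<one>\<^bsub>Bir n\<^esub> = polmap n f"
  using Bir_mult_polmap[OF assms dominant_Var] by (simp add: Bir_def comp_tuple_def)

text \<open>\<open>m_inv\<close> is a definite description, so uniqueness has to be supplied: H = H
  F G = G, by associativity and the unit laws.\<close>

lemma Bir_m_inv_eq:
  assumes F: "F \<in> carrier (Bir n)" and G: "G \<in> carrier (Bir n)"
    and FG: "F \<otimes>\<^bsub>Bir n\<^esub> G = \<one>\<^bsub>Bir n\<^esub>" and GF: "G \<otimes>\<^bsub>Bir n\<^esub> F = \<one>\<^bsub>Bir n\<^esub>"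
  shows "inv\<^bsub>Bir n\<^esub> F = G"
  unfolding m_inv_def
proof (rule the_equality)
  fix H assume H: "H \<in> carrier (Bir n) \<and> F \<otimes>\<^bsub>Bir n\<^esub> H = \<one>\<^bsub>Bir n\<^esub> \<and> H \<otimes>\<^bsub>Bir n\<^esub> F = \<one>\<^bsub>Bir n\<^esub>"
  then have "H = H \<otimes>\<^bsub>Bir n\<^esub> (F \<otimes>\<^bsub>Bir n\<^esub> G)"
    using FG Bir_one_right by (metis carrier_BirE)
  also have "\<dots> = G" using Bir_assoc[OF _ F G, of H] H Bir_one_left by (metis G carrier_BirE)
  finally show "H = G" .
qed (use assms in auto)

section \<open>Tuples representing the elements of $G_n$\<close>

definition lin_forms :: "nat \<Rightarrow> 'a::field mat \<Rightarrow> nat \<Rightarrow> 'a mpol" where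
  "lin_forms n M i = (\<Sum>j\<le>n. Cst (M $$ (i, j)) * Var j)"

definition cremona_forms :: "nat \<Rightarrow> nat \<Rightarrow> 'a::field mpol" where
  "cremona_forms n i = (\<Prod>j\<in>{..n} - {i}. Var j)"

text \<open>The rule \<open>proportional\<close> with factor 1 also changes entries above index n at
  will; the coordinate and row operations rely on this.\<close>

inductive_set G_tuples :: "nat \<Rightarrow> (nat \<Rightarrow> 'a::field mpol fract) set" for n where
  Var: "frac_tuple Var \<in> G_tuples n"
| proportional: "\<psi> \<in> G_tuples n \<Longrightarrow> proportional n \<phi> \<psi> \<Longrightarrow> \<phi> \<in> G_tuples n"
| linear: "\<psi> \<in> G_tuples n \<Longrightarrow> M \<in> carrier (GL (n + 1)) \<Longrightarrow>
    (\<lambda>i. \<Sum>j\<le>n. const (M $$ (i, j)) * \<psi> j) \<in> G_tuples n"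
| inverse: "\<psi> \<in> G_tuples n \<Longrightarrow> (\<lambda>i. 1 / \<psi> i) \<in> G_tuples n"

lemma ev_lin_forms: "ev \<theta> (lin_forms n M i) = (\<Sum>j\<le>n. const (M $$ (i, j)) * \<theta> j)"
  by (simp add: lin_forms_def ev.hom_sum ev.hom_mult)

lemma ev_cremona_forms:
  assumes "\<And>i. i \<le> n \<Longrightarrow> \<theta> i \<noteq> 0"
  shows "proportional n (\<lambda>i. ev \<theta> (cremona_forms n i)) (\<lambda>i. 1 / \<theta> i)"
  unfolding proportional_def
proof (intro exI conjI allI impI)
  show "(\<Prod>j\<le>n. \<theta> j) \<noteq> 0" using assms by simp
  fix i assume "i \<le> n"
  then have "(\<Prod>j\<le>n. \<theta> j) = \<theta> i * (\<Prod>j\<in>{..n} - {i}. \<theta> j)" by (intro prod.remove) auto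
  then show "ev \<theta> (cremona_forms n i) = (\<Prod>j\<le>n. \<theta> j) * (1 / \<theta> i)"
    using assms[OF \<open>i \<le> n\<close>] by (simp add: cremona_forms_def ev.hom_prod)
qed

lemma comp_lin_forms:
  assumes "M \<in> carrier_mat (n + 1) (n + 1)" "N \<in> carrier_mat (n + 1) (n + 1)" "M * N = 1\<^sub>m (n + 1)"
    and "i \<le> n"
  shows "comp_tuple (lin_forms n M) (lin_forms n N) i = Var i"
proof -
  have "comp_tuple (lin_forms n M) (lin_forms n N) i =
      (\<Sum>j\<le>n. \<Sum>k\<le>n. Cst (M $$ (i, j)) * (Cst (N $$ (j, k)) * Var k))"
    by (simp add: comp_tuple_def lin_forms_def subst_pol_eq_poly_eval subst.hom_sum subst.hom_mult
        sum_distrib_left)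
  also have "\<dots> = (\<Sum>k\<le>n. \<Sum>j\<le>n. Cst (M $$ (i, j)) * (Cst (N $$ (j, k)) * Var k))"
    by (rule sum.swap)
  also have "\<dots> = (\<Sum>k\<le>n. Cst ((M * N) $$ (i, k)) * Var k)"
  proof (rule sum.cong[OF refl])
    fix k assume "k \<in> {..n}"
    then have "(M * N) $$ (i, k) = (\<Sum>j\<le>n. M $$ (i, j) * N $$ (j, k))"
      using assms(1,2,4) by (simp add: scalar_prod_def atLeast0LessThan lessThan_Suc_atMost)
    then show "(\<Sum>j\<le>n. Cst (M $$ (i, j)) * (Cst (N $$ (j, k)) * Var k)) = Cst ((M * N) $$ (i, k)) * Var k"
      by (simp add: Cst.hom_sum Cst.hom_mult sum_distrib_right mult.assoc)
  qed
  also have "\<dots> = (\<Sum>k\<le>n. if k = i then Var i else 0)"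
    using assms by (intro sum.cong) auto
  finally show ?thesis using assms by simp
qed

lemma form_lin_forms: "form n 1 (lin_forms n M i)"
  unfolding lin_forms_def
proof (rule form_sum)
  fix j assume "j \<in> {..n}"
  then show "form n 1 (Cst (M $$ (i, j)) * Var j)" using form_mult[OF form_Cst form_Var] by fastforce
qed

lemma polmap_Var_cong:
  assumes "\<And>i. i \<le> n \<Longrightarrow> f i = Var i"
  shows "f \<in> polmap n Var"
  using assms Var_form_tuples[of n] by (auto simp: ratmap_def form_tuples_def)

lemma lin_forms_form_tuples:
  assumes "M \<in> carrier (GL (n + 1))"
  shows "lin_forms n M \<in> form_tuples n"
proof -
  obtain N where N: "N \<in> carrier_mat (n + 1) (n + 1)" "M * N = 1\<^sub>m (n + 1)"
    using assms by (auto simp: carrier_GL)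
  have M: "M \<in> carrier_mat (n + 1) (n + 1)" using assms by (auto simp: carrier_GL)
  have "\<exists>i\<le>n. lin_forms n M i \<noteq> 0"
  proof (rule ccontr)
    assume "\<not> ?thesis"
    then have "comp_tuple (lin_forms n M) (lin_forms n N) 0 = 0"
      by (simp add: comp_tuple_def subst_pol_def)
    with comp_lin_forms[OF M N(1) N(2), of 0] show False by simp
  qed
  then show ?thesis using form_lin_forms by (auto simp: form_tuples_def)
qed

lemma cremona_forms_form_tuples: "cremona_forms n \<in> form_tuples n"
  unfolding form_tuples_def
proof (intro CollectI conjI exI allI impI)
  fix i assume "i \<le> n"
  have "form n (\<Sum>j\<in>{..n} - {i}. 1) (cremona_forms n i)"
    unfolding cremona_forms_def by (intro form_prod form_Var) auto
  then show "form n n (cremona_forms n i)" using \<open>i \<le> n\<close> by simp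
next
  show "0 \<le> n" "cremona_forms n 0 \<noteq> 0" by (auto simp: cremona_forms_def)
qed

lemma comp_cremona_forms:
  "comp_tuple (cremona_forms n) (cremona_forms n) \<in> polmap n (Var :: nat \<Rightarrow> 'a::field mpol)"
proof -
  let ?C = "cremona_forms n :: nat \<Rightarrow> 'a mpol"
  have nz: "to_fract (?C i) \<noteq> 0" for i by (auto simp: cremona_forms_def)
  have pr: "proportional n (frac_tuple ?C) (\<lambda>i. 1 / to_fract (Var i))"
    using ev_cremona_forms[of n "frac_tuple Var"] by (simp add: ev_to_fract_Var)
  have "proportional n (\<lambda>i. 1 / frac_tuple ?C i) (frac_tuple Var)"
  proof -
    obtain c where c: "c \<noteq> 0" "\<And>i. i \<le> n \<Longrightarrow> frac_tuple ?C i = c * (1 / to_fract (Var i))"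
      using pr by (auto simp: proportional_def)
    show ?thesis
      unfolding proportional_def by (rule exI[of _ "inverse c"]) (auto simp: c field_simps)
  qed
  then have "proportional n (frac_tuple (comp_tuple ?C ?C)) (frac_tuple Var)"
    unfolding frac_tuple_comp_tuple by (rule proportional_trans[OF ev_cremona_forms[OF nz]])
  \<comment> \<open>A nonzero entry is read off from the proportionality just shown:
    \<open>comp_tuple_form_tuples\<close> asks for dominance of the Cremona forms, which is deduced
    from this very lemma.\<close>
  moreover have "comp_tuple ?C ?C \<in> form_tuples n"
    unfolding form_tuples_def
  proof (intro CollectI conjI)
    obtain d where "\<And>i. i \<le> n \<Longrightarrow> form n d (?C i)"
      using cremona_forms_form_tuples by (auto simp: form_tuples_def)
    then have "form n (d * d) (comp_tuple ?C ?C i)" if "i \<le> n" for i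
      unfolding comp_tuple_def using that by (intro form_subst_pol) auto
    then show "\<exists>d. \<forall>i\<le>n. form n d (comp_tuple ?C ?C i)" by blast
    have "\<exists>i\<le>n. frac_tuple (comp_tuple ?C ?C) i \<noteq> 0"
      using calculation by (subst proportional_nonzero) auto
    then show "\<exists>i\<le>n. comp_tuple ?C ?C i \<noteq> 0" by simp
  qed
  ultimately show ?thesis by (subst mem_ratmap_iff) auto
qed

lemma dominant_cremona_forms: "dominant n (frac_tuple (cremona_forms n))"
  by (rule dominant_of_left_inverse[OF cremona_forms_form_tuples comp_cremona_forms])

lemma dominant_lin_forms:
  assumes "M \<in> carrier (GL (n + 1))"
  shows "dominant n (frac_tuple (lin_forms n M))"
proof -
  obtain N where N: "N \<in> carrier_mat (n + 1) (n + 1)" "M * N = 1\<^sub>m (n + 1)"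
    using assms by (auto simp: carrier_GL)
  have M: "M \<in> carrier_mat (n + 1) (n + 1)" using assms by (auto simp: carrier_GL)
  show ?thesis
    by (rule dominant_of_left_inverse[OF lin_forms_form_tuples[OF assms]])
      (rule polmap_Var_cong, rule comp_lin_forms[OF M N])
qed

lemma std_involution_eq: "std_involution n = polmap n (cremona_forms n)"
  unfolding std_involution_def
  using ev_cremona_forms[of n "frac_tuple Var"]
  by (intro ratmap_cong_proportional[OF proportional_sym]) (simp add: ev_to_fract_Var)

lemma Aut_P_eq: "Aut_P n = {polmap n (lin_forms n M) | M. M \<in> carrier (GL (n + 1))}"
  by (simp add: Aut_P_def lin_forms_def[abs_def])

lemma G_tuples_dominant: "\<psi> \<in> G_tuples n \<Longrightarrow> dominant n \<psi>"
proof (induction rule: G_tuples.induct)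
  case Var
  then show ?case by (rule dominant_Var)
next
  case (proportional \<psi> \<phi>)
  then show ?case by (blast intro: dominant_cong_proportional)
next
  case (linear \<psi> M)
  from dominant_comp[OF lin_forms_form_tuples dominant_lin_forms linear(3), OF linear(2) linear(2)]
  show ?case by (simp add: ev_lin_forms)
next
  case (inverse \<psi>)
  have "proportional n (\<lambda>i. 1 / \<psi> i) (\<lambda>i. ev \<psi> (cremona_forms n i))"
    by (rule proportional_sym[OF ev_cremona_forms[OF dominant_nonzero[OF inverse(2)]]])
  then show ?case
    by (rule dominant_cong_proportional[rotated])
      (rule dominant_comp[OF cremona_forms_form_tuples dominant_cremona_forms inverse(2)])
qed

lemma G_tuples_nonzero: "\<psi> \<in> G_tuples n \<Longrightarrow> i \<le> n \<Longrightarrow> \<psi> i \<noteq> 0"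
  by (rule dominant_nonzero[OF G_tuples_dominant])

lemma polmap_mult_ratmap:
  assumes "f \<in> form_tuples n" "dominant n \<theta>"
  shows "polmap n f \<otimes>\<^bsub>Bir n\<^esub> ratmap n \<theta> = ratmap n (\<lambda>i. ev \<theta> (f i))"
proof -
  have nz: "\<exists>i\<le>n. to_fract (f i) \<noteq> 0" using assms by (auto simp: form_tuples_def)
  then have "f \<in> polmap n f" using assms by (simp add: mem_ratmap_iff)
  from comp_ratmap[OF this nz assms(2)] show ?thesis .
qed

lemma ratmap_G_tuples_subset: "\<psi> \<in> G_tuples n \<Longrightarrow> ratmap n \<psi> \<in> G_sub n"
proof (induction rule: G_tuples.induct)
  case Var
  have "\<one>\<^bsub>Bir n\<^esub> \<in> G_sub n" unfolding G_sub_def by (rule generate.one)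
  then show ?case by (simp add: Bir_def)
next
  case (proportional \<psi> \<phi>)
  then show ?case using ratmap_cong_proportional[OF proportional(2)] by simp
next
  case (linear \<psi> M)
  have "polmap n (lin_forms n M) \<in> G_sub n"
    unfolding G_sub_def Aut_P_eq using linear(2) by (intro generate.incl) auto
  with linear(3) have "polmap n (lin_forms n M) \<otimes>\<^bsub>Bir n\<^esub> ratmap n \<psi> \<in> G_sub n"
    unfolding G_sub_def by (intro generate.eng)
  then show ?case
    using polmap_mult_ratmap[OF lin_forms_form_tuples[OF linear(2)] G_tuples_dominant[OF linear(1)]]
    by (simp add: ev_lin_forms)
next
  case (inverse \<psi>)
  have "polmap n (cremona_forms n) \<in> G_sub n"
    unfolding G_sub_def std_involution_eq by (intro generate.incl) auto
  with inverse(2) have "polmap n (cremona_forms n) \<otimes>\<^bsub>Bir n\<^esub> ratmap n \<psi> \<in> G_sub n"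
    unfolding G_sub_def by (intro generate.eng)
  then show ?case
    using polmap_mult_ratmap[OF cremona_forms_form_tuples G_tuples_dominant[OF inverse(1)]]
      ratmap_cong_proportional[OF ev_cremona_forms, OF G_tuples_nonzero[OF inverse(1)]]
    by simp
qed

text \<open>Here s is the outermost letter of a word and \<psi> the rest of it. The lemma pulls s
  out of the composition with \<theta>, which is the inductive step of
  \<open>G_tuples_comp\<close>.\<close>

lemma ev_comp_step:
  assumes s: "s \<in> form_tuples n" and f': "f' \<in> form_tuples n" "dominant n (frac_tuple f')"
    and pr: "proportional n (frac_tuple f') \<psi>" "proportional n \<phi> (\<lambda>i. ev \<psi> (s i))"
    and \<phi>: "dominant n \<phi>" "f \<in> ratmap n \<phi>" and \<theta>: "dominant n \<theta>"
  shows "proportional n (\<lambda>i. ev \<theta> (f i)) (\<lambda>i. ev (\<lambda>j. ev \<theta> (f' j)) (s i))"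
proof -
  have f: "f \<in> form_tuples n" "proportional n (frac_tuple f) \<phi>"
    using \<phi> by (simp_all add: mem_ratmap_dominant_iff)
  have "proportional n (frac_tuple (comp_tuple s f')) (\<lambda>i. ev \<psi> (s i))"
    unfolding frac_tuple_comp_tuple by (rule ev_scale[OF s pr(1)])
  then have "proportional n (frac_tuple f) (frac_tuple (comp_tuple s f'))"
    by (intro proportional_trans[OF f(2) proportional_trans[OF pr(2) proportional_sym]])
  from ev_proportional[OF f(1) comp_tuple_form_tuples[OF s f'] this \<theta>]
  show ?thesis by (simp add: comp_tuple_def ev_subst_pol)
qed

text \<open>Induction on the left factor, with \<theta> fixed. The representative f is arbitrary
  because the shorter word has a representative of its own.\<close>

lemma G_tuples_comp:
  fixes \<psi> \<theta> :: "nat \<Rightarrow> 'a::field mpol fract"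
  assumes "\<psi> \<in> G_tuples n" "\<theta> \<in> G_tuples n" "f \<in> ratmap n \<psi>"
  shows "(\<lambda>i. ev \<theta> (f i)) \<in> G_tuples n"
  using assms(1,3)
proof (induction arbitrary: f rule: G_tuples.induct)
  case Var
  have "\<exists>i\<le>n. frac_tuple Var i \<noteq> (0 :: 'a mpol fract)" by auto
  with Var have "f \<in> form_tuples n" "proportional n (frac_tuple f) (frac_tuple Var)"
    by (simp_all add: mem_ratmap_iff)
  from ev_proportional[OF this(1) Var_form_tuples this(2) G_tuples_dominant[OF assms(2)]]
  show ?case by (intro G_tuples.proportional[OF assms(2)]) simp
next
  case (proportional \<psi> \<phi>)
  then show ?case using ratmap_cong_proportional[OF proportional(2)] by simp
next
  case (linear \<psi> M)
  obtain f' where f': "f' \<in> form_tuples n" "proportional n (frac_tuple f') \<psi>" "f' \<in> ratmap n \<psi>"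
      "dominant n (frac_tuple f')"
    using G_tuples_dominant[OF linear(1)] by (rule dominantE)
  have D: "dominant n (\<lambda>i. ev \<psi> (lin_forms n M i))"
    by (rule dominant_comp[OF lin_forms_form_tuples[OF linear(2)] dominant_lin_forms[OF linear(2)]
          G_tuples_dominant[OF linear(1)]])
  have f: "f \<in> ratmap n (\<lambda>i. ev \<psi> (lin_forms n M i))"
    using linear(4) unfolding ev_lin_forms .
  have G: "(\<lambda>i. ev (\<lambda>j. ev \<theta> (f' j)) (lin_forms n M i)) \<in> G_tuples n"
    unfolding ev_lin_forms by (rule G_tuples.linear[OF linear(3)[OF f'(3)] linear(2)])
  have "proportional n (\<lambda>i. ev \<theta> (f i)) (\<lambda>i. ev (\<lambda>j. ev \<theta> (f' j)) (lin_forms n M i))"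
    using lin_forms_form_tuples[OF linear(2)] f'(1,4,2) _ D f G_tuples_dominant[OF assms(2)]
    by (rule ev_comp_step) (rule proportional_refl)
  with G show ?case by (rule G_tuples.proportional)
next
  case (inverse \<psi>)
  obtain f' where f': "f' \<in> form_tuples n" "proportional n (frac_tuple f') \<psi>" "f' \<in> ratmap n \<psi>"
      "dominant n (frac_tuple f')"
    using G_tuples_dominant[OF inverse(1)] by (rule dominantE)
  have pr: "proportional n (\<lambda>i. 1 / \<psi> i) (\<lambda>i. ev \<psi> (cremona_forms n i))"
    by (rule proportional_sym[OF ev_cremona_forms[OF G_tuples_nonzero[OF inverse(1)]]])
  have G: "(\<lambda>j. ev \<theta> (f' j)) \<in> G_tuples n" by (rule inverse(2)[OF f'(3)])
  have "proportional n (\<lambda>i. ev \<theta> (f i)) (\<lambda>i. ev (\<lambda>j. ev \<theta> (f' j)) (cremona_forms n i))"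
    by (rule ev_comp_step[OF cremona_forms_form_tuples f'(1,4,2) pr
      G_tuples_dominant[OF G_tuples.inverse[OF inverse(1)]] inverse(3) G_tuples_dominant[OF assms(2)]])
  moreover have "proportional n (\<lambda>i. ev (\<lambda>j. ev \<theta> (f' j)) (cremona_forms n i)) (\<lambda>i. 1 / ev \<theta> (f' i))"
    by (intro ev_cremona_forms G_tuples_nonzero[OF G])
  ultimately show ?case
    by (intro G_tuples.proportional[OF G_tuples.inverse[OF G]]) (rule proportional_trans)
qed

lemma G_tuples_comp_ratmap:
  assumes "\<psi> \<in> G_tuples n" "\<theta> \<in> G_tuples n"
  shows "ratmap n \<psi> \<otimes>\<^bsub>Bir n\<^esub> ratmap n \<theta> \<in> ratmap n ` G_tuples n"
proof -
  obtain f where f: "f \<in> ratmap n \<psi>" using G_tuples_dominant[OF assms(1)] by (rule dominantE)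
  have "\<exists>i\<le>n. \<psi> i \<noteq> 0" using G_tuples_nonzero[OF assms(1)] by auto
  from comp_ratmap[OF f this G_tuples_dominant[OF assms(2)]] G_tuples_comp[OF assms f]
  show ?thesis by auto
qed

lemma G_sub_eq: "(G_sub n :: (nat \<Rightarrow> 'a::field mpol) set set) = ratmap n ` G_tuples n"
proof
  have lin: "polmap n (lin_forms n M) \<in> ratmap n ` G_tuples n" if "M \<in> carrier (GL (n + 1))" for M :: "'a mat"
  proof (rule image_eqI[OF refl])
    show "frac_tuple (lin_forms n M) \<in> G_tuples n"
      using G_tuples.linear[OF G_tuples.Var that] by (simp add: lin_forms_def)
  qed
  have cre: "polmap n (cremona_forms n :: nat \<Rightarrow> 'a mpol) \<in> ratmap n ` G_tuples n"
    unfolding std_involution_eq[symmetric] std_involution_def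
    by (rule imageI[OF G_tuples.inverse[OF G_tuples.Var]])
  show "(G_sub n :: (nat \<Rightarrow> 'a mpol) set set) \<subseteq> ratmap n ` G_tuples n"
  proof
    fix F :: "(nat \<Rightarrow> 'a mpol) set" assume "F \<in> G_sub n"
    then show "F \<in> ratmap n ` G_tuples n"
      unfolding G_sub_def
    proof (induction rule: generate.induct)
      case one
      show ?case unfolding Bir_one by (rule imageI[OF G_tuples.Var])
    next
      case (incl F)
      then show ?case using lin cre by (auto simp: Aut_P_eq std_involution_eq)
    next
      \<comment> \<open>\<open>generate\<close> admits inverses of generators. They are generators
        again: the standard involution is its own inverse, and the inverse matrix N inverts the
        class of M.\<close>
      case (inv F)
      show ?case
      proof (cases "F = std_involution n")
        case True
        let ?C = "cremona_forms n :: nat \<Rightarrow> 'a mpol"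
        have one: "polmap n ?C \<otimes>\<^bsub>Bir n\<^esub> polmap n ?C = \<one>\<^bsub>Bir n\<^esub>"
        proof -
          have "proportional n (frac_tuple (comp_tuple ?C ?C)) (frac_tuple Var)"
            using comp_cremona_forms by (subst (asm) mem_ratmap_iff) auto
          from ratmap_cong_proportional[OF this] show ?thesis
            by (simp add: Bir_mult_polmap cremona_forms_form_tuples dominant_cremona_forms Bir_one)
        qed
        have "polmap n ?C \<in> carrier (Bir n)"
          using cremona_forms_form_tuples comp_cremona_forms by (auto simp: Bir_def)
        from Bir_m_inv_eq[OF this this one one] show ?thesis using cre True by (simp add: std_involution_eq)
      next
        case False
        then obtain M where M: "M \<in> carrier (GL (n + 1))" "F = polmap n (lin_forms n M)"
          using inv by (auto simp: Aut_P_eq)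
        then obtain N where N: "N \<in> carrier_mat (n + 1) (n + 1)" "M * N = 1\<^sub>m (n + 1)" "N * M = 1\<^sub>m (n + 1)"
          by (auto simp: carrier_GL)
        have M': "M \<in> carrier_mat (n + 1) (n + 1)" using M by (auto simp: carrier_GL)
        have N': "N \<in> carrier (GL (n + 1))" using N M' by (auto simp: carrier_GL)
        have one: "polmap n (lin_forms n A) \<otimes>\<^bsub>Bir n\<^esub> polmap n (lin_forms n B) = \<one>\<^bsub>Bir n\<^esub>"
          and car: "polmap n (lin_forms n A) \<in> carrier (Bir n)"
          if A: "A \<in> carrier (GL (n + 1))" "B \<in> carrier (GL (n + 1))" "A * B = 1\<^sub>m (n + 1)" "B * A = 1\<^sub>m (n + 1)" for A B :: "'a mat"
        proof -
          have A': "A \<in> carrier_mat (n + 1) (n + 1)" "B \<in> carrier_mat (n + 1) (n + 1)"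
            using A by (auto simp: carrier_GL)
          have "proportional n (frac_tuple (comp_tuple (lin_forms n A) (lin_forms n B))) (frac_tuple Var)"
            using comp_lin_forms[OF A' A(3)] unfolding proportional_def by (intro exI[of _ 1]) auto
          from ratmap_cong_proportional[OF this]
          show "polmap n (lin_forms n A) \<otimes>\<^bsub>Bir n\<^esub> polmap n (lin_forms n B) = \<one>\<^bsub>Bir n\<^esub>"
            using A by (simp add: Bir_mult_polmap lin_forms_form_tuples dominant_lin_forms Bir_one)
          show "polmap n (lin_forms n A) \<in> carrier (Bir n)"
            using lin_forms_form_tuples[OF A(1)] lin_forms_form_tuples[OF A(2)]
              polmap_Var_cong[of n "comp_tuple (lin_forms n A) (lin_forms n B)", OF comp_lin_forms[OF A' A(3)]]
              polmap_Var_cong[of n "comp_tuple (lin_forms n B) (lin_forms n A)", OF comp_lin_forms[OF A'(2,1) A(4)]]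
            by (auto simp: Bir_def)
        qed
        have "inv\<^bsub>Bir n\<^esub> F = polmap n (lin_forms n N)"
          unfolding M(2) using car one M N N' by (intro Bir_m_inv_eq) auto
        then show ?thesis using lin[OF N'] by simp
      qed
    next
      case (eng F G)
      then show ?case using G_tuples_comp_ratmap by blast
    qed
  qed
qed (use ratmap_G_tuples_subset in blast)

text \<open>Equal classes share a representative and so have proportional tuples; membership in G_n
  becomes a property of one tuple.\<close>

lemma ratmap_mem_G_sub_iff:
  assumes "\<exists>i\<le>n. \<phi> i \<noteq> 0"
  shows "ratmap n \<phi> \<in> G_sub n \<longleftrightarrow> \<phi> \<in> G_tuples n"
proof
  assume "ratmap n \<phi> \<in> G_sub n"
  then obtain \<psi> where \<psi>: "\<psi> \<in> G_tuples n" "ratmap n \<phi> = ratmap n \<psi>" by (auto simp: G_sub_eq)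
  obtain f where "f \<in> ratmap n \<psi>" using G_tuples_dominant[OF \<psi>(1)] by (rule dominantE)
  with \<psi>(2) have "f \<in> ratmap n \<phi>" "f \<in> ratmap n \<psi>" by simp_all
  then have "proportional n (frac_tuple f) \<phi>" "proportional n (frac_tuple f) \<psi>"
    using assms G_tuples_dominant[OF \<psi>(1)] by (simp_all add: mem_ratmap_iff mem_ratmap_dominant_iff)
  then have "proportional n \<phi> \<psi>" by (rule proportional_trans[OF proportional_sym])
  with \<psi>(1) show "\<phi> \<in> G_tuples n" by (rule G_tuples.proportional)
qed (rule ratmap_G_tuples_subset)

section \<open>Operations on coordinates realised in $G_n$\<close>

lemma GL_Units: "carrier (GL n) = Units (ring_mat TYPE('r::comm_ring_1) n ())"
  by (simp add: GL_def units_of_def)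

lemma const_simps [simp]: "const 0 = 0" "const 1 = 1" "const (- c) = - const c" "const (a + b) = const a + const b"
  "const (a * b) = const a * const b"
  by (simp_all add: Cst.hom_uminus Cst.hom_add Cst.hom_mult)

lemma const_numeral [simp]: "const (numeral v) = numeral v"
proof -
  have "to_fract (of_nat m) = of_nat m" for m by (induction m) simp_all
  from this[of "numeral v"] show ?thesis by (simp add: Cst_def)
qed

lemma G_tuples_add:
  assumes \<psi>: "\<psi> \<in> G_tuples n" and ij: "i \<le> n" "j \<le> n" "i \<noteq> j"
  shows "\<psi>(i := \<psi> i + const c * \<psi> j) \<in> G_tuples n"
proof -
  let ?M = "addrow_mat (n + 1) c i j"
  have "?M \<in> carrier (GL (n + 1))" unfolding GL_Units using ij by (intro addrow_mat_Unit) auto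
  note G_tuples.linear[OF \<psi> this]
  moreover have "(\<psi>(i := \<psi> i + const c * \<psi> j)) k = (\<Sum>l\<le>n. const (?M $$ (k, l)) * \<psi> l)" if "k \<le> n" for k
  proof -
    have "(\<Sum>l\<le>n. const (?M $$ (k, l)) * \<psi> l) =
        (\<Sum>l\<le>n. (if l = k then \<psi> l else 0) + (if l = j then if k = i then const c * \<psi> l else 0 else 0))"
      using that ij by (intro sum.cong) (auto simp: algebra_simps)
    then show ?thesis using that ij by (simp add: sum.distrib)
  qed
  then have "proportional n (\<psi>(i := \<psi> i + const c * \<psi> j)) (\<lambda>k. \<Sum>l\<le>n. const (?M $$ (k, l)) * \<psi> l)"
    unfolding proportional_def by (intro exI[of _ 1]) simp
  ultimately show ?thesis by (rule G_tuples.proportional)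
qed

lemma G_tuples_scale:
  assumes \<psi>: "\<psi> \<in> G_tuples n" and i: "i \<le> n" and c: "c \<noteq> 0"
  shows "\<psi>(i := const c * \<psi> i) \<in> G_tuples n"
proof -
  let ?M = "multrow_mat (n + 1) i c"
  have "?M \<in> carrier (GL (n + 1))" unfolding GL_Units using i c by (intro multrow_mat_Unit) auto
  note G_tuples.linear[OF \<psi> this]
  moreover have "(\<psi>(i := const c * \<psi> i)) k = (\<Sum>l\<le>n. const (?M $$ (k, l)) * \<psi> l)" if "k \<le> n" for k
  proof -
    have "(\<Sum>l\<le>n. const (?M $$ (k, l)) * \<psi> l) =
        (\<Sum>l\<le>n. if l = k then (if k = i then const c * \<psi> l else \<psi> l) else 0)"
      using that i by (intro sum.cong) auto
    then show ?thesis using that i by simp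
  qed
  then have "proportional n (\<psi>(i := const c * \<psi> i)) (\<lambda>k. \<Sum>l\<le>n. const (?M $$ (k, l)) * \<psi> l)"
    unfolding proportional_def by (intro exI[of _ 1]) simp
  ultimately show ?thesis by (rule G_tuples.proportional)
qed

lemma G_tuples_swap:
  assumes \<psi>: "\<psi> \<in> G_tuples n" and ij: "i \<le> n" "j \<le> n" "i \<noteq> j"
  shows "\<psi>(i := \<psi> j, j := \<psi> i) \<in> G_tuples n"
proof -
  let ?M = "swaprows_mat (n + 1) i j"
  have "?M \<in> carrier (GL (n + 1))" unfolding GL_Units using ij by (intro swaprows_mat_Unit) auto
  note G_tuples.linear[OF \<psi> this]
  moreover have "(\<psi>(i := \<psi> j, j := \<psi> i)) k = (\<Sum>l\<le>n. const (?M $$ (k, l)) * \<psi> l)" if "k \<le> n" for k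
  proof -
    have "(\<Sum>l\<le>n. const (?M $$ (k, l)) * \<psi> l) =
        (\<Sum>l\<le>n. if l = (if k = i then j else if k = j then i else k) then \<psi> l else 0)"
      using that ij by (intro sum.cong) auto
    then show ?thesis using that ij by simp
  qed
  then have "proportional n (\<psi>(i := \<psi> j, j := \<psi> i)) (\<lambda>k. \<Sum>l\<le>n. const (?M $$ (k, l)) * \<psi> l)"
    unfolding proportional_def by (intro exI[of _ 1]) simp
  ultimately show ?thesis by (rule G_tuples.proportional)
qed

lemma G_tuples_harmonic_add:
  assumes \<psi>: "\<psi> \<in> G_tuples n" and ij: "i \<le> n" "j \<le> n" "i \<noteq> j"
  shows "\<psi>(i := 1 / (1 / \<psi> i + 1 / \<psi> j)) \<in> G_tuples n"
proof -
  from G_tuples.inverse[OF G_tuples_add[OF G_tuples.inverse[OF \<psi>] ij, of 1]]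
  show ?thesis by (rule G_tuples.proportional) (auto simp: proportional_def intro!: exI[of _ 1])
qed

text \<open>In terms of u = \<psi>_i / \<psi>_j the moves are u -> u - 1 -> 1 - 1/u -> - 1/u -> 1/u,
  where the second arrow is the harmonic addition v -> v / (v + 1).\<close>

lemma G_tuples_reflect:
  assumes \<psi>: "\<psi> \<in> G_tuples n" and ij: "i \<le> n" "j \<le> n" "i \<noteq> j"
  shows "\<psi>(i := \<psi> j ^ 2 / \<psi> i) \<in> G_tuples n"
proof -
  let ?a = "\<psi> i - \<psi> j"
  have 1: "\<psi>(i := ?a) \<in> G_tuples n" using G_tuples_add[OF \<psi> ij, of "-1"] by simp
  \<comment> \<open>The difference is nonzero because it is an entry of a tuple in
    \<open>G_tuples\<close>.\<close>
  have nz: "?a \<noteq> 0" "\<psi> i \<noteq> 0" "\<psi> j \<noteq> 0"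
    using G_tuples_nonzero[OF 1 ij(1)] G_tuples_nonzero[OF \<psi>] ij by auto
  have "1 / (1 / ?a + 1 / \<psi> j) = ?a * \<psi> j / \<psi> i"
    using nz by (simp add: field_simps)
  then have "\<psi>(i := ?a * \<psi> j / \<psi> i) \<in> G_tuples n" using G_tuples_harmonic_add[OF 1 ij] ij by simp
  from G_tuples_scale[OF G_tuples_add[OF this ij, of "-1"] ij(1), of "-1"]
  have "\<psi>(i := - (?a * \<psi> j / \<psi> i - \<psi> j)) \<in> G_tuples n" using ij by simp
  moreover have "- (?a * \<psi> j / \<psi> i - \<psi> j) = \<psi> j ^ 2 / \<psi> i"
    using nz by (simp add: field_simps power2_eq_square)
  ultimately show ?thesis by simp
qed

lemma G_tuples_add_square_div:
  assumes \<psi>: "\<psi> \<in> G_tuples n" and "i \<le> n" "j \<le> n" "k \<le> n" "i \<noteq> j" "i \<noteq> k" "j \<noteq> k"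
  shows "\<psi>(i := \<psi> i + const c * \<psi> j ^ 2 / \<psi> k) \<in> G_tuples n"
proof -
  have "\<psi>(k := \<psi> j ^ 2 / \<psi> k) \<in> G_tuples n" using assms by (intro G_tuples_reflect) auto
  from G_tuples_reflect[OF G_tuples_add[OF this assms(2,4,6), of c] assms(4,3)]
  have "\<psi>(k := \<psi> j ^ 2 / \<psi> k, i := \<psi> i + const c * \<psi> j ^ 2 / \<psi> k, k := \<psi> j ^ 2 / (\<psi> j ^ 2 / \<psi> k)) \<in> G_tuples n"
    using assms by simp
  moreover have "\<psi>(k := \<psi> j ^ 2 / \<psi> k, i := \<psi> i + const c * \<psi> j ^ 2 / \<psi> k, k := \<psi> j ^ 2 / (\<psi> j ^ 2 / \<psi> k))
      = \<psi>(i := \<psi> i + const c * \<psi> j ^ 2 / \<psi> k)"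
    using assms G_tuples_nonzero[OF \<psi>] by (auto simp: fun_eq_iff)
  ultimately show ?thesis by simp
qed

lemma two_neq_0_of_CHAR:
  assumes "CHAR('a::field) \<noteq> 2"
  shows "(2 :: 'a) \<noteq> 0"
proof
  assume "(2 :: 'a) = 0"
  then have "CHAR('a) dvd 2" using of_nat_eq_0_iff_char_dvd[of 2, where 'a = 'a] by simp
  then have "CHAR('a) = 1" using assms by (metis two_is_prime_nat prime_nat_iff)
  then show False by simp
qed

text \<open>Polarisation of the previous lemma: $4 xy = (x + y)^2 - (x - y)^2$.\<close>

lemma G_tuples_add_prod_div:
  fixes \<psi> :: "nat \<Rightarrow> 'a::field mpol fract"
  assumes char: "CHAR('a) \<noteq> 2" and \<psi>: "\<psi> \<in> G_tuples n"
    and le: "i \<le> n" "j \<le> n" "k \<le> n" "l \<le> n" and ne: "distinct [i, j, k, l]"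
  shows "\<psi>(i := \<psi> i + const c * \<psi> j * \<psi> l / \<psi> k) \<in> G_tuples n"
proof -
  \<comment> \<open>d is c / 4, the sole place where characteristic 2 is excluded.\<close>
  define d where "d = inverse 2 * (inverse 2 * c)"
  have c: "c = 2 * (2 * d)"
    using two_neq_0_of_CHAR[OF char] by (simp only: d_def mult.assoc[symmetric] mult.commute[of 2]) simp
  let ?x = "\<psi> j" and ?y = "\<psi> l" and ?z = "\<psi> k"
  let ?f = "\<lambda>u v. \<psi>(i := u, j := v)"
  have 1: "?f (\<psi> i) (?x + ?y) \<in> G_tuples n"
    using G_tuples_add[OF \<psi> le(2,4), of 1] ne by simp
  have 2: "?f (\<psi> i + const d * (?x + ?y) ^ 2 / ?z) (?x + ?y) \<in> G_tuples n"
    using G_tuples_add_square_div[OF 1 le(1,2,3), of d] ne by (simp add: fun_upd_twist)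
  have 3: "?f (\<psi> i + const d * (?x + ?y) ^ 2 / ?z) (?x - ?y) \<in> G_tuples n"
    using G_tuples_add[OF 2 le(2,4), of "- 2"] ne by (simp add: algebra_simps)
  have 4: "?f (\<psi> i + const d * (?x + ?y) ^ 2 / ?z - const d * (?x - ?y) ^ 2 / ?z) (?x - ?y) \<in> G_tuples n"
    using G_tuples_add_square_div[OF 3 le(1,2,3), of "- d"] ne by (simp add: fun_upd_twist)
  have 5: "?f (\<psi> i + const d * (?x + ?y) ^ 2 / ?z - const d * (?x - ?y) ^ 2 / ?z) ?x \<in> G_tuples n"
    using G_tuples_add[OF 4 le(2,4), of 1] ne by simp
  have "\<psi> i + const d * (?x + ?y) ^ 2 / ?z - const d * (?x - ?y) ^ 2 / ?z
      = \<psi> i + const c * ?x * ?y / ?z"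
    unfolding c by (simp add: power2_eq_square algebra_simps add_divide_distrib diff_divide_distrib)
  with 5 show ?thesis using ne by (simp add: fun_upd_twist)
qed

text \<open>In the group generated by the transvections \<open>x += t y\<close>, \<open>y += s x\<close> with
  \<open>t = x\<^sub>l / x\<^sub>k\<close> and \<open>s = - 1 / t\<close> one finds the diagonal matrix with entries
  \<open>1 / t\<close> and \<open>t\<close>.\<close>

lemma G_tuples_diagonal:
  fixes \<psi> :: "nat \<Rightarrow> 'a::field mpol fract"
  assumes char: "CHAR('a) \<noteq> 2" and \<psi>: "\<psi> \<in> G_tuples n"
    and le: "i \<le> n" "j \<le> n" "k \<le> n" "l \<le> n" and ne: "distinct [i, j, k, l]"
  shows "\<psi>(i := \<psi> i * \<psi> k / \<psi> l, j := \<psi> j * \<psi> l / \<psi> k) \<in> G_tuples n"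
proof -
  let ?x = "\<psi> i" and ?y = "\<psi> j" and ?z = "\<psi> k" and ?w = "\<psi> l"
  have nz: "?z \<noteq> 0" "?w \<noteq> 0" using G_tuples_nonzero[OF \<psi>] le by auto
  let ?f = "\<lambda>u v. \<psi>(i := u, j := v)"
  have 1: "?f (?x + ?y * ?w / ?z) ?y \<in> G_tuples n"
    using G_tuples_add_prod_div[OF char \<psi> le(1,2,3,4) ne, of 1] ne by (simp add: fun_upd_twist)
  \<comment> \<open>The second transvection has the coefficient - 1 / t, so k and l exchange their
    roles.\<close>
  have d: "distinct [j, i, l, k]" using ne by auto
  have "?y - (?x + ?y * ?w / ?z) * ?z / ?w = - (?x * ?z / ?w)" using nz by (simp add: field_simps)
  then have 2: "?f (?x + ?y * ?w / ?z) (- (?x * ?z / ?w)) \<in> G_tuples n"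
    using G_tuples_add_prod_div[OF char 1 le(2,1,4,3) d, of "-1"] ne by simp
  have 3: "?f (?y * ?w / ?z) (- (?x * ?z / ?w)) \<in> G_tuples n"
    using G_tuples_add_prod_div[OF char 2 le(1,2,3,4) ne, of 1] ne nz by (simp add: fun_upd_twist)
  \<comment> \<open>The three transvections give the antidiagonal matrix with entries t and - 1 / t;
    a sign change and a swap make it diagonal.\<close>
  have 4: "?f (?y * ?w / ?z) (?x * ?z / ?w) \<in> G_tuples n"
    using G_tuples_scale[OF 3 le(2), of "-1"] by simp
  show ?thesis using G_tuples_swap[OF 4 le(1,2)] ne by (simp add: fun_upd_twist)
qed

section \<open>Row reduction of integer matrices\<close>

text \<open>As functions, matrices undergo row operations by function update. The lower index s
  singles out a block: s = 0 for the whole matrix, s = 1 once the first column is a unit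
  vector.\<close>

definition left_invertible :: "nat \<Rightarrow> nat \<Rightarrow> (nat \<Rightarrow> nat \<Rightarrow> int) \<Rightarrow> bool" where
  "left_invertible s n A \<longleftrightarrow> (\<exists>B. \<forall>i\<in>{s..<n}. \<forall>j\<in>{s..<n}.
     (\<Sum>t\<in>{s..<n}. B i t * A t j) = (if i = j then 1 else (0::int)))"

definition add_row :: "int \<Rightarrow> nat \<Rightarrow> nat \<Rightarrow> (nat \<Rightarrow> nat \<Rightarrow> int) \<Rightarrow> nat \<Rightarrow> nat \<Rightarrow> int" where
  [simp]: "add_row c i k A = A(i := \<lambda>j. A i j + c * A k j)"

definition neg_row :: "nat \<Rightarrow> (nat \<Rightarrow> nat \<Rightarrow> int) \<Rightarrow> nat \<Rightarrow> nat \<Rightarrow> int" where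
  [simp]: "neg_row i A = A(i := \<lambda>j. - A i j)"

lemma left_invertible_add_row:
  assumes "left_invertible s n A" "i \<in> {s..<n}" "k \<in> {s..<n}" "i \<noteq> k"
  shows "left_invertible s n (add_row c i k A)"
proof -
  obtain B where B: "\<And>p q. p \<in> {s..<n} \<Longrightarrow> q \<in> {s..<n} \<Longrightarrow>
      (\<Sum>t\<in>{s..<n}. B p t * A t q) = (if p = q then 1 else 0)"
    using assms(1) unfolding left_invertible_def by blast
  \<comment> \<open>B times the inverse elementary matrix, which acts on column k.\<close>
  define B' where "B' p = (B p)(k := B p k - c * B p i)" for p
  have "(\<Sum>t\<in>{s..<n}. B' p t * add_row c i k A t q) = (\<Sum>t\<in>{s..<n}. B p t * A t q)" for p q
  proof -
    have "(\<Sum>t\<in>{s..<n}. B' p t * add_row c i k A t q) =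
        (\<Sum>t\<in>{s..<n}. B p t * A t q + (if t = i then c * B p i * A k q else 0)
          - (if t = k then c * B p i * A k q else 0))"
      using assms(4) by (intro sum.cong) (auto simp: B'_def algebra_simps)
    then show ?thesis using assms by (simp add: sum.distrib sum_subtractf)
  qed
  then show ?thesis using B unfolding left_invertible_def by (intro exI[of _ B']) simp
qed

lemma left_invertible_neg_row:
  assumes "left_invertible s n A"
  shows "left_invertible s n (neg_row i A)"
proof -
  obtain B where B: "\<And>p q. p \<in> {s..<n} \<Longrightarrow> q \<in> {s..<n} \<Longrightarrow>
      (\<Sum>t\<in>{s..<n}. B p t * A t q) = (if p = q then 1 else 0)"
    using assms(1) unfolding left_invertible_def by blast
  have "(\<Sum>t\<in>{s..<n}. ((B p)(i := - B p i)) t * neg_row i A t q) = (\<Sum>t\<in>{s..<n}. B p t * A t q)" for p q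
    by (intro sum.cong) auto
  then show ?thesis using B unfolding left_invertible_def by (intro exI[of _ "\<lambda>p. (B p)(i := - B p i)"]) simp
qed

text \<open>Expresses that the entries of column k from row k on are coprime. Against the unit
  vectors in the earlier columns, row k of the left inverse must vanish at the earlier indices, so
  only the lower entries contribute to the 1.\<close>

lemma left_invertible_column:
  assumes "left_invertible s n A" "k \<in> {s..<n}"
    and "\<And>i j. j \<in> {s..<k} \<Longrightarrow> i \<in> {s..<n} \<Longrightarrow> A i j = (if i = j then 1 else 0)"
  obtains b where "(\<Sum>t\<in>{k..<n}. b t * A t k) = 1"
proof -
  obtain B where B: "\<And>p q. p \<in> {s..<n} \<Longrightarrow> q \<in> {s..<n} \<Longrightarrow>
      (\<Sum>t\<in>{s..<n}. B p t * A t q) = (if p = q then 1 else 0)"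
    using assms(1) unfolding left_invertible_def by blast
  have "B k j = 0" if j: "j \<in> {s..<k}" for j
  proof -
    have "(\<Sum>t\<in>{s..<n}. B k t * A t j) = (\<Sum>t\<in>{s..<n}. if t = j then B k t else 0)"
      using assms(3)[OF j] by (intro sum.cong) auto
    then show ?thesis using B[of k j] j assms(2) by auto
  qed
  then have "(\<Sum>t\<in>{s..<n}. B k t * A t k) = (\<Sum>t\<in>{k..<n}. B k t * A t k)"
    using assms(2) by (intro sum.mono_neutral_right) auto
  then show thesis using B[of k k] assms(2) that[of "B k"] by simp
qed

text \<open>Euclid's algorithm on a column: subtracting the smaller entry from the larger one until at
  most one entry is left.\<close>

lemma column_reduction:
  fixes P :: "(nat \<Rightarrow> nat \<Rightarrow> int) \<Rightarrow> bool"
  assumes add: "\<And>A i l c. i \<in> {k..<n} \<Longrightarrow> l \<in> {k..<n} \<Longrightarrow> i \<noteq> l \<Longrightarrow> R A \<Longrightarrow>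
      R (add_row c i l A) \<and> (P (add_row c i l A) \<longrightarrow> P A)"
    and base: "\<And>A p. R A \<Longrightarrow> p \<in> {k..<n} \<Longrightarrow> (\<And>i. i \<in> {k..<n} \<Longrightarrow> i \<noteq> p \<Longrightarrow> A i k = 0) \<Longrightarrow> P A"
    and k: "k < n" and R: "R A"
  shows "P A"
  using R
proof (induction "\<Sum>i\<in>{k..<n}. nat \<bar>A i k\<bar>" arbitrary: A rule: less_induct)
  case less
  show ?case
  proof (cases "\<exists>i\<in>{k..<n}. \<exists>l\<in>{k..<n}. i \<noteq> l \<and> A i k \<noteq> 0 \<and> A l k \<noteq> 0")
    case True
    then obtain i l where il: "i \<in> {k..<n}" "l \<in> {k..<n}" "i \<noteq> l" "A i k \<noteq> 0" "A l k \<noteq> 0" by blast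
    have main: "P A" if "i \<in> {k..<n}" "l \<in> {k..<n}" "i \<noteq> l" "A i k \<noteq> 0" "A l k \<noteq> 0" "\<bar>A l k\<bar> \<le> \<bar>A i k\<bar>" for i l
    proof -
      \<comment> \<open>With this sign the entry loses exactly the absolute value of the entry in
        row l.\<close>
      define c where "c = - sgn (A i k) * sgn (A l k)"
      let ?A = "add_row c i l A"
      have "nat \<bar>?A i k\<bar> < nat \<bar>A i k\<bar>"
        using that by (auto simp: c_def sgn_if abs_if split: if_splits)
      then have "(\<Sum>t\<in>{k..<n}. nat \<bar>?A t k\<bar>) < (\<Sum>t\<in>{k..<n}. nat \<bar>A t k\<bar>)"
        using that by (intro sum_strict_mono_ex1) auto
      then have "P ?A" using add[OF that(1-3) less(2), of c] less(1)[of ?A] by blast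
      then show "P A" using add[OF that(1-3) less(2), of c] by blast
    qed
    show ?thesis using main[of i l] main[of l i] il by linarith
  next
    case False
    show ?thesis
    proof (cases "\<exists>p\<in>{k..<n}. A p k \<noteq> 0")
      case True
      then show ?thesis using False base[OF less(2)] by metis
    next
      case False
      \<comment> \<open>A zero column meets the premise of \<open>base\<close> with any p.\<close>
      then show ?thesis using base[OF less(2), of k] k by auto
    qed
  qed
qed

text \<open>The moves are stated backwards, as P after the move implies P before it, for an
  arbitrary predicate. In even dimension P is \<open>realisable\<close> itself; in odd dimension it
  also lets row 0 change along with the block.\<close>

lemma unimodular_reduction:
  fixes P :: "(nat \<Rightarrow> nat \<Rightarrow> int) \<Rightarrow> bool"
  assumes add: "\<And>A i k c. i \<in> {s..<n} \<Longrightarrow> k \<in> {s..<n} \<Longrightarrow> i \<noteq> k \<Longrightarrow> P (add_row c i k A) \<Longrightarrow> P A"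
    and neg: "\<And>A i. i \<in> {s..<n} \<Longrightarrow> P (neg_row i A) \<Longrightarrow> P A"
    and base: "\<And>A. (\<And>i j. i \<in> {s..<n} \<Longrightarrow> j \<in> {s..<n} \<Longrightarrow> A i j = (if i = j then 1 else 0)) \<Longrightarrow> P A"
    and "left_invertible s n A"
  shows "P A"
proof -
  define R where "R k A \<longleftrightarrow> left_invertible s n A \<and>
    (\<forall>j\<in>{s..<k}. \<forall>i\<in>{s..<n}. A i j = (if i = j then 1 else (0::int)))" for k A
  \<comment> \<open>Row l has zeros in the finished columns since l \<ge> k, so adding a multiple of
    it to any row preserves them.\<close>
  have R_add: "R k (add_row c i l A)" if "R k A" "i \<in> {s..<n}" "l \<in> {k..<n}" "s \<le> k" "i \<noteq> l" for k c i l A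
    using that left_invertible_add_row[of s n A i l c] by (auto simp: R_def)
  have step: "P A" if IH: "\<And>A. R (Suc k) A \<Longrightarrow> P A" and RA: "R k A" and k: "k \<in> {s..<n}" for k A
  proof -
    have clear: "P A" if "R k A" "A k k = 1" for A
    proof -
      have "P A" if "finite S" "S \<subseteq> {s..<n} - {k}" "R k A" "A k k = 1"
        "\<And>i. i \<in> {s..<n} \<Longrightarrow> i \<notin> S \<Longrightarrow> i \<noteq> k \<Longrightarrow> A i k = 0" for S
        using that
      proof (induction S arbitrary: A)
        case empty
        then have "R (Suc k) A" by (auto simp: R_def less_Suc_eq)
        then show ?case using IH by blast
      next
        case (insert i S)
        let ?A = "add_row (- A i k) i k A"
        have i: "i \<in> {s..<n}" "i \<noteq> k" using insert by auto
        have "P ?A"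
        proof (rule insert.IH)
          show "R k ?A" by (rule R_add[OF insert.prems(2) i(1) _ _ i(2)]) (use k in auto)
        qed (use insert.prems i in auto)
        then show ?case using add[OF i(1) k i(2)] by blast
      qed
      from this[of "{s..<n} - {k}"] that show ?thesis by auto
    qed
    show ?thesis
    proof (rule column_reduction[where R = "R k" and k = k and n = n])
      show "k < n" "R k A" using k RA by auto
    next
      fix A i l c assume *: "i \<in> {k..<n}" "l \<in> {k..<n}" "i \<noteq> l" "R k A"
      then show "R k (add_row c i l A) \<and> (P (add_row c i l A) \<longrightarrow> P A)"
        using R_add[of k A i l c] add[of i l c A] k by auto
    next
      fix A p assume A: "R k A" "p \<in> {k..<n}" "\<And>i. i \<in> {k..<n} \<Longrightarrow> i \<noteq> p \<Longrightarrow> A i k = 0"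
      obtain b where b: "(\<Sum>t\<in>{k..<n}. b t * A t k) = 1"
        using left_invertible_column[of s n A k] A(1) k by (auto simp: R_def)
      have "(\<Sum>t\<in>{k..<n}. b t * A t k) = (\<Sum>t\<in>{k..<n}. if t = p then b p * A p k else 0)"
        using A(3) by (intro sum.cong) auto
      then have unit: "b p * A p k = 1" using b A(2) by simp
      then have sq: "A p k * A p k = 1" by (metis mult.commute zmult_eq_1_iff mult_minus_left mult_1 minus_minus)
      show "P A"
      proof (cases "p = k")
        case True
        show ?thesis
        proof (cases "A k k = 1")
          case False
          then have "A k k = - 1" using sq True by (metis zmult_eq_1_iff)
          moreover have "R k (neg_row k A)"
            using A(1) left_invertible_neg_row[of s n A k] by (auto simp: R_def)
          ultimately have "P (neg_row k A)" by (intro clear) auto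
          then show ?thesis using neg k by blast
        qed (use clear A in blast)
      next
        case False
        \<comment> \<open>The entry at p is 1 or - 1 and the one at k is 0; adding
          \<open>A p k\<close> times row p puts the square 1 on the diagonal, which takes the place
          of a row swap.\<close>
        let ?A = "add_row (A p k) k p A"
        have "R k ?A" using R_add[OF A(1) k A(2)] False k by auto
        moreover have "?A k k = 1" using A(3)[of k] sq False k by simp
        ultimately have "P ?A" by (rule clear)
        then show ?thesis using add[of k p "A p k" A] k A(2) False by auto
      qed
    qed
  qed
  \<comment> \<open>d counts the columns still to be treated, so the induction starts from the fully
    reduced matrix.\<close>
  have "\<forall>A. R (n - d) A \<longrightarrow> P A" if "d \<le> n - s" "s \<le> n" for d
    using that
  proof (induction d)
    case 0
    then show ?case using base by (auto simp: R_def)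
  next
    case (Suc d)
    then have "Suc (n - Suc d) = n - d" "n - Suc d \<in> {s..<n}" by auto
    then show ?case using Suc step[of "n - Suc d"] by auto
  qed
  from this[of "n - s"] have "R s A \<longrightarrow> P A" if "s \<le> n" using that by simp
  moreover have "R s A" using assms(4) by (simp add: R_def)
  moreover have "P A" if "\<not> s \<le> n" using base that by simp
  ultimately show ?thesis by blast
qed

section \<open>Monomial maps contained in $G_n$\<close>

definition affine_coord :: "nat \<Rightarrow> 'a::field mpol fract" where
  "affine_coord j = to_fract (Var (Suc j)) / to_fract (Var 0)"

definition row_monom :: "nat \<Rightarrow> (nat \<Rightarrow> int) \<Rightarrow> 'a::field mpol fract" where
  "row_monom n r = (\<Prod>j<n. affine_coord j powi r j)"

definition monom_tuple :: "nat \<Rightarrow> (nat \<Rightarrow> nat \<Rightarrow> int) \<Rightarrow> nat \<Rightarrow> 'a::field mpol fract" where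
  "monom_tuple n A k = (case k of 0 \<Rightarrow> 1 | Suc i \<Rightarrow> row_monom n (A i))"

text \<open>Rows of A are exponent vectors, and all scalars are 1; arbitrary scalars are put back by
  a diagonal matrix in \<open>twisted_tuple_G_tuples\<close>.\<close>

definition realisable :: "'a::field itself \<Rightarrow> nat \<Rightarrow> (nat \<Rightarrow> nat \<Rightarrow> int) \<Rightarrow> bool" where
  "realisable TYPE('a) n A \<longleftrightarrow> (monom_tuple n A :: nat \<Rightarrow> 'a mpol fract) \<in> G_tuples n"

lemma affine_coord_nonzero [simp]: "affine_coord j \<noteq> 0"
  by (simp add: affine_coord_def)

lemma row_monom_nonzero [simp]: "row_monom n r \<noteq> 0"
  by (simp add: row_monom_def power_int_eq_0_iff)

lemma row_monom_add: "row_monom n (\<lambda>j. r j + s j) = row_monom n r * row_monom n s"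
  by (simp add: row_monom_def power_int_add prod.distrib)

lemma row_monom_uminus: "row_monom n (\<lambda>j. - r j) = 1 / row_monom n r"
  using prod_inversef[of "\<lambda>j. affine_coord j powi r j" "{..<n}"]
  by (simp add: row_monom_def power_int_minus divide_inverse comp_def)

lemma row_monom_diff: "row_monom n (\<lambda>j. r j - s j) = row_monom n r / row_monom n s"
  using row_monom_add[of n r "\<lambda>j. - s j"] by (simp add: row_monom_uminus)

lemma row_monom_add_double: "row_monom n (\<lambda>j. r j + 2 * s j) = row_monom n s ^ 2 * row_monom n r"
  using row_monom_add[of n "\<lambda>j. r j + s j" s] by (simp add: row_monom_add power2_eq_square algebra_simps)

lemma monom_tuple_0 [simp]: "monom_tuple n A 0 = 1"
  and monom_tuple_Suc [simp]: "monom_tuple n A (Suc i) = row_monom n (A i)"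
  by (simp_all add: monom_tuple_def)

lemma monom_tuple_upd: "monom_tuple n (A(i := r)) = (monom_tuple n A)(Suc i := row_monom n r)"
  by (auto simp: fun_eq_iff monom_tuple_def split: nat.split)

lemma add_row_add_row: "i \<noteq> k \<Longrightarrow> add_row d i k (add_row c i k A) = add_row (c + d) i k A"
  by (auto simp: fun_eq_iff algebra_simps)

text \<open>Reflection against coordinate 0, whose entry is 1.\<close>

lemma realisable_neg_row:
  assumes "realisable TYPE('a::field) n A" "i < n"
  shows "realisable TYPE('a) n (neg_row i A)"
  using assms G_tuples_reflect[of "monom_tuple n A" n "Suc i" 0]
  by (simp add: realisable_def monom_tuple_upd row_monom_uminus)

lemma realisable_swap:
  assumes "realisable TYPE('a::field) n A" "i < n" "k < n" "i \<noteq> k"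
  shows "realisable TYPE('a) n (A(i := A k, k := A i))"
  using assms G_tuples_swap[of "monom_tuple n A" n "Suc i" "Suc k"]
  by (simp add: realisable_def monom_tuple_upd)

text \<open>Two reflections make a translation: x_i -> 1 / x_i -> x_k^2 x_i.\<close>

lemma realisable_add_row_2:
  assumes "realisable TYPE('a::field) n A" "i < n" "k < n" "i \<noteq> k"
  shows "realisable TYPE('a) n (add_row 2 i k A)"
  using realisable_neg_row[OF assms(1,2)] assms(2-)
    G_tuples_reflect[of "monom_tuple n (neg_row i A)" n "Suc i" "Suc k"]
  by (simp add: realisable_def monom_tuple_upd row_monom_uminus row_monom_add_double)

lemma realisable_add_row_even:
  assumes "realisable TYPE('a::field) n A" "i < n" "k < n" "i \<noteq> k" "even c"
  shows "realisable TYPE('a) n (add_row c i k A)"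
proof -
  have pos: "realisable TYPE('a) n (add_row (2 * int m) i k A)" if "realisable TYPE('a) n A" for m A
  proof (induction m)
    case 0
    then show ?case using that by simp
  next
    case (Suc m)
    have "add_row 2 i k (add_row (2 * int m) i k A) = add_row (2 * int (Suc m)) i k A"
      using assms(4) by (auto simp: fun_eq_iff algebra_simps)
    with realisable_add_row_2[OF Suc assms(2-4)] show ?case by metis
  qed
  obtain d where d: "c = 2 * d" using assms(5) by blast
  show ?thesis
  proof (cases d)
    case (nonneg m)
    then show ?thesis using pos[OF assms(1)] d by simp
  next
    case (neg m)
    then have c: "c = - (2 * int (Suc m))" using d by simp
    \<comment> \<open>Negative multiples are obtained by conjugating with the sign change of row
      k.\<close>
    have "neg_row k (add_row (2 * int (Suc m)) i k (neg_row k A)) = add_row c i k A"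
      unfolding c using assms(4) by (auto simp: fun_eq_iff algebra_simps)
    then show ?thesis
      using realisable_neg_row[OF pos[OF realisable_neg_row[OF assms(1,3)]] assms(3)] by metis
  qed
qed

text \<open>\<open>G_tuples_diagonal\<close> with coordinate 0, whose entry is 1, as its fourth
  index.\<close>

lemma realisable_transfer:
  assumes "CHAR('a::field) \<noteq> 2" "realisable TYPE('a) n A" "i < n" "j < n" "k < n" "distinct [i, j, k]"
  shows "realisable TYPE('a) n (add_row (- 1) j k (add_row 1 i k A))"
proof -
  let ?\<psi> = "monom_tuple n A :: nat \<Rightarrow> 'a mpol fract"
  have "?\<psi>(Suc i := ?\<psi> (Suc i) * ?\<psi> (Suc k) / ?\<psi> 0, Suc j := ?\<psi> (Suc j) * ?\<psi> 0 / ?\<psi> (Suc k)) \<in> G_tuples n"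
    by (rule G_tuples_diagonal[OF assms(1), of ?\<psi> n "Suc i" "Suc j" "Suc k" 0]) (use assms(2-) in \<open>auto simp: realisable_def\<close>)
  moreover have "monom_tuple n (add_row (- 1) j k (add_row 1 i k A)) =
      ?\<psi>(Suc i := ?\<psi> (Suc i) * ?\<psi> (Suc k) / ?\<psi> 0, Suc j := ?\<psi> (Suc j) * ?\<psi> 0 / ?\<psi> (Suc k))"
    using assms(6) row_monom_add[of n "A i" "A k", where 'a = 'a] row_monom_diff[of n "A j" "A k", where 'a = 'a]
    by (simp add: monom_tuple_upd)
  ultimately show ?thesis by (simp only: realisable_def)
qed

text \<open>If a and b are odd, the transfer accounts for 1 and - 1, and the remainders a - 1 and b
  + 1 are even.\<close>

lemma realisable_add_row_pair:
  assumes "CHAR('a::field) \<noteq> 2" "realisable TYPE('a) n A" "i < n" "j < n" "k < n" "distinct [i, j, k]"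
    and "even (a + b)"
  shows "realisable TYPE('a) n (add_row b j k (add_row a i k A))"
proof (cases "even a")
  case True
  then show ?thesis using assms by (intro realisable_add_row_even) auto
next
  case False
  let ?A = "add_row (- 1) j k (add_row 1 i k A)"
  have "realisable TYPE('a) n (add_row (a - 1) i k ?A)"
    by (rule realisable_add_row_even[OF realisable_transfer[OF assms(1-6)]]) (use False assms(3-7) in auto)
  then have *: "realisable TYPE('a) n (add_row (b + 1) j k (add_row (a - 1) i k ?A))"
    by (rule realisable_add_row_even) (use False assms(3-7) in auto)
  have eq: "add_row (b + 1) j k (add_row (a - 1) i k ?A) = add_row b j k (add_row a i k A)"
    using assms(6) by (auto simp: fun_eq_iff algebra_simps)
  show ?thesis using * unfolding eq .
qed

lemma realisable_identity:
  assumes "\<And>i j. i < n \<Longrightarrow> j < n \<Longrightarrow> A i j = (if i = j then 1 else 0)"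
  shows "realisable TYPE('a::field) n A"
proof -
  have "monom_tuple n A k = 1 / to_fract (Var 0) * to_fract (Var k :: 'a mpol)" if "k \<le> n" for k
  proof (cases k)
    case (Suc i)
    have "row_monom n (A i) = (\<Prod>j<n. if j = i then affine_coord j else (1 :: 'a mpol fract))"
      unfolding row_monom_def using assms[of i] Suc that by (intro prod.cong) auto
    then show ?thesis using Suc that by (simp add: affine_coord_def)
  qed simp
  then have "proportional n (monom_tuple n A) (frac_tuple (Var :: nat \<Rightarrow> 'a mpol))"
    unfolding proportional_def by (intro exI[of _ "1 / to_fract (Var 0)"]) auto
  then show ?thesis unfolding realisable_def by (rule G_tuples.proportional[OF G_tuples.Var])
qed

subsection \<open>Even dimension\<close>

lemma realisable_add_row_set:
  assumes char: "CHAR('a::field) \<noteq> 2" and k: "k < n"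
    and "S \<subseteq> {..<n} - {k}" "even (card S)" "realisable TYPE('a) n A"
  shows "realisable TYPE('a) n (\<lambda>m. if m \<in> S then (\<lambda>j. A m j + A k j) else A m)"
proof -
  have "finite S" using assms(3) finite_subset by blast
  then show ?thesis
    using assms(3-)
  proof (induction S arbitrary: A rule: finite_psubset_induct)
    case (psubset S)
    show ?case
    proof (cases "S = {}")
      case False
      then obtain a where a: "a \<in> S" by blast
      have "card S \<noteq> 1" using psubset.prems(2) by auto
      then have "S \<noteq> {a}" by auto
      with a obtain b where b: "b \<in> S" "b \<noteq> a" by blast
      let ?S = "S - {a, b}" and ?A = "add_row 1 b k (add_row 1 a k A)"
      have "card ?S = card S - 2" using a b card_Diff_subset[of "{a, b}" S] by simp
      then have ev: "even (card ?S)" using psubset.prems(2) by simp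
      have A: "realisable TYPE('a) n ?A"
        by (rule realisable_add_row_pair[OF char psubset.prems(3)]) (use a b psubset.prems(1) k in auto)
      have S: "?S \<subset> S" "?S \<subseteq> {..<n} - {k}" using a psubset.prems(1) by blast+
      have "k \<noteq> a" "k \<noteq> b" using a b psubset.prems(1) by blast+
      then have eq: "(\<lambda>m. if m \<in> ?S then (\<lambda>j. ?A m j + ?A k j) else ?A m) =
          (\<lambda>m. if m \<in> S then (\<lambda>j. A m j + A k j) else A m)"
        using a b by (intro ext) simp
      show ?thesis using psubset.IH[OF S ev A] unfolding eq .
    qed (use psubset.prems in simp)
  qed
qed

text \<open>Interchange coordinates 0 and \<open>Suc k\<close>, then divide by the new coordinate 0,
  which is the monomial of row k.\<close>

lemma realisable_swap_0:
  assumes "realisable TYPE('a::field) n A" "k < n"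
  shows "realisable TYPE('a) n (\<lambda>m. if m = k then (\<lambda>j. - A k j) else (\<lambda>j. A m j - A k j))"
proof -
  let ?\<psi> = "monom_tuple n A :: nat \<Rightarrow> 'a mpol fract"
  let ?A = "\<lambda>m. if m = k then (\<lambda>j. - A k j) else (\<lambda>j. A m j - A k j)"
  have "?\<psi>(0 := ?\<psi> (Suc k), Suc k := ?\<psi> 0) \<in> G_tuples n"
    by (rule G_tuples_swap[of ?\<psi> n 0 "Suc k"]) (use assms in \<open>auto simp: realisable_def\<close>)
  moreover have "monom_tuple n ?A m = 1 / row_monom n (A k) * (?\<psi>(0 := ?\<psi> (Suc k), Suc k := ?\<psi> 0)) m" for m
    by (cases m) (auto simp: row_monom_uminus row_monom_diff)
  then have "proportional n (monom_tuple n ?A) (?\<psi>(0 := ?\<psi> (Suc k), Suc k := ?\<psi> 0))"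
    unfolding proportional_def by (intro exI[of _ "1 / row_monom n (A k)"]) auto
  ultimately show ?thesis unfolding realisable_def by (rule G_tuples.proportional)
qed

text \<open>For odd c the swap with coordinate 0 is used: it subtracts row k from every other row,
  and as n - 2 is even, pairs add row k back to all of them except row i. What remains to be added
  to row i is the even multiple c + 1.\<close>

lemma realisable_add_row:
  assumes char: "CHAR('a::field) \<noteq> 2" and n: "even n"
    and A: "realisable TYPE('a) n A" and ik: "i < n" "k < n" "i \<noteq> k"
  shows "realisable TYPE('a) n (add_row c i k A)"
proof (cases "even c")
  case False
  define B where "B = neg_row k (\<lambda>m. if m = k then (\<lambda>j. - A k j) else (\<lambda>j. A m j - A k j))"
  define S where "S = {..<n} - {i, k}"
  define C where "C = (\<lambda>m. if m \<in> S then (\<lambda>j. B m j + B k j) else B m)"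
  have B: "realisable TYPE('a) n B"
    unfolding B_def by (rule realisable_neg_row[OF realisable_swap_0[OF A ik(2)] ik(2)])
  have "card S = n - 2" unfolding S_def using ik by (simp add: card_Diff_subset)
  then have "realisable TYPE('a) n C"
    unfolding C_def using n by (intro realisable_add_row_set[OF char ik(2) _ _ B]) (auto simp: S_def)
  then have R: "realisable TYPE('a) n (add_row (c + 1) i k C)"
    by (rule realisable_add_row_even) (use ik False in auto)
  have Bk: "B k = A k" by (simp add: B_def)
  have Bm: "B m = (\<lambda>j. A m j - A k j)" if "m \<noteq> k" for m using that by (simp add: B_def)
  have "C k = A k" "C i = (\<lambda>j. A i j - A k j)" using ik by (simp_all add: C_def S_def Bk Bm)
  moreover have "C m = A m" if "m < n" "m \<noteq> i" "m \<noteq> k" for m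
    using that by (simp add: C_def S_def Bk Bm)
  \<comment> \<open>Rows from n on have been altered by the swap, so the two matrices agree only
    below n; for the tuples this is enough.\<close>
  ultimately have "add_row (c + 1) i k C m = add_row c i k A m" if "m < n" for m
    using ik that by (cases "m = i"; cases "m = k") (simp_all add: ring_distribs)
  then have "monom_tuple n (add_row c i k A) m = (monom_tuple n (add_row (c + 1) i k C) m :: 'a mpol fract)"
    if "m \<le> n" for m
    using that by (cases m) (auto simp del: add_row_def)
  then have "proportional n (monom_tuple n (add_row c i k A)) (monom_tuple n (add_row (c + 1) i k C) :: nat \<Rightarrow> 'a mpol fract)"
    unfolding proportional_def by (intro exI[of _ 1]) simp
  with R show ?thesis unfolding realisable_def by (rule G_tuples.proportional)
next
  case True
  show ?thesis by (rule realisable_add_row_even[OF A ik True])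
qed

lemma realisable_even:
  assumes "CHAR('a::field) \<noteq> 2" "even n" "left_invertible 0 n A"
  shows "realisable TYPE('a) n A"
  using _ _ _ assms(3)
proof (rule unimodular_reduction)
  fix A i k c assume *: "i \<in> {0..<n}" "k \<in> {0..<n}" "i \<noteq> k" "realisable TYPE('a) n (add_row c i k A)"
  have "add_row (- c) i k (add_row c i k A) = A" using *(3) by (auto simp: fun_eq_iff)
  then show "realisable TYPE('a) n A"
    using realisable_add_row[OF assms(1,2) *(4), of i k "- c"] * by auto
next
  fix A i assume *: "i \<in> {0..<n}" "realisable TYPE('a) n (neg_row i A)"
  have "neg_row i (neg_row i A) = A" by (auto simp: fun_eq_iff)
  then show "realisable TYPE('a) n A" using realisable_neg_row[OF *(2), of i] * by simp
qed (auto intro!: realisable_identity)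

subsection \<open>Odd dimension\<close>

definition odd_columns :: "nat \<Rightarrow> (nat \<Rightarrow> nat \<Rightarrow> int) \<Rightarrow> bool" where
  "odd_columns n A \<longleftrightarrow> (\<forall>j<n. odd (\<Sum>i<n. A i j))"

lemma sum_row_upd:
  fixes A :: "nat \<Rightarrow> nat \<Rightarrow> int"
  shows "i < n \<Longrightarrow> (\<Sum>t<n. (A(i := r)) t j) = (\<Sum>t<n. A t j) - A i j + r j"
  by (simp add: sum.remove[of "{..<n}" i])

lemma odd_columns_add_row:
  assumes "i < n" "even c"
  shows "odd_columns n (add_row c i k A) \<longleftrightarrow> odd_columns n A"
  using assms by (simp add: odd_columns_def sum_row_upd del: fun_upd_apply)

lemma odd_columns_neg_row: "i < n \<Longrightarrow> odd_columns n (neg_row i A) \<longleftrightarrow> odd_columns n A"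
  by (simp add: odd_columns_def sum_row_upd del: fun_upd_apply)

lemma odd_columns_add_row_pair:
  assumes "i < n" "j < n" "distinct [i, j, k]" "even (a + b)"
  shows "odd_columns n (add_row b j k (add_row a i k A)) \<longleftrightarrow> odd_columns n A"
proof -
  have "(\<Sum>t<n. (add_row b j k (add_row a i k A)) t q) = (\<Sum>t<n. A t q) + (a + b) * A k q" for q
    using assms(1-3) by (simp add: sum_row_upd algebra_simps del: fun_upd_apply) (simp add: algebra_simps)
  then show ?thesis using assms(4) by (simp add: odd_columns_def)
qed

lemma realisable_odd_aux:
  assumes char: "CHAR('a::field) \<noteq> 2" and n: "n \<ge> 2"
    and "left_invertible 1 n A" "odd_columns n A" "\<And>i. i < n \<Longrightarrow> A i 0 = (if i = 0 then 1 else 0)"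
  shows "realisable TYPE('a) n A"
proof -
  \<comment> \<open>P constrains row 0 only through its first entry and the column parities, so this
    row can take the second half of every paired addition. The matrix A matters through its rows
    from 1 on.\<close>
  define P where "P A \<longleftrightarrow> (\<forall>C. (\<forall>i\<in>{1..<n}. C i = A i) \<longrightarrow> (\<forall>i<n. C i 0 = (if i = 0 then 1 else 0)) \<longrightarrow>
    odd_columns n C \<longrightarrow> realisable TYPE('a) n C)" for A
  have "P A"
    using _ _ _ assms(3)
  proof (rule unimodular_reduction)
    fix A i k c assume *: "i \<in> {1..<n}" "k \<in> {1..<n}" "i \<noteq> k" "P (add_row c i k A)"
    show "P A"
      unfolding P_def
    proof (intro allI impI)
      fix C :: "nat \<Rightarrow> nat \<Rightarrow> int" assume C: "\<forall>i\<in>{1..<n}. C i = A i" "\<forall>i<n. C i 0 = (if i = 0 then 1 else 0)" "odd_columns n C"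
      \<comment> \<open>Row k vanishes in column 0, so both additions keep the unit vector
        there.\<close>
      let ?C = "add_row c 0 k (add_row c i k C)"
      have "odd_columns n ?C" using C(3) * by (subst odd_columns_add_row_pair) auto
      moreover have "\<forall>i'\<in>{1..<n}. ?C i' = add_row c i k A i'" using C(1) * by auto
      moreover have "\<forall>i<n. ?C i 0 = (if i = 0 then 1 else 0)" using C(2) * by auto
      ultimately have "realisable TYPE('a) n ?C" using *(4) by (simp only: P_def)
      from realisable_add_row_pair[OF char this, of i 0 k "- c" "- c"] *
      have "realisable TYPE('a) n (add_row (- c) 0 k (add_row (- c) i k ?C))" by simp
      moreover have "add_row (- c) 0 k (add_row (- c) i k ?C) = C" using * by (auto simp: fun_eq_iff)
      ultimately show "realisable TYPE('a) n C" by metis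
    qed
  next
    fix A i assume *: "i \<in> {1..<n}" "P (neg_row i A)"
    show "P A"
      unfolding P_def
    proof (intro allI impI)
      fix C :: "nat \<Rightarrow> nat \<Rightarrow> int" assume C: "\<forall>i\<in>{1..<n}. C i = A i" "\<forall>i<n. C i 0 = (if i = 0 then 1 else 0)" "odd_columns n C"
      have "odd_columns n (neg_row i C)" using C(3) * by (subst odd_columns_neg_row) auto
      moreover have "\<forall>i'\<in>{1..<n}. neg_row i C i' = neg_row i A i'" using C(1) * by auto
      moreover have "\<forall>i'<n. neg_row i C i' 0 = (if i' = 0 then 1 else 0)" using C(2) * by auto
      ultimately have "realisable TYPE('a) n (neg_row i C)" using *(2) by (simp only: P_def)
      from realisable_neg_row[OF this, of i] * show "realisable TYPE('a) n C" by simp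
    qed
  next
    fix A :: "nat \<Rightarrow> nat \<Rightarrow> int"
    assume A: "\<And>i j. i \<in> {1..<n} \<Longrightarrow> j \<in> {1..<n} \<Longrightarrow> A i j = (if i = j then 1 else 0)"
    show "P A"
      unfolding P_def
    proof (intro allI impI)
      fix C :: "nat \<Rightarrow> nat \<Rightarrow> int" assume C: "\<forall>i\<in>{1..<n}. C i = A i" "\<forall>i<n. C i 0 = (if i = 0 then 1 else 0)" "odd_columns n C"
      have rows: "C i j = (if i = j then 1 else 0)" if "i \<in> {1..<n}" "j < n" for i j
        using that A[of i j] C(1,2) by (cases "j = 0") auto
      \<comment> \<open>Below row 0 the column is a unit vector and contributes 1 to an odd
        sum.\<close>
      have even: "even (C 0 j)" if j: "j \<in> {1..<n}" for j
      proof -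
        have "(\<Sum>i<n. C i j) = C 0 j + (\<Sum>i\<in>{1..<n}. C i j)"
          using n by (simp add: lessThan_atLeast0 sum.atLeast_Suc_lessThan)
        also have "(\<Sum>i\<in>{1..<n}. C i j) = (\<Sum>i\<in>{1..<n}. if i = j then 1 else 0)"
          using rows j by (intro sum.cong) auto
        finally show ?thesis using C(3) j by (auto simp: odd_columns_def)
      qed
      \<comment> \<open>S holds the columns in which row 0 may still be nonzero. Row l is the l-th
        unit vector, so clearing one entry leaves the others alone.\<close>
      have "realisable TYPE('a) n D" if "finite S" "S \<subseteq> {1..<n}" "\<forall>i\<in>{1..<n}. D i = C i"
        "D 0 0 = 1" "\<And>j. j \<in> {1..<n} \<Longrightarrow> even (D 0 j)" "\<And>j. j \<in> {1..<n} - S \<Longrightarrow> D 0 j = 0" for S D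
        using that
      proof (induction S arbitrary: D)
        case empty
        have "D i j = (if i = j then 1 else 0)" if "i < n" "j < n" for i j
          using empty rows[of i j] that by (cases "i = 0"; cases "j = 0") auto
        then show ?case by (rule realisable_identity)
      next
        case (insert l S)
        let ?D = "add_row (- D 0 l) 0 l D"
        have l: "l \<in> {1..<n}" "D l = C l" using insert by auto
        have "realisable TYPE('a) n ?D"
        proof (rule insert.IH)
          show "\<forall>i\<in>{1..<n}. ?D i = C i" using insert.prems by auto
          show "?D 0 0 = 1" using insert.prems(3) l rows[of l 0] by auto
          show "even (?D 0 j)" if "j \<in> {1..<n}" for j
            using insert.prems(4)[OF that] insert.prems(4)[OF l(1)] by simp
          show "?D 0 j = 0" if "j \<in> {1..<n} - S" for j
            using insert.prems(5)[of j] that l rows[of l j] by auto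
        qed (use insert in auto)
        from realisable_add_row_even[OF this, of 0 l "D 0 l"] l insert.prems(4)[OF l(1)]
        have "realisable TYPE('a) n (add_row (D 0 l) 0 l ?D)" by simp
        moreover have "add_row (D 0 l) 0 l ?D = D" using l by (auto simp: fun_eq_iff)
        ultimately show ?case by metis
      qed
      from this[of "{1..<n}" C] show "realisable TYPE('a) n C" using C(2) even n by auto
    qed
  qed
  then show ?thesis using assms(4,5) by (auto simp: P_def)
qed

lemma left_invertible_swap:
  assumes "left_invertible s n A" "i \<in> {s..<n}" "k \<in> {s..<n}" "i \<noteq> k"
  shows "left_invertible s n (A(i := A k, k := A i))"
proof -
  have "neg_row k (add_row 1 i k (add_row (- 1) k i (add_row 1 i k A))) = A(i := A k, k := A i)"
    using assms(4) by (auto simp: fun_eq_iff)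
  moreover have "left_invertible s n (neg_row k (add_row 1 i k (add_row (- 1) k i (add_row 1 i k A))))"
    using assms by (intro left_invertible_neg_row left_invertible_add_row) auto
  ultimately show ?thesis by metis
qed

lemma left_invertible_Suc:
  assumes "left_invertible 0 n A" "\<And>i. i < n \<Longrightarrow> A i 0 = (if i = 0 then 1 else 0)"
  shows "left_invertible 1 n A"
proof -
  obtain B where B: "\<And>p q. p \<in> {0..<n} \<Longrightarrow> q \<in> {0..<n} \<Longrightarrow>
      (\<Sum>t\<in>{0..<n}. B p t * A t q) = (if p = q then 1 else 0)"
    using assms(1) unfolding left_invertible_def by blast
  have "(\<Sum>t\<in>{1..<n}. B i t * A t j) = (if i = j then 1 else 0)" if ij: "i \<in> {1..<n}" "j \<in> {1..<n}" for i j
  proof -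
    have "(\<Sum>t\<in>{0..<n}. B i t * A t 0) = (\<Sum>t\<in>{0..<n}. if t = 0 then B i t else 0)"
      using assms(2) by (intro sum.cong) auto
    then have "B i 0 = 0" using B[of i 0] ij by auto
    then have "(\<Sum>t\<in>{0..<n}. B i t * A t j) = (\<Sum>t\<in>{1..<n}. B i t * A t j)"
      using ij by (simp add: sum.atLeast_Suc_lessThan)
    then show ?thesis using B[of i j] ij by auto
  qed
  then show ?thesis unfolding left_invertible_def by blast
qed

text \<open>Only even multiples of a row may be added to another one, and odd multiples to two
  others at the same time; Euclid's algorithm on the first column then stops at a unit vector because the
  entries of this column are coprime and their sum is odd.\<close>

lemma realisable_odd:
  assumes char: "CHAR('a::field) \<noteq> 2" and n: "n \<ge> 2"
    and "left_invertible 0 n A" "odd_columns n A"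
  shows "realisable TYPE('a) n A"
  using assms(3,4)
proof (induction "\<Sum>i<n. nat \<bar>A i 0\<bar>" arbitrary: A rule: less_induct)
  case less
  \<comment> \<open>Two nonzero entries of distinct absolute value, three nonzero ones of the same
    absolute value, or at most two nonzero entries, all of absolute value g.\<close>
  consider (unequal) i l where "i < n" "l < n" "A l 0 \<noteq> 0" "\<bar>A l 0\<bar> < \<bar>A i 0\<bar>"
    | (three) i l k where "i < n" "l < n" "k < n" "distinct [i, l, k]"
        "A k 0 \<noteq> 0" "\<bar>A i 0\<bar> = \<bar>A k 0\<bar>" "\<bar>A l 0\<bar> = \<bar>A k 0\<bar>"
    | (few) g where "\<And>i. i < n \<Longrightarrow> A i 0 = 0 \<or> \<bar>A i 0\<bar> = g"
        "\<And>i l k. i < n \<Longrightarrow> l < n \<Longrightarrow> k < n \<Longrightarrow> distinct [i, l, k] \<Longrightarrow> A i 0 = 0 \<or> A l 0 = 0 \<or> A k 0 = 0"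
  proof (cases "\<exists>i<n. \<exists>l<n. A l 0 \<noteq> 0 \<and> A i 0 \<noteq> 0 \<and> \<bar>A l 0\<bar> \<noteq> \<bar>A i 0\<bar>")
    case True
    then obtain i l where "i < n" "l < n" "A l 0 \<noteq> 0" "A i 0 \<noteq> 0" "\<bar>A l 0\<bar> \<noteq> \<bar>A i 0\<bar>" by blast
    then have "\<bar>A l 0\<bar> < \<bar>A i 0\<bar> \<or> \<bar>A i 0\<bar> < \<bar>A l 0\<bar>" by linarith
    then show thesis
      using unequal[of i l] unequal[of l i] \<open>i < n\<close> \<open>l < n\<close> \<open>A l 0 \<noteq> 0\<close> \<open>A i 0 \<noteq> 0\<close> by argo
  next
    case same: False
    then have same: "\<bar>A l 0\<bar> = \<bar>A i 0\<bar>" if "i < n" "l < n" "A i 0 \<noteq> 0" "A l 0 \<noteq> 0" for i l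
      using that by blast
    show thesis
    proof (cases "\<exists>i l k. i < n \<and> l < n \<and> k < n \<and> distinct [i, l, k] \<and> A i 0 \<noteq> 0 \<and> A l 0 \<noteq> 0 \<and> A k 0 \<noteq> 0")
      case True
      then obtain i l k where ilk: "i < n" "l < n" "k < n" "distinct [i, l, k]" "A i 0 \<noteq> 0" "A l 0 \<noteq> 0" "A k 0 \<noteq> 0"
        by blast
      show thesis
        by (rule three[OF ilk(1-4,7) same[OF ilk(3,1,7,5)] same[OF ilk(3,2,7,6)]])
    next
      case False
      have "\<exists>g. \<forall>i<n. A i 0 = 0 \<or> \<bar>A i 0\<bar> = g"
      proof (cases "\<exists>p<n. A p 0 \<noteq> 0")
        case True
        then obtain p where p: "p < n" "A p 0 \<noteq> 0" by blast
        have "A i 0 = 0 \<or> \<bar>A i 0\<bar> = \<bar>A p 0\<bar>" if "i < n" for i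
          using same[OF p(1) that p(2)] by argo
        then show ?thesis by (intro exI[of _ "\<bar>A p 0\<bar>"]) simp
      qed blast
      then obtain g where g: "\<And>i. i < n \<Longrightarrow> A i 0 = 0 \<or> \<bar>A i 0\<bar> = g" by blast
      show thesis by (rule few[OF g]) (use False in auto)
    qed
  qed
  then show ?case
  proof cases
    case unequal
    \<comment> \<open>The new absolute value is that of |A i 0| - 2 |A l 0|, which is below |A i 0|
      because 0 < |A l 0| < |A i 0|.\<close>
    define c where "c = - 2 * (sgn (A i 0) * sgn (A l 0))"
    let ?A = "add_row c i l A"
    have il: "i \<noteq> l" using unequal by auto
    have "even c" by (simp add: c_def)
    have "nat \<bar>?A i 0\<bar> < nat \<bar>A i 0\<bar>"
      using unequal by (auto simp: c_def sgn_if abs_if split: if_splits)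
    then have "(\<Sum>t<n. nat \<bar>?A t 0\<bar>) < (\<Sum>t<n. nat \<bar>A t 0\<bar>)"
      using unequal by (intro sum_strict_mono_ex1) auto
    moreover have "left_invertible 0 n ?A"
      by (rule left_invertible_add_row[OF less.prems(1)]) (use unequal il in auto)
    moreover have "odd_columns n ?A"
      using odd_columns_add_row[OF unequal(1) \<open>even c\<close>] less.prems(2) by blast
    ultimately have "realisable TYPE('a) n ?A" by (rule less.hyps)
    from realisable_add_row_even[OF this unequal(1,2) il, of "- c"] \<open>even c\<close>
    have "realisable TYPE('a) n (add_row (- c) i l ?A)" by simp
    then show ?thesis unfolding add_row_add_row[OF il] by simp
  next
    case three
    \<comment> \<open>Row k annihilates both other entries at once; a and b are 1 or - 1, so their
      sum is even as a paired addition requires.\<close>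
    define a where "a = - (sgn (A i 0) * sgn (A k 0))"
    define b where "b = - (sgn (A l 0) * sgn (A k 0))"
    let ?A = "add_row b l k (add_row a i k A)"
    have "even (a + b)" using three by (auto simp: a_def b_def sgn_if)
    have zero: "?A i 0 = 0" "?A l 0 = 0"
      using three by (auto simp: a_def b_def sgn_if abs_if split: if_splits)
    then have "(\<Sum>t<n. nat \<bar>?A t 0\<bar>) < (\<Sum>t<n. nat \<bar>A t 0\<bar>)"
      using three by (intro sum_strict_mono_ex1) (auto intro!: bexI[of _ i])
    moreover have "left_invertible 0 n ?A"
      by (intro left_invertible_add_row less.prems(1)) (use three in auto)
    moreover have "odd_columns n ?A"
      using odd_columns_add_row_pair[OF three(1,2,4) \<open>even (a + b)\<close>] less.prems(2) by blast
    ultimately have "realisable TYPE('a) n ?A" by (rule less.hyps)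
    from realisable_add_row_pair[OF char this three(1,2,3,4), of "- a" "- b"] \<open>even (a + b)\<close>
    have "realisable TYPE('a) n (add_row (- b) l k (add_row (- a) i k ?A))" by simp
    moreover have "add_row (- b) l k (add_row (- a) i k ?A) = A"
      using three(4) by (auto simp: fun_eq_iff)
    ultimately show ?thesis by metis
  next
    case few
    obtain b where b: "(\<Sum>t\<in>{0..<n}. b t * A t 0) = 1"
      using left_invertible_column[OF less.prems(1), of 0] n by auto
    \<comment> \<open>Coprimality of the column forces g to divide 1.\<close>
    have "g dvd A t 0" if "t < n" for t using few(1)[OF that] by auto
    then have "g dvd (\<Sum>t\<in>{0..<n}. b t * A t 0)" by (intro dvd_sum) auto
    then have "g dvd 1" unfolding b .
    then have unit: "A i 0 = 0 \<or> \<bar>A i 0\<bar> = 1" if "i < n" for i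
      using few(1)[OF that] by (auto simp: zdvd1_eq)
    have "\<exists>p<n. A p 0 \<noteq> 0"
    proof (rule ccontr)
      assume "\<not> ?thesis"
      then have "(\<Sum>t\<in>{0..<n}. b t * A t 0) = 0" by (intro sum.neutral) auto
      then show False using b by simp
    qed
    then obtain p where p: "p < n" "A p 0 \<noteq> 0" by blast
    \<comment> \<open>A second nonzero entry would be 1 or - 1 like the first one, and the column
      sum would be even.\<close>
    have others: "A i 0 = 0" if i: "i < n" "i \<noteq> p" for i
    proof (rule ccontr)
      assume nz: "A i 0 \<noteq> 0"
      have "(\<Sum>t<n. A t 0) = (\<Sum>t\<in>{i, p}. A t 0)"
        using few(2)[of i p] i p nz by (intro sum.mono_neutral_right) auto
      also have "even (\<dots>)" using unit[of i] unit[of p] i p nz by (auto simp: abs_if split: if_splits)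
      finally show False using less.prems(2) n by (auto simp: odd_columns_def)
    qed
    have pos: "realisable TYPE('a) n D"
      if D: "left_invertible 0 n D" "odd_columns n D" "\<And>i. i < n \<Longrightarrow> i \<noteq> 0 \<Longrightarrow> D i 0 = 0" "\<bar>D 0 0\<bar> = 1" for D
    proof (cases "D 0 0 = 1")
      case True
      then have col: "D i 0 = (if i = 0 then 1 else 0)" if "i < n" for i using D(3) that by auto
      show ?thesis by (rule realisable_odd_aux[OF char n left_invertible_Suc[OF D(1) col] D(2) col])
    next
      case False
      then have "D 0 0 = - 1" using D(4) by linarith
      then have col: "neg_row 0 D i 0 = (if i = 0 then 1 else 0)" if "i < n" for i using D(3) that by auto
      have "odd_columns n (neg_row 0 D)" using odd_columns_neg_row[of 0 n D] D(2) n by simp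
      moreover have "left_invertible 1 n (neg_row 0 D)"
        by (rule left_invertible_Suc[OF left_invertible_neg_row[OF D(1)]]) (rule col)
      ultimately have "realisable TYPE('a) n (neg_row 0 D)"
        using col by (intro realisable_odd_aux[OF char n])
      from realisable_neg_row[OF this, of 0] n show ?thesis by simp
    qed
    show ?thesis
    proof (cases "p = 0")
      case True
      then show ?thesis using pos[OF less.prems] others unit[of 0] p by auto
    next
      case False
      let ?D = "A(0 := A p, p := A 0)"
      have "(\<Sum>t<n. ?D t j) = (\<Sum>t<n. A t j)" for j
        using False p n by (simp add: sum_row_upd del: fun_upd_apply) simp
      then have "odd_columns n ?D" using less.prems(2) by (simp add: odd_columns_def)
      then have "realisable TYPE('a) n ?D"
        using left_invertible_swap[OF less.prems(1), of 0 p] False p n others unit[OF p(1)]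
        by (intro pos) auto
      from realisable_swap[OF this, of 0 p] False p n show ?thesis by (simp add: fun_upd_twist)
    qed
  qed
qed

section \<open>Valuations given by leading monomials\<close>

text \<open>The maximum refers to the linear order on exponent vectors, which is compatible with
  addition.\<close>

definition lead_monom :: "'a::field mpol \<Rightarrow> (nat \<Rightarrow>\<^sub>0 nat)" where
  "lead_monom p = Max (Poly_Mapping.keys p)"

text \<open>Once both leading terms are split off, every other contribution to the product has a
  smaller monomial, so the product of the leading coefficients cannot cancel.\<close>

lemma lead_monom_mult:
  assumes "p \<noteq> 0" "q \<noteq> 0"
  shows "lead_monom (p * q) = lead_monom p + lead_monom q"
proof -
  let ?P = "lead_monom p" and ?Q = "lead_monom q"
  have nonempty: "Poly_Mapping.keys r \<noteq> {}" if "r \<noteq> 0" for r :: "'a mpol" using that by simp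
  have P: "?P \<in> Poly_Mapping.keys p" "\<And>m. m \<in> Poly_Mapping.keys p \<Longrightarrow> m \<le> ?P"
    using nonempty[OF assms(1)] by (auto simp: lead_monom_def)
  have Q: "?Q \<in> Poly_Mapping.keys q" "\<And>m. m \<in> Poly_Mapping.keys q \<Longrightarrow> m \<le> ?Q"
    using nonempty[OF assms(2)] by (auto simp: lead_monom_def)
  let ?c = "Poly_Mapping.lookup p ?P" and ?d = "Poly_Mapping.lookup q ?Q"
  define p' where "p' = p - Poly_Mapping.single ?P ?c"
  define q' where "q' = q - Poly_Mapping.single ?Q ?d"
  have p': "m < ?P" if "m \<in> Poly_Mapping.keys p'" for m
    using that P(2)[of m] by (cases "m = ?P") (auto simp: p'_def in_keys_iff lookup_minus lookup_single when_def)
  have q': "m < ?Q" if "m \<in> Poly_Mapping.keys q'" for m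
    using that Q(2)[of m] by (cases "m = ?Q") (auto simp: q'_def in_keys_iff lookup_minus lookup_single when_def)
  have "p * q = Poly_Mapping.single (?P + ?Q) (?c * ?d) + Poly_Mapping.single ?P ?c * q' + p' * q"
    by (simp add: p'_def q'_def algebra_simps flip: mult_single)
  moreover have "?P + ?Q \<notin> Poly_Mapping.keys (Poly_Mapping.single ?P ?c * q')"
  proof
    assume "?P + ?Q \<in> Poly_Mapping.keys (Poly_Mapping.single ?P ?c * q')"
    then obtain a b where "?P + ?Q = a + b" "a \<in> Poly_Mapping.keys (Poly_Mapping.single ?P ?c)" "b \<in> Poly_Mapping.keys q'"
      using Poly_Mapping.keys_mult by blast
    then show False using q'[of b] by (auto split: if_splits)
  qed
  moreover have "?P + ?Q \<notin> Poly_Mapping.keys (p' * q)"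
  proof
    assume "?P + ?Q \<in> Poly_Mapping.keys (p' * q)"
    then obtain a b where "?P + ?Q = a + b" "a \<in> Poly_Mapping.keys p'" "b \<in> Poly_Mapping.keys q"
      using Poly_Mapping.keys_mult by blast
    moreover have "a + b < ?P + ?Q" using p'[of a] Q(2)[of b] calculation by (intro add_less_le_mono) auto
    ultimately show False by simp
  qed
  ultimately have "Poly_Mapping.lookup (p * q) (?P + ?Q) = ?c * ?d"
    by (simp add: lookup_add in_keys_iff)
  then have "?P + ?Q \<in> Poly_Mapping.keys (p * q)" using P(1) Q(1) by (simp add: in_keys_iff)
  moreover have "m \<le> ?P + ?Q" if m: "m \<in> Poly_Mapping.keys (p * q)" for m
  proof -
    obtain a b where "m = a + b" "a \<in> Poly_Mapping.keys p" "b \<in> Poly_Mapping.keys q"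
      using m Poly_Mapping.keys_mult[of p q] by blast
    then show ?thesis using P(2)[of a] Q(2)[of b] by (simp add: add_mono)
  qed
  ultimately show ?thesis unfolding lead_monom_def[of "p * q"] by (intro Max_eqI) auto
qed

lemma fract_cases:
  obtains a b where "q = to_fract a / to_fract b" "b \<noteq> 0"
  by (cases q) (auto simp: Fract_conv_to_fract)

text \<open>One component of the valuation with values in exponent vectors. On nonzero elements it
  is a homomorphism to the integers, by which the parity of an exponent can be tested modulo
  arbitrary squares. The choice does not depend on the fraction, by cross multiplication.\<close>

definition lead_exponent :: "nat \<Rightarrow> 'a::field mpol fract \<Rightarrow> int" where
  "lead_exponent i q = (SOME k. \<exists>a b. a \<noteq> 0 \<and> b \<noteq> 0 \<and> q = to_fract a / to_fract b \<and>
     k = int (Poly_Mapping.lookup (lead_monom a) i) - int (Poly_Mapping.lookup (lead_monom b) i))"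

lemma lead_exponent_fract:
  assumes "a \<noteq> 0" "b \<noteq> 0"
  shows "lead_exponent i (to_fract a / to_fract b) =
    int (Poly_Mapping.lookup (lead_monom a) i) - int (Poly_Mapping.lookup (lead_monom b) i)"
  unfolding lead_exponent_def
proof (rule some_equality)
  fix k assume "\<exists>a' b'. a' \<noteq> 0 \<and> b' \<noteq> 0 \<and> to_fract a / to_fract b = to_fract a' / to_fract b' \<and>
     k = int (Poly_Mapping.lookup (lead_monom a') i) - int (Poly_Mapping.lookup (lead_monom b') i)"
  then obtain a' b' where *: "a' \<noteq> 0" "b' \<noteq> 0" "to_fract a / to_fract b = to_fract a' / to_fract b'"
     "k = int (Poly_Mapping.lookup (lead_monom a') i) - int (Poly_Mapping.lookup (lead_monom b') i)" by blast
  then have "to_fract (a * b') = to_fract (a' * b)" using assms by (simp add: field_simps)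
  then have "a * b' = a' * b" by (simp only: to_fract_eq_iff)
  then have "lead_monom a + lead_monom b' = lead_monom a' + lead_monom b"
    using assms * by (simp flip: lead_monom_mult)
  then have "Poly_Mapping.lookup (lead_monom a + lead_monom b') i = Poly_Mapping.lookup (lead_monom a' + lead_monom b) i"
    by simp
  then show "k = int (Poly_Mapping.lookup (lead_monom a) i) - int (Poly_Mapping.lookup (lead_monom b) i)"
    using *(4) by (simp add: lookup_add)
qed (use assms in blast)

lemma lead_exponent_mult:
  assumes "q \<noteq> 0" "r \<noteq> 0"
  shows "lead_exponent i (q * r) = lead_exponent i q + lead_exponent i r"
proof -
  obtain a b where q: "q = to_fract a / to_fract b" "b \<noteq> 0" by (rule fract_cases)
  obtain c d where r: "r = to_fract c / to_fract d" "d \<noteq> 0" by (rule fract_cases)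
  have "a \<noteq> 0" "c \<noteq> 0" using assms q r by auto
  moreover have "q * r = to_fract (a * c) / to_fract (b * d)" using q r by simp
  ultimately show ?thesis
    using q r by (simp add: lead_exponent_fract lead_monom_mult lookup_add del: to_fract_mult)
qed

lemma lead_monom_single: "c \<noteq> 0 \<Longrightarrow> lead_monom (Poly_Mapping.single m c) = m"
  by (simp add: lead_monom_def)

lemma lead_exponent_to_fract: "(p :: 'a::field mpol) \<noteq> 0 \<Longrightarrow> lead_exponent i (to_fract p) = int (Poly_Mapping.lookup (lead_monom p) i)"
  using lead_exponent_fract[of p 1 i] lead_monom_single[of "1 :: 'a" 0] by simp

lemma lead_exponent_const [simp]: "c \<noteq> 0 \<Longrightarrow> lead_exponent i (const c) = 0"
  by (simp add: lead_exponent_to_fract) (simp add: Cst_def lead_monom_single)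

lemma lead_exponent_1 [simp]: "lead_exponent i 1 = 0"
  using lead_exponent_const[of 1] by simp

lemma lead_exponent_Var: "lead_exponent i (to_fract (Var j :: 'a::field mpol)) = (if i = j then 1 else 0)"
  by (simp add: lead_exponent_to_fract) (simp add: Var_def lead_monom_single lookup_single when_def)

lemma lead_exponent_inverse: "q \<noteq> 0 \<Longrightarrow> lead_exponent i (inverse q) = - lead_exponent i q"
  using lead_exponent_mult[of q "inverse q" i] by simp

lemma lead_exponent_divide: "q \<noteq> 0 \<Longrightarrow> r \<noteq> 0 \<Longrightarrow> lead_exponent i (q / r) = lead_exponent i q - lead_exponent i r"
  by (simp add: divide_inverse lead_exponent_mult lead_exponent_inverse)

lemma lead_exponent_power: "q \<noteq> 0 \<Longrightarrow> lead_exponent i (q ^ k) = int k * lead_exponent i q"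
  by (induction k) (simp_all add: lead_exponent_mult algebra_simps)

lemma lead_exponent_power_int: "q \<noteq> 0 \<Longrightarrow> lead_exponent i (q powi k) = k * lead_exponent i q"
  by (simp add: power_int_def lead_exponent_power lead_exponent_inverse)

lemma lead_exponent_prod:
  "(\<And>t. t \<in> T \<Longrightarrow> f t \<noteq> 0) \<Longrightarrow> lead_exponent i (prod f T) = (\<Sum>t\<in>T. lead_exponent i (f t))"
  by (induction T rule: infinite_finite_induct) (simp_all add: lead_exponent_mult)

lemma lead_exponent_affine_coord: "lead_exponent (Suc i) (affine_coord j) = (if i = j then 1 else 0)"
  by (simp add: affine_coord_def lead_exponent_divide lead_exponent_Var)

lemma lead_exponent_row_monom:
  assumes "j < n"
  shows "lead_exponent (Suc j) (row_monom n r) = r j"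
proof -
  have "lead_exponent (Suc j) (row_monom n r) = (\<Sum>t<n. r t * (if j = t then 1 else 0))"
    unfolding row_monom_def
    by (simp add: lead_exponent_prod power_int_eq_0_iff lead_exponent_power_int lead_exponent_affine_coord)
  then show ?thesis using assms by (simp add: if_distrib[of "(*) _"] cong: if_cong)
qed

section \<open>Derivations of the function field\<close>

text \<open>The partial derivative is the coefficient of \<open>\<epsilon>\<close> in \<open>p(\<dots>, x\<^sub>i + \<epsilon>, \<dots>)\<close>, so
  that the product rule is a consequence of evaluation being multiplicative.\<close>

definition eps_eval :: "nat \<Rightarrow> 'a::field mpol \<Rightarrow> 'a mpol fract poly" where
  "eps_eval i = poly_eval (\<lambda>c. [:const c:]) (\<lambda>j. [:to_fract (Var j), if j = i then 1 else 0:])"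

lemma eps_const_hom: "comm_ring_hom (\<lambda>c. [:const c:])"
  by unfold_locales (simp_all add: pCons_one)

interpretation eps: evaluation "\<lambda>c. [:const c:]"
  unfolding evaluation_def by (rule eps_const_hom)

definition pdiff :: "nat \<Rightarrow> 'a::field mpol \<Rightarrow> 'a mpol fract" where
  "pdiff i p = coeff (eps_eval i p) 1"

lemma coeff_0_eps_eval: "coeff (eps_eval i p) 0 = to_fract p"
proof -
  have "comm_ring_hom (\<lambda>q :: 'a mpol fract poly. poly q 0)" by unfold_locales simp_all
  from hom_poly_eval[OF eps_const_hom this]
  show ?thesis by (simp add: eps_eval_def poly_0_coeff_0[symmetric] comp_def ev_to_fract_Var)
qed

lemma pdiff_add: "pdiff i (p + q) = pdiff i p + pdiff i q"
  by (simp add: pdiff_def eps_eval_def eps.poly_eval_add)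

lemma pdiff_mult: "pdiff i (p * q) = pdiff i p * to_fract q + to_fract p * pdiff i q"
proof -
  have "eps_eval i (p * q) = eps_eval i p * eps_eval i q" by (simp add: eps_eval_def eps.poly_eval_mult)
  then show ?thesis by (simp add: pdiff_def coeff_mult coeff_0_eps_eval)
qed

lemma pdiff_Cst: "pdiff i (Cst c) = 0"
  by (simp add: pdiff_def eps_eval_def)

lemma pdiff_1: "pdiff i 1 = 0"
  by (simp add: pdiff_def eps_eval_def)

lemma pdiff_Var: "pdiff i (Var j) = (if j = i then 1 else 0)"
  by (simp add: pdiff_def eps_eval_def)

text \<open>The quotient rule for q = a / b, multiplied by b and demanded for all fractions at once.
  A suitable d exists because differentiating a b' = a' b shows that all fractions agree.\<close>

definition fdiff :: "nat \<Rightarrow> 'a::field mpol fract \<Rightarrow> 'a mpol fract" where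
  "fdiff i q = (SOME d. \<forall>a b. b \<noteq> 0 \<longrightarrow> q * to_fract b = to_fract a \<longrightarrow>
     d * to_fract b = pdiff i a - q * pdiff i b)"

lemma fdiff_mult_to_fract:
  assumes "b \<noteq> 0" "q * to_fract b = to_fract a"
  shows "fdiff i q * to_fract b = pdiff i a - q * pdiff i b"
proof -
  let ?P = "\<lambda>d. \<forall>a b. b \<noteq> 0 \<longrightarrow> q * to_fract b = to_fract a \<longrightarrow> d * to_fract b = pdiff i a - q * pdiff i b"
  have "?P ((pdiff i a - q * pdiff i b) / to_fract b)"
  proof (intro allI impI)
    fix a' b' assume *: "b' \<noteq> 0" "q * to_fract b' = to_fract a'"
    have "to_fract (a * b') = to_fract (a' * b)"
      using assms(2)[symmetric] *(2)[symmetric] by simp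
    then have "a * b' = a' * b" by (simp only: to_fract_eq_iff)
    then have "pdiff i (a * b') = pdiff i (a' * b)" by simp
    then have "(pdiff i a - q * pdiff i b) * to_fract b' = (pdiff i a' - q * pdiff i b') * to_fract b"
      unfolding pdiff_mult assms(2)[symmetric] *(2)[symmetric] by (simp add: algebra_simps)
    then show "(pdiff i a - q * pdiff i b) / to_fract b * to_fract b' = pdiff i a' - q * pdiff i b'"
      using assms(1) by (simp add: field_simps)
  qed
  then have "?P (fdiff i q)" unfolding fdiff_def by (rule someI)
  then show ?thesis using assms by blast
qed

lemma fdiff_to_fract: "fdiff i (to_fract p) = pdiff i p"
  using fdiff_mult_to_fract[of 1 "to_fract p" p i] by (simp add: pdiff_1)

lemma fdiff_add: "fdiff i (q + r) = fdiff i q + fdiff i r"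
  and fdiff_mult: "fdiff i (q * r) = fdiff i q * r + q * fdiff i r"
proof -
  obtain a b where q: "q = to_fract a / to_fract b" "b \<noteq> 0" by (rule fract_cases)
  obtain c d where r: "r = to_fract c / to_fract d" "d \<noteq> 0" by (rule fract_cases)
  have ac: "to_fract a = q * to_fract b" "to_fract c = r * to_fract d" using q r by simp_all
  have bd: "b * d \<noteq> 0" "to_fract (b * d) \<noteq> 0" using q r by simp_all
  note dq = fdiff_mult_to_fract[OF q(2) ac(1)[symmetric], of i]
  note dr = fdiff_mult_to_fract[OF r(2) ac(2)[symmetric], of i]
  have "fdiff i (q + r) * to_fract (b * d) = pdiff i (a * d + c * b) - (q + r) * pdiff i (b * d)"
    using ac by (intro fdiff_mult_to_fract bd) (simp add: algebra_simps)
  also have "\<dots> = (pdiff i a - q * pdiff i b) * to_fract d + (pdiff i c - r * pdiff i d) * to_fract b"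
    by (simp add: pdiff_add pdiff_mult ac algebra_simps)
  also have "\<dots> = (fdiff i q + fdiff i r) * to_fract (b * d)"
    unfolding dq[symmetric] dr[symmetric] by (simp add: algebra_simps)
  finally show "fdiff i (q + r) = fdiff i q + fdiff i r" using mult_right_cancel[OF bd(2)] by blast
  have "fdiff i (q * r) * to_fract (b * d) = pdiff i (a * c) - (q * r) * pdiff i (b * d)"
    using ac by (intro fdiff_mult_to_fract bd) simp
  also have "\<dots> = (pdiff i a - q * pdiff i b) * (r * to_fract d) + (pdiff i c - r * pdiff i d) * (q * to_fract b)"
    by (simp add: pdiff_mult ac algebra_simps)
  also have "\<dots> = (fdiff i q * r + q * fdiff i r) * to_fract (b * d)"
    unfolding dq[symmetric] dr[symmetric] by (simp add: algebra_simps)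
  finally show "fdiff i (q * r) = fdiff i q * r + q * fdiff i r" using mult_right_cancel[OF bd(2)] by blast
qed

lemma fdiff_const [simp]: "fdiff i (const c) = 0"
  by (simp add: fdiff_to_fract pdiff_Cst)

lemma fdiff_0 [simp]: "fdiff i 0 = 0" and fdiff_1 [simp]: "fdiff i 1 = 0"
  using fdiff_const[of i 0] fdiff_const[of i 1] by simp_all

lemma fdiff_sum: "fdiff i (sum f T) = (\<Sum>t\<in>T. fdiff i (f t))"
  by (induction T rule: infinite_finite_induct) (simp_all add: fdiff_add)

lemma fdiff_inverse:
  assumes "q \<noteq> 0"
  shows "fdiff i (inverse q) = - fdiff i q / q ^ 2"
proof -
  have "fdiff i (q * inverse q) = 0" using assms by simp
  then have "q * fdiff i (inverse q) = - (fdiff i q * inverse q)"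
    unfolding fdiff_mult by (simp add: eq_neg_iff_add_eq_0 add.commute)
  then show ?thesis using assms by (simp add: field_simps power2_eq_square)
qed

section \<open>Logarithmic derivatives of Laurent monomials\<close>

lemma fdiff_log_mult:
  assumes "q \<noteq> 0" "r \<noteq> 0"
  shows "fdiff i (q * r) / (q * r) = fdiff i q / q + fdiff i r / r"
  using assms by (simp add: fdiff_mult field_simps)

lemma fdiff_log_inverse: "q \<noteq> 0 \<Longrightarrow> fdiff i (inverse q) / inverse q = - (fdiff i q / q)"
  unfolding fdiff_inverse by (simp add: divide_inverse power2_eq_square)

lemma fdiff_log_power: "q \<noteq> 0 \<Longrightarrow> fdiff i (q ^ k) / q ^ k = of_nat k * (fdiff i q / q)"
proof (induction k)
  case (Suc k)
  then show ?case using fdiff_log_mult[of q "q ^ k" i] by (simp add: ring_distribs add_divide_distrib)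
qed simp

lemma fdiff_log_power_int:
  assumes "q \<noteq> 0"
  shows "fdiff i (q powi k) / q powi k = of_int k * (fdiff i q / q)"
proof (cases "k \<ge> 0")
  case True
  then show ?thesis using fdiff_log_power[OF assms, of i "nat k"] by (simp add: power_int_def)
next
  case False
  then show ?thesis using fdiff_log_power[of "inverse q" i "nat (- k)"] assms fdiff_log_inverse[OF assms, of i]
    by (simp add: power_int_def)
qed

lemma fdiff_log_prod:
  "(\<And>t. t \<in> T \<Longrightarrow> f t \<noteq> 0) \<Longrightarrow> fdiff i (prod f T) / prod f T = (\<Sum>t\<in>T. fdiff i (f t) / f t)"
proof (induction T rule: infinite_finite_induct)
  case (insert t T)
  then show ?case using fdiff_log_mult[of "f t" "prod f T" i] by simp
qed simp_all

text \<open>x_0 is a constant for the derivation with index \<open>Suc k\<close>, so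
  \<open>affine_coord k\<close> is the only factor that contributes.\<close>

lemma fdiff_log_row_monom:
  assumes "k < n"
  shows "fdiff (Suc k) (row_monom n r) / row_monom n r = of_int (r k) / (to_fract (Var (Suc k)) :: 'a::field mpol fract)"
proof -
  have coord: "fdiff (Suc k) (affine_coord j) / affine_coord j =
      (if j = k then 1 / (to_fract (Var (Suc k)) :: 'a mpol fract) else 0)" for j
    using fdiff_log_mult[of "to_fract (Var (Suc j)) :: 'a mpol fract" "inverse (to_fract (Var 0))" "Suc k"]
    unfolding affine_coord_def divide_inverse[of "to_fract (Var (Suc j))"]
    by (simp add: fdiff_inverse fdiff_to_fract pdiff_Var)
  have "fdiff (Suc k) (row_monom n r) / row_monom n r =
      (\<Sum>j<n. fdiff (Suc k) (affine_coord j powi r j) / (affine_coord j powi r j :: 'a mpol fract))"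
    unfolding row_monom_def by (rule fdiff_log_prod) (simp add: power_int_eq_0_iff)
  also have "\<dots> = (\<Sum>j<n. of_int (r j) * (if j = k then 1 / (to_fract (Var (Suc k)) :: 'a mpol fract) else 0))"
    by (simp only: fdiff_log_power_int[OF affine_coord_nonzero] coord)
  also have "\<dots> = (\<Sum>j<n. if j = k then of_int (r k) / (to_fract (Var (Suc k)) :: 'a mpol fract) else 0)"
    by (intro sum.cong) auto
  finally show ?thesis using assms by simp
qed

section \<open>The Jacobian invariant\<close>

text \<open>For forms of degree d, Euler's relation gives d * det = x_0 * J, where J is the full
  Jacobian determinant in x_0, ..., x_n. For a tuple with \<psi>_0 = 1 the determinant is the
  Jacobian determinant of \<psi>_1, ..., \<psi>_n in x_1, ..., x_n.\<close>

definition jac_mat :: "nat \<Rightarrow> (nat \<Rightarrow> 'a::field mpol fract) \<Rightarrow> 'a mpol fract mat" where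
  "jac_mat n \<psi> = mat (n + 1) (n + 1) (\<lambda>(i, j). if j = 0 then \<psi> i else fdiff j (\<psi> i))"

lemma jac_mat_carrier: "jac_mat n \<psi> \<in> carrier_mat (n + 1) (n + 1)"
  and jac_mat_carrier_Suc [simp]: "jac_mat n \<psi> \<in> carrier_mat (Suc n) (Suc n)"
  by (simp_all add: jac_mat_def)

lemma jac_mat_index: "i \<le> n \<Longrightarrow> j \<le> n \<Longrightarrow> jac_mat n \<psi> $$ (i, j) = (if j = 0 then \<psi> i else fdiff j (\<psi> i))"
  by (simp add: jac_mat_def)

lemma det_mat_diag: "det (mat_diag n f) = (\<Prod>i<n. f i)"
proof -
  have "det (mat_diag n f) = prod_list (diag_mat (mat_diag n f))"
    by (rule det_upper_triangular[of _ n]) (auto simp: mat_diag_def)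
  also have "\<dots> = (\<Prod>i<n. f i)" by (simp add: prod_list_diag_prod mat_diag_def lessThan_atLeast0)
  finally show ?thesis .
qed

lemma jac_mat_cong:
  assumes "\<And>i. i \<le> n \<Longrightarrow> \<phi> i = \<psi> i"
  shows "jac_mat n \<phi> = jac_mat n \<psi>"
  using assms by (intro eq_matI) (auto simp: jac_mat_def)

text \<open>By the product rule, each derivative column becomes c times itself plus a multiple of
  column 0, which is \<psi>. These column operations form the triangular matrix U with diagonal
  c.\<close>

lemma det_jac_mat_scale: "det (jac_mat n (\<lambda>i. c * \<psi> i)) = c ^ (n + 1) * det (jac_mat n \<psi>)"
proof -
  define U where "U = mat (n + 1) (n + 1) (\<lambda>(k, j). if k = j then c else if k = 0 then fdiff j c else 0)"
  have U: "U \<in> carrier_mat (n + 1) (n + 1)" by (simp add: U_def)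
  have "det U = prod_list (diag_mat U)"
    using U by (intro det_upper_triangular[of _ "n + 1"]) (auto simp: U_def)
  also have "\<dots> = c ^ (n + 1)" by (simp add: prod_list_diag_prod U_def)
  finally have detU: "det U = c ^ (n + 1)" .
  have "jac_mat n (\<lambda>i. c * \<psi> i) = jac_mat n \<psi> * U"
  proof (rule eq_matI)
    fix i j assume "i < dim_row (jac_mat n \<psi> * U)" "j < dim_col (jac_mat n \<psi> * U)"
    then have ij: "i \<le> n" "j \<le> n" by (auto simp: jac_mat_def U_def)
    then have "(jac_mat n \<psi> * U) $$ (i, j) = (\<Sum>k\<le>n. jac_mat n \<psi> $$ (i, k) * U $$ (k, j))"
      using U by (simp add: scalar_prod_def jac_mat_def atLeast0LessThan lessThan_Suc_atMost)
    \<comment> \<open>The second summand is 0 for j = 0, because the entry (0, 0) of U is already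
      counted in the first one.\<close>
    also have "\<dots> = (\<Sum>k\<le>n. (if k = j then jac_mat n \<psi> $$ (i, k) * c else 0) +
        (if k = 0 then if j = 0 then 0 else \<psi> i * fdiff j c else 0))"
      using ij by (intro sum.cong) (auto simp: U_def jac_mat_index)
    also have "\<dots> = jac_mat n (\<lambda>i. c * \<psi> i) $$ (i, j)"
      using ij by (simp add: sum.distrib jac_mat_index fdiff_mult algebra_simps)
    finally show "jac_mat n (\<lambda>i. c * \<psi> i) $$ (i, j) = (jac_mat n \<psi> * U) $$ (i, j)" by simp
  qed (auto simp: jac_mat_def U_def)
  then show ?thesis using det_mult[OF jac_mat_carrier U, of \<psi>] detU by simp
qed

lemma det_jac_mat_linear:
  assumes "M \<in> carrier (GL (n + 1))"
  obtains c where "c \<noteq> 0"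
    "\<And>\<psi>. det (jac_mat n (\<lambda>i. \<Sum>j\<le>n. const (M $$ (i, j)) * \<psi> j)) = const c * det (jac_mat n \<psi>)"
proof -
  have M: "M \<in> carrier_mat (n + 1) (n + 1)" using assms by (auto simp: carrier_GL)
  obtain N where N: "N \<in> carrier_mat (n + 1) (n + 1)" "M * N = 1\<^sub>m (n + 1)"
    using assms by (auto simp: carrier_GL)
  have "det M * det N = 1" using det_mult[OF M N(1)] N(2) by simp
  then have "det M \<noteq> 0" by auto
  moreover have "det (jac_mat n (\<lambda>i. \<Sum>j\<le>n. const (M $$ (i, j)) * \<psi> j)) = const (det M) * det (jac_mat n \<psi>)" for \<psi>
  proof -
    let ?M = "map_mat (\<lambda>c. const c) M"
    have "jac_mat n (\<lambda>i. \<Sum>j\<le>n. const (M $$ (i, j)) * \<psi> j) = ?M * jac_mat n \<psi>"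
    proof (rule eq_matI)
      fix i j assume "i < dim_row (?M * jac_mat n \<psi>)" "j < dim_col (?M * jac_mat n \<psi>)"
      then have ij: "i \<le> n" "j \<le> n" using M by (auto simp: jac_mat_def)
      then have "(?M * jac_mat n \<psi>) $$ (i, j) = (\<Sum>k\<le>n. const (M $$ (i, k)) * jac_mat n \<psi> $$ (k, j))"
        using M by (simp add: scalar_prod_def jac_mat_def atLeast0LessThan lessThan_Suc_atMost)
      then show "jac_mat n (\<lambda>i. \<Sum>j\<le>n. const (M $$ (i, j)) * \<psi> j) $$ (i, j) = (?M * jac_mat n \<psi>) $$ (i, j)"
        using ij by (simp add: jac_mat_index fdiff_sum fdiff_mult)
    qed (use M in \<open>auto simp: jac_mat_def\<close>)
    then show ?thesis
      using det_mult[of ?M "n + 1" "jac_mat n \<psi>"] M const.hom_det[of M] by simp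
  qed
  ultimately show thesis by (rule that)
qed

text \<open>Row i is divided by the square of \<psi>_i, also in column 0, where 1 / \<psi>_i =
  \<psi>_i / \<psi>_i^2; the n derivative columns change sign.\<close>

lemma det_jac_mat_inverse:
  assumes "\<And>i. i \<le> n \<Longrightarrow> \<psi> i \<noteq> 0"
  shows "det (jac_mat n (\<lambda>i. 1 / \<psi> i)) = const ((- 1) ^ n) * (\<Prod>i\<le>n. 1 / \<psi> i) ^ 2 * det (jac_mat n \<psi>)"
proof -
  let ?L = "mat_diag (n + 1) (\<lambda>i. (1 / \<psi> i) ^ 2)"
  let ?R = "mat_diag (n + 1) (\<lambda>j. if j = 0 then 1 else - 1 :: 'a mpol fract)"
  have diff: "fdiff j (1 / \<psi> i) = - ((1 / \<psi> i) ^ 2 * fdiff j (\<psi> i))" if "i < Suc n" for i j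
    using fdiff_inverse[of "\<psi> i" j] assms that by (simp add: divide_inverse power2_eq_square)
  have "jac_mat n (\<lambda>i. 1 / \<psi> i) = ?L * (jac_mat n \<psi> * ?R)"
    using assms
    by (subst mat_diag_mult_right[OF jac_mat_carrier], subst mat_diag_mult_left[of _ _ "n + 1"])
      (auto simp: jac_mat_def diff power2_eq_square intro!: eq_matI)
  moreover have "jac_mat n \<psi> * ?R \<in> carrier_mat (n + 1) (n + 1)"
    by (rule mult_carrier_mat[OF jac_mat_carrier mat_diag_dim])
  moreover have "(\<Prod>j<n + 1. if j = 0 then 1 else - 1 :: 'a mpol fract) = (- 1) ^ n"
    by (simp add: prod.lessThan_Suc_shift del: prod.lessThan_Suc)
  moreover have "const ((- 1) ^ n) = ((- 1) ^ n :: 'a mpol fract)"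
    using const.hom_power[of "- 1" n] by simp
  ultimately show ?thesis
    using det_mult[of ?L "n + 1" "jac_mat n \<psi> * ?R"] det_mult[of "jac_mat n \<psi>" "n + 1" ?R]
    by (simp add: det_mat_diag lessThan_Suc_atMost prod_power_distrib del: prod.lessThan_Suc)
qed

lemma det_jac_mat_Var: "det (jac_mat n (frac_tuple Var)) = to_fract (Var 0)"
proof -
  let ?J = "jac_mat n (frac_tuple Var)"
  have "det ?J = prod_list (diag_mat ?J)"
    by (rule det_lower_triangular[of "n + 1"]) (auto simp: jac_mat_def fdiff_to_fract pdiff_Var)
  also have "\<dots> = (\<Prod>i<Suc n. if i = 0 then to_fract (Var 0) else 1)"
    unfolding prod_list_diag_prod lessThan_atLeast0
    by (rule prod.cong) (auto simp: jac_mat_def fdiff_to_fract pdiff_Var)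
  finally show ?thesis by (simp add: prod.lessThan_Suc_shift del: prod.lessThan_Suc)
qed

text \<open>Rescaling a tuple by \<open>d\<close> multiplies the determinant by \<open>d ^ (n + 1)\<close>, which is a square since
  \<open>n\<close> is odd; linear maps multiply it by a constant, and inversion by a sign and a square.\<close>

lemma det_jac_mat_G_tuples:
  assumes "odd n" "\<psi> \<in> G_tuples n"
  shows "\<exists>c t. c \<noteq> 0 \<and> t \<noteq> 0 \<and> det (jac_mat n \<psi>) = const c * to_fract (Var 0) * t ^ 2"
  using assms(2)
proof (induction rule: G_tuples.induct)
  case Var
  show ?case by (rule exI[of _ 1], rule exI[of _ 1]) (simp add: det_jac_mat_Var)
next
  case (proportional \<psi> \<phi>)
  then obtain c t where ct: "c \<noteq> 0" "t \<noteq> 0" "det (jac_mat n \<psi>) = const c * to_fract (Var 0) * t ^ 2" by blast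
  obtain d where d: "d \<noteq> 0" "\<And>i. i \<le> n \<Longrightarrow> \<phi> i = d * \<psi> i"
    using proportional(2) by (auto simp: proportional_def)
  have "even (n + 1)" using assms(1) by simp
  then obtain m where m: "n + 1 = 2 * m" by (elim evenE)
  have "det (jac_mat n \<phi>) = d ^ (n + 1) * det (jac_mat n \<psi>)"
    using jac_mat_cong[OF d(2)] det_jac_mat_scale[of n d \<psi>] by simp
  also have "\<dots> = const c * to_fract (Var 0) * (d ^ m * t) ^ 2"
    unfolding m ct(3) power_even_eq by (simp add: power_mult_distrib ac_simps)
  finally show ?case using ct d(1) by (intro exI[of _ c] exI[of _ "d ^ m * t"]) simp
next
  case (linear \<psi> M)
  then obtain c t where ct: "c \<noteq> 0" "t \<noteq> 0" "det (jac_mat n \<psi>) = const c * to_fract (Var 0) * t ^ 2" by blast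
  obtain d where d: "d \<noteq> 0"
    "\<And>\<psi>. det (jac_mat n (\<lambda>i. \<Sum>j\<le>n. const (M $$ (i, j)) * \<psi> j)) = const d * det (jac_mat n \<psi>)"
    using det_jac_mat_linear[OF linear(2)] by blast
  show ?case using ct d by (intro exI[of _ "d * c"] exI[of _ t]) (simp add: mult.assoc)
next
  case (inverse \<psi>)
  then obtain c t where ct: "c \<noteq> 0" "t \<noteq> 0" "det (jac_mat n \<psi>) = const c * to_fract (Var 0) * t ^ 2" by blast
  have nz: "\<And>i. i \<le> n \<Longrightarrow> \<psi> i \<noteq> 0" by (rule G_tuples_nonzero[OF inverse(1)])
  have "det (jac_mat n (\<lambda>i. 1 / \<psi> i)) = const ((- 1) ^ n) * (\<Prod>i\<le>n. 1 / \<psi> i) ^ 2 * det (jac_mat n \<psi>)"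
    by (rule det_jac_mat_inverse[OF nz])
  also have "\<dots> = const ((- 1) ^ n * c) * to_fract (Var 0) * ((\<Prod>i\<le>n. 1 / \<psi> i) * t) ^ 2"
    unfolding ct(3) const_simps(5) power_mult_distrib by (simp only: ac_simps)
  finally have "det (jac_mat n (\<lambda>i. 1 / \<psi> i)) =
    const ((- 1) ^ n * c) * to_fract (Var 0) * ((\<Prod>i\<le>n. 1 / \<psi> i) * t) ^ 2" .
  moreover have "(\<Prod>i\<le>n. 1 / \<psi> i) * t \<noteq> 0" using ct nz by simp
  ultimately show ?case using ct(1) by (intro exI[of _ "(- 1) ^ n * c"] exI[of _ "(\<Prod>i\<le>n. 1 / \<psi> i) * t"]) simp
qed

definition twisted_tuple :: "nat \<Rightarrow> (nat \<Rightarrow> 'a) \<Rightarrow> (nat \<Rightarrow> nat \<Rightarrow> int) \<Rightarrow> nat \<Rightarrow> 'a::field mpol fract" where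
  "twisted_tuple n \<alpha> A k = (case k of 0 \<Rightarrow> 1 | Suc i \<Rightarrow> const (\<alpha> i) * row_monom n (A i))"

text \<open>Logarithmic differentiation factors the matrix as diag(\<psi>) B diag(1, 1/x_1, ...,
  1/x_n), where B is A bordered by a first column of ones and a first row (1, 0, ..., 0). Its
  determinant is that of A, namely 1 or - 1, and stays nonzero in every characteristic.\<close>

lemma det_jac_mat_twisted_tuple:
  assumes A: "A \<in> carrier (GL n)" and \<alpha>: "\<And>i. i < n \<Longrightarrow> \<alpha> i \<noteq> 0"
  obtains e where "e \<noteq> 0" "det (jac_mat n (twisted_tuple n \<alpha> (\<lambda>i j. A $$ (i, j)))) =
    const e * (\<Prod>i<n. row_monom n (\<lambda>j. A $$ (i, j))) * (\<Prod>j<n. inverse (to_fract (Var (Suc j))))"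
proof -
  let ?\<psi> = "twisted_tuple n \<alpha> (\<lambda>i j. A $$ (i, j))"
  let ?x = "\<lambda>j. inverse (to_fract (Var j)) :: 'a mpol fract"
  obtain C where C: "C \<in> carrier_mat n n" "A * C = 1\<^sub>m n" using A by (auto simp: carrier_GL)
  have Ac: "A \<in> carrier_mat n n" using A by (auto simp: carrier_GL)
  have "det A * det C = 1" using det_mult[OF Ac C(1)] C(2) by simp
  then have detA: "det A = 1 \<or> det A = - 1" using zmult_eq_1_iff[of "det A" "det C"] by blast
  define B where "B = four_block_mat (1\<^sub>m 1) (0\<^sub>m 1 n) (mat n 1 (\<lambda>_. 1)) A"
  have B: "B \<in> carrier_mat (n + 1) (n + 1)" unfolding B_def carrier_mat_def using Ac by simp
  have detB: "det B = det A"
    unfolding B_def using Ac by (subst det_four_block_mat_upper_right_zero[of _ 1 _ n]) auto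
  let ?B = "map_mat of_int B :: 'a mpol fract mat"
  let ?L = "mat_diag (n + 1) ?\<psi>" and ?R = "mat_diag (n + 1) (\<lambda>j. if j = 0 then 1 else ?x j)"
  have Bc: "?B \<in> carrier_mat (n + 1) (n + 1)" using B by simp
  have "jac_mat n ?\<psi> = ?L * (?B * ?R)"
  proof (subst mat_diag_mult_right[OF Bc], subst mat_diag_mult_left[of _ _ "n + 1"], simp, rule eq_matI)
    fix i j
    assume "i < dim_row (mat (n + 1) (n + 1) (\<lambda>(i, j). ?\<psi> i * mat (n + 1) (n + 1)
        (\<lambda>(i, j). ?B $$ (i, j) * (if j = 0 then 1 else ?x j)) $$ (i, j)))"
      and "j < dim_col (mat (n + 1) (n + 1) (\<lambda>(i, j). ?\<psi> i * mat (n + 1) (n + 1)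
        (\<lambda>(i, j). ?B $$ (i, j) * (if j = 0 then 1 else ?x j)) $$ (i, j)))"
    then have ij: "i \<le> n" "j \<le> n" by simp_all
    have Bij: "B $$ (i, j) = (if j = 0 then 1 else if i = 0 then 0 else A $$ (i - 1, j - 1))"
      using ij Ac by (auto simp: B_def)
    have "jac_mat n ?\<psi> $$ (i, j) = ?\<psi> i * (of_int (B $$ (i, j)) * (if j = 0 then 1 else ?x j))"
    proof (cases "i = 0 \<or> j = 0")
      case True
      then show ?thesis using ij by (auto simp: jac_mat_index Bij twisted_tuple_def)
    next
      case False
      then obtain i' j' where ij': "i = Suc i'" "j = Suc j'" by (metis not0_implies_Suc)
      let ?r = "row_monom n (\<lambda>j. A $$ (i', j)) :: 'a mpol fract"
      have "fdiff j ?r = ?r * (of_int (A $$ (i', j')) * ?x j)"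
        using fdiff_log_row_monom[of j' n "\<lambda>j. A $$ (i', j)", where 'a = 'a] ij ij' by (simp add: field_simps)
      moreover have "B $$ (Suc i', Suc j') = A $$ (i', j')" using Bij ij' by simp
      ultimately show ?thesis using ij ij' by (simp add: jac_mat_index twisted_tuple_def fdiff_mult)
    qed
    then show "jac_mat n ?\<psi> $$ (i, j) = mat (n + 1) (n + 1) (\<lambda>(i, j). ?\<psi> i * mat (n + 1) (n + 1)
        (\<lambda>(i, j). ?B $$ (i, j) * (if j = 0 then 1 else ?x j)) $$ (i, j)) $$ (i, j)"
      using ij B by simp
  qed (simp_all add: jac_mat_def)
  moreover have "?B * ?R \<in> carrier_mat (n + 1) (n + 1)" using Bc by (rule mult_carrier_mat) simp
  ultimately have "det (jac_mat n ?\<psi>) = det ?L * (det ?B * det ?R)"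
    using det_mult[of ?L "n + 1" "?B * ?R"] det_mult[of ?B "n + 1" ?R] Bc by simp
  also have "det ?B = of_int (det A)" using detB of_int_hom.hom_det[of B] by simp
  also have "det ?L = const (\<Prod>i<n. \<alpha> i) * (\<Prod>i<n. row_monom n (\<lambda>j. A $$ (i, j)))"
    by (simp add: det_mat_diag prod.lessThan_Suc_shift twisted_tuple_def prod.distrib const.hom_prod del: prod.lessThan_Suc)
  also have "det ?R = (\<Prod>j<n. ?x (Suc j))"
    by (simp add: det_mat_diag prod.lessThan_Suc_shift del: prod.lessThan_Suc)
  also have "of_int (det A) = const (of_int (det A))" using detA by auto
  finally have "det (jac_mat n ?\<psi>) = const ((\<Prod>i<n. \<alpha> i) * of_int (det A)) *
      (\<Prod>i<n. row_monom n (\<lambda>j. A $$ (i, j))) * (\<Prod>j<n. ?x (Suc j))"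
    by (simp add: ac_simps)
  moreover have "(\<Prod>i<n. \<alpha> i) * of_int (det A) \<noteq> 0" using \<alpha> detA by auto
  ultimately show thesis using that by blast
qed

text \<open>The square root t is an unknown rational function. The homomorphism
  \<open>lead_exponent (Suc j)\<close> sends its square to an even number and ignores constants and
  x_0.\<close>

lemma odd_columns_of_G_tuples:
  fixes \<alpha> :: "nat \<Rightarrow> 'a::field"
  assumes n: "odd n" and A: "A \<in> carrier (GL n)" and \<alpha>: "\<And>i. i < n \<Longrightarrow> \<alpha> i \<noteq> 0"
    and G: "twisted_tuple n \<alpha> (\<lambda>i j. A $$ (i, j)) \<in> G_tuples n"
  shows "odd_columns n (\<lambda>i j. A $$ (i, j))"
  unfolding odd_columns_def
proof (intro allI impI)
  fix j assume j: "j < n"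
  obtain e where e: "e \<noteq> 0" "det (jac_mat n (twisted_tuple n \<alpha> (\<lambda>i j. A $$ (i, j)))) =
    const e * (\<Prod>i<n. row_monom n (\<lambda>j. A $$ (i, j))) * (\<Prod>j<n. inverse (to_fract (Var (Suc j))))"
    by (rule det_jac_mat_twisted_tuple[OF A \<alpha>])
  obtain c t where ct: "c \<noteq> 0" "t \<noteq> 0"
      "det (jac_mat n (twisted_tuple n \<alpha> (\<lambda>i j. A $$ (i, j)))) = const c * to_fract (Var 0) * t ^ 2"
    using det_jac_mat_G_tuples[OF n G] by blast
  let ?y = "\<Prod>i<n. row_monom n (\<lambda>j. A $$ (i, j)) :: 'a mpol fract"
  let ?x = "\<Prod>j<n. inverse (to_fract (Var (Suc j) :: 'a mpol))"
  have "lead_exponent (Suc j) ?y = (\<Sum>i<n. lead_exponent (Suc j) (row_monom n (\<lambda>j. A $$ (i, j)) :: 'a mpol fract))"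
    by (rule lead_exponent_prod) (rule row_monom_nonzero)
  then have y: "lead_exponent (Suc j) ?y = (\<Sum>i<n. A $$ (i, j))"
    by (simp only: lead_exponent_row_monom[OF j])
  have "lead_exponent (Suc j) ?x = (\<Sum>k<n. lead_exponent (Suc j) (inverse (to_fract (Var (Suc k) :: 'a mpol))))"
    by (rule lead_exponent_prod) simp
  also have "\<dots> = (\<Sum>k<n. if k = j then - 1 else 0)"
    by (intro sum.cong) (auto simp: lead_exponent_inverse lead_exponent_Var)
  finally have x: "lead_exponent (Suc j) ?x = - 1" using j by simp
  have nz: "const e \<noteq> 0" "?y \<noteq> 0" "?x \<noteq> 0" using e(1) by simp_all
  have "lead_exponent (Suc j) (const e * ?y * ?x) = (\<Sum>i<n. A $$ (i, j)) - 1"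
    unfolding lead_exponent_mult[OF no_zero_divisors[OF nz(1,2)] nz(3)] lead_exponent_mult[OF nz(1,2)] x y
    using e(1) by simp
  moreover have "lead_exponent (Suc j) (const c * to_fract (Var 0) * t ^ 2) = 2 * lead_exponent (Suc j) t"
    using ct by (simp add: lead_exponent_mult lead_exponent_power lead_exponent_Var)
  ultimately have "(\<Sum>i<n. A $$ (i, j)) = 2 * lead_exponent (Suc j) t + 1"
    using e(2) ct(3) by simp
  then show "odd (\<Sum>i<n. A $$ (i, j))" by simp
qed

section \<open>The group of monomial transformations in $G_n$\<close>

abbreviation entries :: "'r mat \<Rightarrow> nat \<Rightarrow> nat \<Rightarrow> 'r" where
  "entries A \<equiv> \<lambda>i j. A $$ (i, j)"

abbreviation monomial_tuple :: "nat \<Rightarrow> 'a::field vec \<Rightarrow> int mat \<Rightarrow> nat \<Rightarrow> 'a mpol fract" where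
  "monomial_tuple n \<alpha> A \<equiv> twisted_tuple n (($) \<alpha>) (entries A)"

lemma monomial_map_eq: "monomial_map n (\<alpha>, A) = ratmap n (monomial_tuple n \<alpha> A)"
proof -
  have "(\<lambda>k. case k of 0 \<Rightarrow> 1 | Suc i \<Rightarrow> to_fract (Cst (\<alpha> $ i)) *
         (\<Prod>j<n. (to_fract (Var (Suc j)) / to_fract (Var 0)) powi (A $$ (i, j)))) = monomial_tuple n \<alpha> A"
    by (simp add: fun_eq_iff twisted_tuple_def row_monom_def affine_coord_def split: nat.split)
  then show ?thesis by (simp add: monomial_map_def)
qed

lemma twisted_tuple_0 [simp]: "twisted_tuple n \<alpha> A 0 = 1"
  and twisted_tuple_Suc [simp]: "twisted_tuple n \<alpha> A (Suc i) = const (\<alpha> i) * row_monom n (A i)"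
  by (simp_all add: twisted_tuple_def)

lemma mat_diag_GL:
  fixes f :: "nat \<Rightarrow> 'a::field"
  assumes "\<And>i. i < n \<Longrightarrow> f i \<noteq> 0"
  shows "mat_diag n f \<in> carrier (GL n)"
proof -
  have "mat_diag n (\<lambda>i. f i * inverse (f i)) = 1\<^sub>m n" "mat_diag n (\<lambda>i. inverse (f i) * f i) = 1\<^sub>m n"
    using assms by (auto simp: mat_diag_def intro!: eq_matI)
  then show ?thesis
    unfolding carrier_GL by (auto intro!: bexI[of _ "mat_diag n (\<lambda>i. inverse (f i))"])
qed

lemma twisted_tuple_G_tuples:
  fixes \<alpha> :: "nat \<Rightarrow> 'a::field"
  assumes "realisable TYPE('a) n A" "\<And>i. i < n \<Longrightarrow> \<alpha> i \<noteq> 0"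
  shows "twisted_tuple n \<alpha> A \<in> G_tuples n"
proof -
  let ?f = "\<lambda>k. case k of 0 \<Rightarrow> 1 | Suc i \<Rightarrow> \<alpha> i"
  have "mat_diag (n + 1) ?f \<in> carrier (GL (n + 1))"
    using assms(2) by (intro mat_diag_GL) (auto split: nat.split)
  from G_tuples.linear[OF assms(1)[unfolded realisable_def] this]
  have "(\<lambda>i. \<Sum>j\<le>n. const (mat_diag (n + 1) ?f $$ (i, j)) * monom_tuple n A j) \<in> G_tuples n" .
  moreover have "twisted_tuple n \<alpha> A k = (\<Sum>j\<le>n. const (mat_diag (n + 1) ?f $$ (k, j)) * monom_tuple n A j)"
    if "k \<le> n" for k
  proof -
    have "(\<Sum>j\<le>n. const (mat_diag (n + 1) ?f $$ (k, j)) * monom_tuple n A j) =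
        (\<Sum>j\<le>n. if j = k then const (?f k) * monom_tuple n A k else 0)"
      using that by (intro sum.cong) (auto simp: mat_diag_def)
    then show ?thesis using that by (cases k) auto
  qed
  then have "proportional n (twisted_tuple n \<alpha> A)
      (\<lambda>i. \<Sum>j\<le>n. const (mat_diag (n + 1) ?f $$ (i, j)) * monom_tuple n A j)"
    unfolding proportional_def by (intro exI[of _ 1]) simp
  ultimately show ?thesis by (rule G_tuples.proportional)
qed

lemma left_invertible_entries:
  assumes "A \<in> carrier (GL n)"
  shows "left_invertible 0 n (entries A)"
proof -
  obtain B where B: "B \<in> carrier_mat n n" "B * A = 1\<^sub>m n" and A: "A \<in> carrier_mat n n"
    using assms by (auto simp: carrier_GL)
  have "(\<Sum>t\<in>{0..<n}. B $$ (i, t) * A $$ (t, j)) = (if i = j then 1 else 0)" if "i < n" "j < n" for i j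
  proof -
    have "(\<Sum>t\<in>{0..<n}. B $$ (i, t) * A $$ (t, j)) = (B * A) $$ (i, j)"
      using A B(1) that by (simp add: scalar_prod_def)
    then show ?thesis using B(2) that by simp
  qed
  then show ?thesis unfolding left_invertible_def by (intro exI[of _ "entries B"]) auto
qed

lemma mem_GL_odd_iff: "A \<in> GL_odd n \<longleftrightarrow> A \<in> carrier (GL n) \<and> odd_columns n (entries A)"
  by (simp add: GL_odd_def odd_columns_def odd_card_iff_odd_column_sum)

lemma monomial_tuple_even:
  fixes \<alpha> :: "'a::field vec"
  assumes "CHAR('a) \<noteq> 2" "even n" "\<alpha> \<in> torus n" "A \<in> carrier (GL n)"
  shows "monomial_tuple n \<alpha> A \<in> G_tuples n"
  using assms(3) realisable_even[OF assms(1,2) left_invertible_entries[OF assms(4)]]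
  by (intro twisted_tuple_G_tuples) (auto simp: torus_def)

lemma monomial_tuple_odd:
  fixes \<alpha> :: "'a::field vec"
  assumes "CHAR('a) \<noteq> 2" "n \<ge> 2" "\<alpha> \<in> torus n" "A \<in> GL_odd n"
  shows "monomial_tuple n \<alpha> A \<in> G_tuples n"
  using assms(3,4) realisable_odd[OF assms(1,2) left_invertible_entries]
  by (intro twisted_tuple_G_tuples) (auto simp: torus_def mem_GL_odd_iff)

lemma monomial_map_mem_G_sub_iff: "monomial_map n (\<alpha>, A) \<in> G_sub n \<longleftrightarrow> monomial_tuple n \<alpha> A \<in> G_tuples n"
  unfolding monomial_map_eq by (rule ratmap_mem_G_sub_iff) (auto intro!: exI[of _ 0])

lemma monomial_map_G_sub_imp_odd:
  assumes "odd n" "\<alpha> \<in> torus n" "A \<in> carrier (GL n)" "monomial_map n (\<alpha>, A) \<in> G_sub n"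
  shows "A \<in> GL_odd n"
  using assms odd_columns_of_G_tuples[of n A "($) \<alpha>"]
  by (auto simp: monomial_map_mem_G_sub_iff mem_GL_odd_iff torus_def)

lemma exists_monomial_not_odd:
  assumes "n \<ge> 2"
  shows "\<exists>A. A \<in> carrier (GL n) \<and> A \<notin> GL_odd n"
proof -
  let ?A = "addrow_mat n 1 0 1 :: int mat"
  have "?A \<in> carrier (GL n)" unfolding GL_Units using assms by (intro addrow_mat_Unit) auto
  \<comment> \<open>Column 1 of this transvection has the entry 1 in rows 0 and 1 and zeros
    elsewhere, hence the sum 2.\<close>
  have "(\<Sum>i<n. ?A $$ (i, 1)) = (\<Sum>i\<in>{0, 1}. ?A $$ (i, 1))"
    using assms by (intro sum.mono_neutral_right) auto
  then have "\<not> odd (\<Sum>i<n. ?A $$ (i, 1))" using assms by simp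
  moreover have "1 < n" using assms by simp
  ultimately have "?A \<notin> GL_odd n" unfolding mem_GL_odd_iff odd_columns_def by blast
  with \<open>?A \<in> carrier (GL n)\<close> show ?thesis by blast
qed

section \<open>Composition and uniqueness of monomial maps\<close>

lemma const_inverse: "const (inverse c) = inverse (const c)"
proof (cases "c = 0")
  case False
  then have "const c * const (inverse c) = 1" by (simp flip: const_simps(5))
  then show ?thesis by (simp add: inverse_unique)
qed simp

lemma const_power_int: "const (c powi k) = const c powi k"
  by (simp add: power_int_def const_inverse const.hom_power)

lemma power_int_eq_divide:
  fixes x :: "'k::field"
  assumes "x \<noteq> 0"
  shows "x powi k = x ^ nat k / x ^ nat (- k)"
  using assms by (auto simp: power_int_def field_simps)

text \<open>Denominators are cleared in the proof because \<open>ev \<theta>\<close> is defined on polynomials only.\<close>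

lemma ev_eq_row_monom:
  assumes eq: "to_fract p = to_fract q * (const a * row_monom n r)"
    and \<theta>: "\<And>j. j \<le> n \<Longrightarrow> \<theta> j \<noteq> 0"
  shows "ev \<theta> p = ev \<theta> q * (const a * (\<Prod>j<n. (\<theta> (Suc j) / \<theta> 0) powi r j))"
proof -
  \<comment> \<open>N / D is the Laurent monomial with exponents r, its positive and negative powers
    separated.\<close>
  define N where "N = (\<Prod>j<n. Var (Suc j) ^ nat (r j) * Var 0 ^ nat (- r j) :: 'a mpol)"
  define D where "D = (\<Prod>j<n. Var 0 ^ nat (r j) * Var (Suc j) ^ nat (- r j) :: 'a mpol)"
  have quot: "(\<Prod>j<n. (\<theta> (Suc j) / \<theta> 0) powi r j) * ev \<theta> D = ev \<theta> N" "ev \<theta> D \<noteq> 0"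
    if \<theta>: "\<And>j. j \<le> n \<Longrightarrow> \<theta> j \<noteq> 0" for \<theta>
  proof -
    have *: "(\<theta> (Suc j) / \<theta> 0) powi k * (\<theta> 0 ^ nat k * \<theta> (Suc j) ^ nat (- k)) = \<theta> (Suc j) ^ nat k * \<theta> 0 ^ nat (- k)"
      if "j < n" for j k
      using \<theta>[of 0] \<theta>[of "Suc j"] that by (simp add: power_int_eq_divide power_divide field_simps)
    then show "(\<Prod>j<n. (\<theta> (Suc j) / \<theta> 0) powi r j) * ev \<theta> D = ev \<theta> N"
      unfolding N_def D_def ev.hom_prod prod.distrib[symmetric]
      by (intro prod.cong) (simp_all add: ev.hom_mult ev.hom_power)
    show "ev \<theta> D \<noteq> 0" using \<theta> by (simp add: D_def ev.hom_prod ev.hom_mult ev.hom_power)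
  qed
  \<comment> \<open>Read at the generic point, the quotient relation becomes an identity of
    polynomials, which may then be evaluated at \<theta>.\<close>
  have "row_monom n r * to_fract D = to_fract N"
    using quot(1)[of "frac_tuple Var"] by (simp add: ev_to_fract_Var row_monom_def affine_coord_def)
  then have "to_fract (p * D) = to_fract (q * (Cst a * N))" by (simp add: eq mult.assoc)
  then have "p * D = q * (Cst a * N)" by (simp only: to_fract_eq_iff)
  then have "ev \<theta> p * ev \<theta> D = ev \<theta> q * (const a * ev \<theta> N)"
    by (metis ev.hom_mult const.poly_eval_Cst)
  also have "\<dots> = ev \<theta> q * (const a * (\<Prod>j<n. (\<theta> (Suc j) / \<theta> 0) powi r j)) * ev \<theta> D"
    using quot(1)[of \<theta>, OF \<theta>] by (simp add: mult.assoc)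
  finally show ?thesis using mult_right_cancel[OF quot(2)[of \<theta>, OF \<theta>]] by blast
qed

lemma prod_power_int: "(\<Prod>t\<in>T. f t) powi k = (\<Prod>t\<in>T. f t powi k :: 'k::field)"
  by (induction T rule: infinite_finite_induct) (simp_all add: power_int_mult_distrib)

lemma power_int_sum: "x \<noteq> 0 \<Longrightarrow> x powi (\<Sum>t\<in>T. k t) = (\<Prod>t\<in>T. x powi k t :: 'k::field)"
  by (induction T rule: infinite_finite_induct) (simp_all add: power_int_add)

lemma prod_row_monom_power_int:
  "(\<Prod>j<n. row_monom n (B j) powi r j) = row_monom n (\<lambda>k. \<Sum>j<n. r j * B j k)"
proof -
  have "(\<Prod>j<n. row_monom n (B j) powi r j) = (\<Prod>j<n. \<Prod>k<n. affine_coord k powi (r j * B j k))"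
    unfolding row_monom_def prod_power_int by (simp add: power_int_mult[symmetric] mult.commute)
  also have "\<dots> = (\<Prod>k<n. \<Prod>j<n. affine_coord k powi (r j * B j k))" by (rule prod.swap)
  also have "\<dots> = row_monom n (\<lambda>k. \<Sum>j<n. r j * B j k)"
    unfolding row_monom_def by (simp add: power_int_sum)
  finally show ?thesis .
qed

lemma row_monom_cong: "(\<And>j. j < n \<Longrightarrow> r j = s j) \<Longrightarrow> row_monom n r = row_monom n s"
  unfolding row_monom_def by (intro prod.cong) auto

text \<open>As entry 0 of a monomial tuple is 1, the form \<open>f 0\<close> is a common denominator
  of a representative f; its value at the second tuple is the factor between the composite and the
  expected tuple.\<close>

lemma monomial_map_mult:
  fixes \<alpha> \<beta> :: "'a::field vec"
  assumes A: "A \<in> carrier_mat n n" and B: "B \<in> carrier_mat n n"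
    and \<phi>: "monomial_tuple n \<alpha> A \<in> G_tuples n" and \<theta>: "monomial_tuple n \<beta> B \<in> G_tuples n"
  shows "monomial_map n (\<alpha>, A) \<otimes>\<^bsub>Bir n\<^esub> monomial_map n (\<beta>, B) =
    monomial_map n (vec n (\<lambda>i. \<alpha> $ i * (\<Prod>j<n. (\<beta> $ j) powi (A $$ (i, j)))), A * B)"
proof -
  let ?\<phi> = "monomial_tuple n \<alpha> A" and ?\<theta> = "monomial_tuple n \<beta> B"
  let ?\<gamma> = "vec n (\<lambda>i. \<alpha> $ i * (\<Prod>j<n. (\<beta> $ j) powi (A $$ (i, j))))"
  obtain f where f: "f \<in> form_tuples n" "proportional n (frac_tuple f) ?\<phi>" "f \<in> ratmap n ?\<phi>"
    using G_tuples_dominant[OF \<phi>] by (rule dominantE)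
  have dom: "dominant n ?\<theta>" by (rule G_tuples_dominant[OF \<theta>])
  obtain c where c: "c \<noteq> 0" "\<And>k. k \<le> n \<Longrightarrow> to_fract (f k) = c * ?\<phi> k"
    using f(2) by (auto simp: proportional_def)
  then have fk: "to_fract (f k) = to_fract (f 0) * ?\<phi> k" if "k \<le> n" for k
    using that c(2)[of 0] c(2)[of k] by simp
  have f0: "f 0 \<noteq> 0" using c(2)[of 0] c(1) by auto
  obtain d where "form n d (f 0)" using f(1) by (auto simp: form_tuples_def)
  then have nz: "ev ?\<theta> (f 0) \<noteq> 0" using dominant_nonzero_form[OF dom] f0 by blast
  have "ev ?\<theta> (f k) = ev ?\<theta> (f 0) * monomial_tuple n ?\<gamma> (A * B) k" if k: "k \<le> n" for k
  proof (cases k)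
    case (Suc i)
    then have i: "i < n" using k by simp
    have "to_fract (f k) = to_fract (f 0) * (const (\<alpha> $ i) * row_monom n (\<lambda>j. A $$ (i, j)))"
      using fk[OF k] Suc by simp
    then have "ev ?\<theta> (f k) = ev ?\<theta> (f 0) * (const (\<alpha> $ i) * (\<Prod>j<n. (?\<theta> (Suc j) / ?\<theta> 0) powi (A $$ (i, j))))"
      by (rule ev_eq_row_monom) (rule dominant_nonzero[OF dom])
    also have "(\<Prod>j<n. (?\<theta> (Suc j) / ?\<theta> 0) powi (A $$ (i, j))) =
        const (\<Prod>j<n. (\<beta> $ j) powi (A $$ (i, j))) * row_monom n (\<lambda>k. \<Sum>j<n. A $$ (i, j) * B $$ (j, k))"
      by (simp add: power_int_mult_distrib prod.distrib const.hom_prod const_power_int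
          prod_row_monom_power_int[of n "\<lambda>j k. B $$ (j, k)", symmetric])
    also have "row_monom n (\<lambda>k. \<Sum>j<n. A $$ (i, j) * B $$ (j, k)) = row_monom n (\<lambda>k. (A * B) $$ (i, k))"
      using A B i by (intro row_monom_cong) (simp add: scalar_prod_def lessThan_atLeast0)
    finally show ?thesis using Suc i by (simp add: mult.assoc)
  qed simp
  then have "proportional n (\<lambda>k. ev ?\<theta> (f k)) (monomial_tuple n ?\<gamma> (A * B))"
    unfolding proportional_def using nz by blast
  moreover have "ratmap n ?\<phi> \<otimes>\<^bsub>Bir n\<^esub> ratmap n ?\<theta> = ratmap n (\<lambda>k. ev ?\<theta> (f k))"
    using f(3) G_tuples_nonzero[OF \<phi>] dom by (intro comp_ratmap) auto
  ultimately show ?thesis unfolding monomial_map_eq by (simp add: ratmap_cong_proportional)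
qed

text \<open>The factor between the two tuples is 1 because both have entry 0 equal to 1. Leading
  exponents then recover the matrix, and cancelling the monomials recovers the scalars.\<close>

lemma monomial_map_inject:
  fixes \<alpha> \<beta> :: "'a::field vec"
  assumes A: "A \<in> carrier_mat n n" "B \<in> carrier_mat n n" and \<alpha>: "\<alpha> \<in> torus n" "\<beta> \<in> torus n"
    and \<phi>: "monomial_tuple n \<alpha> A \<in> G_tuples n" and \<theta>: "monomial_tuple n \<beta> B \<in> G_tuples n"
    and eq: "monomial_map n (\<alpha>, A) = monomial_map n (\<beta>, B)"
  shows "\<alpha> = \<beta> \<and> A = B"
proof -
  let ?\<phi> = "monomial_tuple n \<alpha> A" and ?\<theta> = "monomial_tuple n \<beta> B"
  obtain f where "f \<in> ratmap n ?\<phi>" using G_tuples_dominant[OF \<phi>] by (rule dominantE)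
  then have "f \<in> ratmap n ?\<phi>" "f \<in> ratmap n ?\<theta>" using eq by (simp_all add: monomial_map_eq)
  then have "proportional n (frac_tuple f) ?\<phi>" "proportional n (frac_tuple f) ?\<theta>"
    using G_tuples_dominant[OF \<phi>] G_tuples_dominant[OF \<theta>] by (simp_all add: mem_ratmap_dominant_iff)
  then have "proportional n ?\<phi> ?\<theta>" by (rule proportional_trans[OF proportional_sym])
  then obtain c where c: "c \<noteq> 0" "\<And>k. k \<le> n \<Longrightarrow> ?\<phi> k = c * ?\<theta> k" by (auto simp: proportional_def)
  have "c = 1" using c(2)[of 0] by simp
  then have row: "const (\<alpha> $ i) * row_monom n (\<lambda>j. A $$ (i, j)) = const (\<beta> $ i) * row_monom n (\<lambda>j. B $$ (i, j))"
    if "i < n" for i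
    using c(2)[of "Suc i"] that by simp
  have nz: "const (\<alpha> $ i) \<noteq> 0" "const (\<beta> $ i) \<noteq> 0" if "i < n" for i
    using \<alpha> that by (auto simp: torus_def)
  have AB: "A $$ (i, j) = B $$ (i, j)" if i: "i < n" and j: "j < n" for i j
  proof -
    have "lead_exponent (Suc j) (const (\<alpha> $ i) * row_monom n (\<lambda>j. A $$ (i, j))) = A $$ (i, j)"
      "lead_exponent (Suc j) (const (\<beta> $ i) * row_monom n (\<lambda>j. B $$ (i, j))) = B $$ (i, j)"
      using nz[OF i] by (simp_all add: lead_exponent_mult lead_exponent_row_monom[OF j])
    then show ?thesis using row[OF i] by metis
  qed
  then have "A = B" using A by (intro eq_matI) auto
  moreover have "\<alpha> = \<beta>"
  proof (rule eq_vecI)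
    fix i assume "i < dim_vec \<beta>"
    then have i: "i < n" using \<alpha> by (auto simp: torus_def)
    have "const (\<alpha> $ i) = const (\<beta> $ i)" using row[OF i] \<open>A = B\<close> by simp
    then have "Cst (\<alpha> $ i - \<beta> $ i) = 0" by (simp add: Cst.hom_minus)
    then show "\<alpha> $ i = \<beta> $ i" by simp
  qed (use \<alpha> in \<open>auto simp: torus_def\<close>)
  ultimately show ?thesis by simp
qed

section \<open>The monomial transformations inside G_n\<close>

lemma torus_semidirect_simps:
  "carrier (torus_semidirect n H) = torus n \<times> H"
  "(\<alpha>, A) \<otimes>\<^bsub>torus_semidirect n H\<^esub> (\<beta>, B) =
    (vec n (\<lambda>i. \<alpha> $ i * (\<Prod>j<n. (\<beta> $ j) powi (A $$ (i, j)))), A * B)"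
  by (simp_all add: torus_semidirect_def)

lemma Monomial_eq: "Monomial n = monomial_map n ` (torus n \<times> carrier (GL n))"
  by (simp add: Monomial_def torus_semidirect_simps)

lemma Monomial_subset_G_sub:
  assumes "even n" "CHAR('a::field) \<noteq> 2"
  shows "(Monomial n :: (nat \<Rightarrow> 'a mpol) set set) \<subseteq> G_sub n"
  using monomial_tuple_even[OF assms(2,1)] by (auto simp: Monomial_eq monomial_map_mem_G_sub_iff)

lemma Monomial_not_subset_G_sub:
  assumes "odd n" "n \<ge> 2"
  shows "\<exists>\<phi> \<in> (Monomial n :: (nat \<Rightarrow> 'a::field mpol) set set). \<phi> \<notin> G_sub n"
proof -
  obtain A where A: "A \<in> carrier (GL n)" "A \<notin> GL_odd n" using exists_monomial_not_odd[OF assms(2)] by blast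
  have one: "(vec n (\<lambda>_. 1) :: 'a vec) \<in> torus n" by (auto simp: torus_def)
  have "monomial_map n (vec n (\<lambda>_. 1) :: 'a vec, A) \<notin> G_sub n"
    using monomial_map_G_sub_imp_odd[OF assms(1) one A(1)] A(2) by blast
  then show ?thesis using one A(1) by (auto simp: Monomial_eq)
qed

lemma Monomial_Int_G_sub:
  assumes "odd n" "n \<ge> 2" "CHAR('a::field) \<noteq> 2"
  shows "(Monomial n :: (nat \<Rightarrow> 'a mpol) set set) \<inter> G_sub n = monomial_map n ` (torus n \<times> GL_odd n)"
proof
  show "(Monomial n :: (nat \<Rightarrow> 'a mpol) set set) \<inter> G_sub n \<subseteq> monomial_map n ` (torus n \<times> GL_odd n)"
    using monomial_map_G_sub_imp_odd[OF assms(1)] by (auto simp: Monomial_eq)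
  show "monomial_map n ` (torus n \<times> GL_odd n) \<subseteq> (Monomial n :: (nat \<Rightarrow> 'a mpol) set set) \<inter> G_sub n"
    using monomial_tuple_odd[OF assms(3,2)]
    by (auto simp: Monomial_eq monomial_map_mem_G_sub_iff mem_GL_odd_iff)
qed

lemma monomial_map_iso:
  assumes "odd n" "n \<ge> 2" "CHAR('a::field) \<noteq> 2"
  shows "monomial_map n \<in> iso (torus_semidirect n (GL_odd n))
    ((Bir n :: (nat \<Rightarrow> 'a mpol) set monoid)\<lparr>carrier := Monomial n \<inter> G_sub n\<rparr>)"
proof (rule isoI)
  have car: "A \<in> carrier_mat n n" if "A \<in> GL_odd n" for A
    using that by (auto simp: mem_GL_odd_iff carrier_GL)
  note mem = monomial_tuple_odd[OF assms(3,2)]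
  show "monomial_map n \<in> hom (torus_semidirect n (GL_odd n))
    ((Bir n :: (nat \<Rightarrow> 'a mpol) set monoid)\<lparr>carrier := Monomial n \<inter> G_sub n\<rparr>)"
  proof (rule homI)
    fix x :: "'a vec \<times> int mat" assume "x \<in> carrier (torus_semidirect n (GL_odd n))"
    then show "monomial_map n x \<in> carrier ((Bir n :: (nat \<Rightarrow> 'a mpol) set monoid)\<lparr>carrier := Monomial n \<inter> G_sub n\<rparr>)"
      using Monomial_Int_G_sub[OF assms] by (auto simp: torus_semidirect_simps)
  next
    fix x y :: "'a vec \<times> int mat"
    assume "x \<in> carrier (torus_semidirect n (GL_odd n))" "y \<in> carrier (torus_semidirect n (GL_odd n))"
    moreover obtain \<alpha> A \<beta> B where "x = (\<alpha>, A)" "y = (\<beta>, B)" by (metis surj_pair)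
    ultimately show "monomial_map n (x \<otimes>\<^bsub>torus_semidirect n (GL_odd n)\<^esub> y) = monomial_map n x
        \<otimes>\<^bsub>(Bir n :: (nat \<Rightarrow> 'a mpol) set monoid)\<lparr>carrier := Monomial n \<inter> G_sub n\<rparr>\<^esub> monomial_map n y"
      using monomial_map_mult[of A n B \<alpha> \<beta>] mem car by (simp add: torus_semidirect_simps)
  qed
  have "inj_on (monomial_map n :: 'a vec \<times> int mat \<Rightarrow> _) (torus n \<times> GL_odd n)"
  proof (rule inj_onI)
    fix x y :: "'a vec \<times> int mat"
    assume *: "x \<in> torus n \<times> GL_odd n" "y \<in> torus n \<times> GL_odd n" "monomial_map n x = monomial_map n y"
    obtain \<alpha> A \<beta> B where "x = (\<alpha>, A)" "y = (\<beta>, B)" by (metis surj_pair)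
    then show "x = y" using monomial_map_inject[of A n B \<alpha> \<beta>] * mem car by auto
  qed
  then show "bij_betw (monomial_map n) (carrier (torus_semidirect n (GL_odd n)))
      (carrier ((Bir n :: (nat \<Rightarrow> 'a mpol) set monoid)\<lparr>carrier := Monomial n \<inter> G_sub n\<rparr>))"
    using Monomial_Int_G_sub[OF assms] by (simp add: bij_betw_def torus_semidirect_simps)
qed

theorem theorem1:
  fixes n :: nat
  assumes "n \<ge> 2"
  shows
    "(even n \<and> CHAR('a::field) \<noteq> 2 \<longrightarrow>
        (Monomial n :: (nat \<Rightarrow> 'a mpol) set set) \<subseteq> G_sub n) \<and>
     (odd n \<longrightarrow>
        (\<exists>\<phi> \<in> (Monomial n :: (nat \<Rightarrow> 'a mpol) set set). \<phi> \<notin> G_sub n)) \<and>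
     (odd n \<and> CHAR('a) \<noteq> 2 \<longrightarrow>
        (Monomial n :: (nat \<Rightarrow> 'a mpol) set set) \<inter> G_sub n =
          monomial_map n ` carrier (torus_semidirect n (GL_odd n)) \<and>
        monomial_map n \<in> iso (torus_semidirect n (GL_odd n))
          ((Bir n :: (nat \<Rightarrow> 'a mpol) set monoid)\<lparr>carrier := Monomial n \<inter> G_sub n\<rparr>))"
  using Monomial_subset_G_sub[of n, where 'a = 'a] Monomial_not_subset_G_sub[of n, where 'a = 'a]
    Monomial_Int_G_sub[of n, where 'a = 'a] monomial_map_iso[of n, where 'a = 'a] assms
  by (auto simp only: torus_semidirect_simps)

end
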